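(* Let $X$ be a fat CW complex and $\mathcal{U}$ an open covering of $X$ (with respect to the $D$-topology). Then there is a smooth partition of unity on $X$ subordinate to $\mathcal{U}$, i.e. a family of smooth functions $\rho_U:X\to[0,1]$, $U\in\mathcal{U}$, with $\operatorname{supp}\rho_U\subset U$, the supports forming a locally finite family, and $\sum_{U\in\mathcal{U}}\rho_U=1$.
   Context: Smooth functions on a diffeological space $X$ are smooth maps $X\to\mathbb{R}$. The $D$-topology of $X$: $O\subset X$ is open iff $P^{-1}(O)$ is open for every plot $P$. Let $\ell(t)=0$ for $t\le0$, $e^{-1/t}$ for $t>0$; $\alpha_0=\int_0^1\ell(3x)\ell(3-3x)dx$; $\lambda(t)=\frac1{\alpha_0}\int_0^t\ell(3x)\ell(3-3x)dx$; $\phi(t)=\int_0^{1/2+t}\lambda(x)dx$. For integers $n,m\ge0$: $\mathbb{D}^{n,m}=\{(u,v)\in\mathbb{R}^n\times\mathbb{R}^m:\|u\|\ge1-\phi(2-\|u\|-\|v\|)\}$, $\mathbb{S}^{n-1,m}=\{(u,v):\|u\|\ge1\}$ (empty for $n=0$), with subset diffeologies. A fat CW complex is a diffeological space $X$ with subspaces $\emptyset=X^{(-1)}\subset X^{(0)}\subset\cdots$, index sets $J_n$, maps $m_n:J_n\to\mathbb{N}_0$ and smooth maps $h_n:\coprod_{j\in J_n}\mathbb{S}^{n-1,m_n(j)}\to X^{(n-1)}$ such that each $X^{(n)}$ is the pushout in diffeological spaces of the inclusion $\coprod_j\mathbb{S}^{n-1,m_n(j)}\hookrightarrow\coprod_j\mathbb{D}^{n,m_n(j)}$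 and $h_n$, and $X$ is the diffeological colimit of the $X^{(n)}$. *)

theory Defs
  imports "HOL-Analysis.Analysis"
begin

text \<open>R^n is represented as the functions nat => real vanishing at all indices >= n;
  coordinates are x 0, ..., x (n-1).\<close>

definition euc :: "nat \<Rightarrow> (nat \<Rightarrow> real) set" where
  "euc n = {x. \<forall>i\<ge>n. x i = 0}"

definition edist :: "nat \<Rightarrow> (nat \<Rightarrow> real) \<Rightarrow> (nat \<Rightarrow> real) \<Rightarrow> real" where
  "edist n x y = sqrt (\<Sum>i<n. (x i - y i)\<^sup>2)"

definition open_euc :: "nat \<Rightarrow> (nat \<Rightarrow> real) set \<Rightarrow> bool" where
  "open_euc n U \<longleftrightarrow> U \<subseteq> euc n \<and>
     (\<forall>x\<in>U. \<exists>e>0. \<forall>y\<in>euc n. edist n x y < e \<longrightarrow> y \<in> U)"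

definition cont_euc :: "nat \<Rightarrow> (nat \<Rightarrow> real) set \<Rightarrow> ((nat \<Rightarrow> real) \<Rightarrow> real) \<Rightarrow> bool" where
  "cont_euc n U f \<longleftrightarrow>
     (\<forall>x\<in>U. \<forall>e>0. \<exists>d>0. \<forall>y\<in>U. edist n x y < d \<longrightarrow> \<bar>f y - f x\<bar> < e)"

coinductive smooth_fun :: "nat \<Rightarrow> (nat \<Rightarrow> real) set \<Rightarrow> ((nat \<Rightarrow> real) \<Rightarrow> real) \<Rightarrow> bool"
  for n :: nat and U :: "(nat \<Rightarrow> real) set" where
  "cont_euc n U f \<Longrightarrow>
   (\<forall>i<n. \<forall>x\<in>U. ((\<lambda>t. f (x(i := x i + t))) has_real_derivative g i x) (at 0)) \<Longrightarrow>
   (\<forall>i<n. smooth_fun n U (g i)) \<Longrightarrow> smooth_fun n U f"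

definition smooth_map :: "nat \<Rightarrow> (nat \<Rightarrow> real) set \<Rightarrow> nat \<Rightarrow> ((nat \<Rightarrow> real) \<Rightarrow> (nat \<Rightarrow> real)) \<Rightarrow> bool" where
  "smooth_map k U N F \<longleftrightarrow> (\<forall>x\<in>U. F x \<in> euc N) \<and> (\<forall>i<N. smooth_fun k U (\<lambda>x. F x i))"

text \<open>A family of plots: Pl k U P means P : U -> X is a plot, U open in R^k.\<close>
type_synonym 'a plots = "nat \<Rightarrow> (nat \<Rightarrow> real) set \<Rightarrow> ((nat \<Rightarrow> real) \<Rightarrow> 'a) \<Rightarrow> bool"

definition diffeology :: "'a set \<Rightarrow> 'a plots \<Rightarrow> bool" where
  "diffeology X Pl \<longleftrightarrow>
     (\<forall>k U P. Pl k U P \<longrightarrow> open_euc k U \<and> P ` U \<subseteq> X) \<and>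
     (\<forall>k U P Q. Pl k U P \<longrightarrow> (\<forall>u\<in>U. P u = Q u) \<longrightarrow> Pl k U Q) \<and>
     (\<forall>k U x. open_euc k U \<longrightarrow> x \<in> X \<longrightarrow> Pl k U (\<lambda>_. x)) \<and>
     (\<forall>k U P. open_euc k U \<longrightarrow> P ` U \<subseteq> X \<longrightarrow>
        (\<forall>u\<in>U. \<exists>V. open_euc k V \<and> u \<in> V \<and> V \<subseteq> U \<and> Pl k V P) \<longrightarrow> Pl k U P) \<and>
     (\<forall>k U P j V F. Pl k U P \<longrightarrow> open_euc j V \<longrightarrow> smooth_map j V k F \<longrightarrow> F ` V \<subseteq> U \<longrightarrow>
        Pl j V (P \<circ> F))"

definition subset_plot :: "'a plots \<Rightarrow> 'a set \<Rightarrow> 'a plots" where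
  "subset_plot Pl A k U P \<longleftrightarrow> Pl k U P \<and> P ` U \<subseteq> A"

definition euc_plot :: "nat \<Rightarrow> (nat \<Rightarrow> real) set \<Rightarrow> (nat \<Rightarrow> real) plots" where
  "euc_plot N S k U Q \<longleftrightarrow> open_euc k U \<and> smooth_map k U N Q \<and> Q ` U \<subseteq> S"

definition smooth_real :: "'a plots \<Rightarrow> ('a \<Rightarrow> real) \<Rightarrow> bool" where
  "smooth_real Pl f \<longleftrightarrow> (\<forall>k U P. Pl k U P \<longrightarrow> smooth_fun k U (f \<circ> P))"

definition D_open :: "'a set \<Rightarrow> 'a plots \<Rightarrow> 'a set \<Rightarrow> bool" where
  "D_open X Pl W \<longleftrightarrow> W \<subseteq> X \<and> (\<forall>k U P. Pl k U P \<longrightarrow> open_euc k {u\<in>U. P u \<in> W})"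

definition D_closure :: "'a set \<Rightarrow> 'a plots \<Rightarrow> 'a set \<Rightarrow> 'a set" where
  "D_closure X Pl A = \<Inter>{C. C \<subseteq> X \<and> D_open X Pl (X - C) \<and> A \<subseteq> C}"

definition D_support :: "'a set \<Rightarrow> 'a plots \<Rightarrow> ('a \<Rightarrow> real) \<Rightarrow> 'a set" where
  "D_support X Pl f = D_closure X Pl {x\<in>X. f x \<noteq> 0}"

definition ell :: "real \<Rightarrow> real" where
  "ell t = (if t \<le> 0 then 0 else exp (- 1 / t))"

definition alpha0 :: real where
  "alpha0 = integral {0..1} (\<lambda>x. ell (3 * x) * ell (3 - 3 * x))"

text \<open>For t < 0 the interval {0..t} is empty; the integral is 0, which agrees with the
  oriented integral since the integrand vanishes on [t,0].\<close>
definition lam :: "real \<Rightarrow> real" where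
  "lam t = integral {0..t} (\<lambda>x. ell (3 * x) * ell (3 - 3 * x)) / alpha0"

definition phi :: "real \<Rightarrow> real" where
  "phi t = integral {0..1/2 + t} lam"

text \<open>A point of R^n x R^m is w \<in> euc (n+m): u = (w 0,...,w(n-1)), v = (w n,...,w(n+m-1)).\<close>
definition unorm :: "nat \<Rightarrow> (nat \<Rightarrow> real) \<Rightarrow> real" where
  "unorm n w = sqrt (\<Sum>i<n. (w i)\<^sup>2)"

definition vnorm :: "nat \<Rightarrow> nat \<Rightarrow> (nat \<Rightarrow> real) \<Rightarrow> real" where
  "vnorm n m w = sqrt (\<Sum>i<m. (w (n + i))\<^sup>2)"

definition fat_disk :: "nat \<Rightarrow> nat \<Rightarrow> (nat \<Rightarrow> real) set" where
  "fat_disk n m = {w \<in> euc (n + m). unorm n w \<ge> 1 - phi (2 - unorm n w - vnorm n m w)}"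

definition fat_sphere :: "nat \<Rightarrow> nat \<Rightarrow> (nat \<Rightarrow> real) set" where
  "fat_sphere n m = {w \<in> euc (n + m). unorm n w \<ge> 1}"

definition prev_skel :: "(nat \<Rightarrow> 'a set) \<Rightarrow> nat \<Rightarrow> 'a set" where
  "prev_skel Sk n = (if n = 0 then {} else Sk (n - 1))"

text \<open>B (with subset diffeology) is the pushout of the inclusion of the disjoint union of the
  fat spheres S^{n-1,mn j} into the disjoint union of the fat disks D^{n,mn j}, j \<in> Jn,
  along hn into A (with subset diffeology); chi j are the induced maps D^{n,mn j} -> B.\<close>
definition pushout_cond ::
  "'a set \<Rightarrow> 'a plots \<Rightarrow> nat \<Rightarrow> 'a set \<Rightarrow> 'a set \<Rightarrow> 'j set \<Rightarrow> ('j \<Rightarrow> nat) \<Rightarrow>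
   ('j \<Rightarrow> (nat \<Rightarrow> real) \<Rightarrow> 'a) \<Rightarrow> ('j \<Rightarrow> (nat \<Rightarrow> real) \<Rightarrow> 'a) \<Rightarrow> bool" where
  "pushout_cond X Pl n A B Jn mn hn chi \<longleftrightarrow>
     A \<subseteq> B \<and> B \<subseteq> X \<and>
     \<comment> \<open>h_n is a smooth map from the disjoint union of fat spheres into A\<close>
     (\<forall>j\<in>Jn. hn j ` fat_sphere n (mn j) \<subseteq> A) \<and>
     (\<forall>j\<in>Jn. \<forall>k U Q. euc_plot (n + mn j) (fat_sphere n (mn j)) k U Q \<longrightarrow>
        subset_plot Pl A k U (hn j \<circ> Q)) \<and>
     \<comment> \<open>pushout of underlying sets\<close>
     (\<forall>j\<in>Jn. \<forall>s\<in>fat_sphere n (mn j). chi j s = hn j s) \<and>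
     B = A \<union> (\<Union>j\<in>Jn. chi j ` fat_disk n (mn j)) \<and>
     (\<forall>j\<in>Jn. \<forall>j'\<in>Jn. \<forall>x\<in>fat_disk n (mn j) - fat_sphere n (mn j).
        \<forall>y\<in>fat_disk n (mn j') - fat_sphere n (mn j'). chi j x = chi j' y \<longrightarrow> j = j' \<and> x = y) \<and>
     (\<forall>j\<in>Jn. \<forall>x\<in>fat_disk n (mn j) - fat_sphere n (mn j). chi j x \<notin> A) \<and>
     \<comment> \<open>the diffeology of B is the quotient of the coproduct diffeology\<close>
     (\<forall>k U P. open_euc k U \<longrightarrow>
        (subset_plot Pl B k U P \<longleftrightarrow>
          P ` U \<subseteq> B \<and>
          (\<forall>u\<in>U. \<exists>V. open_euc k V \<and> u \<in> V \<and> V \<subseteq> U \<and>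
             (subset_plot Pl A k V P \<or>
              (\<exists>j\<in>Jn. \<exists>Q. euc_plot (n + mn j) (fat_disk n (mn j)) k V Q \<and>
                 (\<forall>x\<in>V. P x = chi j (Q x)))))))"

definition fat_CW :: "'a set \<Rightarrow> 'a plots \<Rightarrow> (nat \<Rightarrow> 'a set) \<Rightarrow> (nat \<Rightarrow> 'j set) \<Rightarrow>
    (nat \<Rightarrow> 'j \<Rightarrow> nat) \<Rightarrow> (nat \<Rightarrow> 'j \<Rightarrow> (nat \<Rightarrow> real) \<Rightarrow> 'a) \<Rightarrow> bool" where
  "fat_CW X Pl Sk J m h \<longleftrightarrow>
     diffeology X Pl \<and>
     (\<forall>n. \<exists>chi. pushout_cond X Pl n (prev_skel Sk n) (Sk n) (J n) (m n) (h n) chi) \<and>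
     \<comment> \<open>X is the colimit of the skeleta\<close>
     X = (\<Union>n. Sk n) \<and>
     (\<forall>k U P. Pl k U P \<longrightarrow>
        (\<forall>u\<in>U. \<exists>V n. open_euc k V \<and> u \<in> V \<and> V \<subseteq> U \<and> P ` V \<subseteq> Sk n))"

end

theory Submission
  imports Defs
begin

text \<open>A smooth function on the fat sphere extends to the fat disk: in the coordinate \<open>s = \<parallel>u\<parallel> - 1\<close>
  it is smooth up to the boundary of the half space \<open>s \<ge> 0\<close> by Whitney's argument for even functions
  (only its composites with plots such as \<open>s = t\<^sup>2\<close> are known to be smooth), and Seeley's reflection
  extends it to \<open>s < 0\<close>. Hence smooth functions, together with open sets prescribed to contain their
  nonnegative loci, extend over one skeleton after another. Start on each level \<open>n\<close> with countably many
  bump functions on every open \<open>n\<close>-cell, each carried by a member of the cover; bumps of different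
  cells with the same index form one function, and the cells are kept apart by disjoint open
  neighbourhoods. This leaves countably many functions on \<open>X\<close> whose positivity sets cover \<open>X\<close>, and
  the usual damping of each by its predecessors makes them locally finite.\<close>

section \<open>Differentiability in finitely many coordinates\<close>

text \<open>Two obstacles shape the argument. An open cell of level n is open in its skeleton but in
  general not in X, so a function on it says nothing about neighbourhoods in X until it has been
  continued over all later cells. And \<open>J n\<close> may be uncountable, so X itself offers no
  countability; only each single disk does, through Lindelof's theorem. This is why bumps are
  indexed inside their cell and merged across cells. The first obstacle is met by tracking signs.
  Bumps run from -1 to 1, and each extension preserves the invariant that the closed set where the
  function is nonnegative lies in a prescribed open set of X. Composition with \<open>ell\<close>
  then yields a function whose support lies in that open set. Extension over a cell succeeds because
  the fat sphere is a closed region bounded by a smooth hypersurface, so that only one variable, the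
  radius, has to be reflected. Arguments with balls need the D-topologies of sphere and disk to be
  subspace topologies. The boundary obstructs this, and explicit plots with continuous sections
  overcome it.\<close>

lemma euc_upd [simp]: "i < n \<Longrightarrow> x \<in> euc n \<Longrightarrow> x(i := c) \<in> euc n"
  by (auto simp: euc_def)

lemma edist_L2: "edist n x y = L2_set (\<lambda>i. x i - y i) {..<n}"
  by (simp add: edist_def L2_set_def)

lemma edist_nonneg [simp]: "0 \<le> edist n x y"
  by (simp add: edist_L2)

lemma edist_self [simp]: "edist n x x = 0"
  by (simp add: edist_def)

lemma coord_le_edist: "i < n \<Longrightarrow> \<bar>x i - y i\<bar> \<le> edist n x y"
  unfolding edist_def by (rule real_le_rsqrt) (auto intro!: member_le_sum)

lemma edist_le_sum: "edist n x y \<le> (\<Sum>i<n. \<bar>x i - y i\<bar>)"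
  unfolding edist_L2 by (rule L2_set_le_sum_abs)

lemma edist_upd: "i < n \<Longrightarrow> edist n x (x(i := x i + t)) = \<bar>t\<bar>"
proof -
  assume i: "i < n"
  have "(\<Sum>k<n. (x k - (x(i := x i + t)) k)\<^sup>2) = (\<Sum>k<n. if k = i then t\<^sup>2 else 0)"
    by (intro sum.cong) auto
  then show ?thesis using i by (simp add: edist_def)
qed

text \<open>The metric on functions is the series of coordinate distances capped at 1 with weights
  (1/2)^k, which add up to 2. With the converse comparison \<open>edist_small_dist\<close>, openness
  and continuity in terms of \<open>edist\<close> become those of the subspace topology on
  \<open>euc n\<close>.\<close>

lemma dist_le_edist:
  assumes "x \<in> euc n" "y \<in> euc n"
  shows "dist x y \<le> 2 * edist n x y"
proof -
  have *: "dist (x k) (y k) \<le> edist n x y" for k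
    using assms coord_le_edist[of k n x y] by (cases "k < n") (auto simp: dist_real_def euc_def)
  have s: "summable (\<lambda>k. (1/2::real)^k)" by (rule summable_geometric) simp
  have "dist x y = (\<Sum>k. (1/2)^k * min (dist (x (from_nat k)) (y (from_nat k))) 1)"
    by (simp add: dist_fun_def)
  also have "\<dots> \<le> (\<Sum>k. (1/2)^k * edist n x y)"
  proof (rule suminf_le)
    show "(1/2)^k * min (dist (x (from_nat k)) (y (from_nat k))) 1 \<le> (1/2)^k * edist n x y" for k
      using *[of "from_nat k"] by (intro mult_left_mono) (auto simp: min_def)
    show "summable (\<lambda>k. (1/2)^k * min (dist (x (from_nat k)) (y (from_nat k))) 1)"
      by (rule summable_comparison_test'[OF s, of 0]) (auto simp: min_def)
    show "summable (\<lambda>k. (1/2)^k * edist n x y)" using s by (rule summable_mult2)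
  qed
  also have "\<dots> = 2 * edist n x y"
    using suminf_mult2[OF s, of "edist n x y"] suminf_geometric[of "1/2::real"] by simp
  finally show ?thesis .
qed

lemma continuous_on_edist: "continuous_on UNIV (\<lambda>y. edist n x y)"
  unfolding edist_def
  by (intro continuous_intros continuous_on_product_coordinates)

lemma edist_small_dist:
  assumes "e > 0"
  obtains d where "d > 0" "\<And>y. dist x y < d \<Longrightarrow> edist n x y < e"
proof -
  have "continuous (at x) (\<lambda>y. edist n x y)"
    using continuous_on_edist[of n x] by (simp add: continuous_on_eq_continuous_at)
  then obtain d where "d > 0" "\<And>y. dist y x < d \<Longrightarrow> dist (edist n x y) (edist n x x) < e"
    using assms unfolding continuous_at_eps_delta by blast
  then show ?thesis using that[of d] by (auto simp: dist_commute dist_real_def)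
qed

lemma open_euc_iff: "open_euc n U \<longleftrightarrow> openin (top_of_set (euc n)) U"
proof
  assume U: "open_euc n U"
  show "openin (top_of_set (euc n)) U"
    unfolding openin_euclidean_subtopology_iff
  proof (intro conjI ballI)
    show "U \<subseteq> euc n" using U by (simp add: open_euc_def)
    fix x assume "x \<in> U"
    then obtain e where e: "e > 0" "\<forall>y\<in>euc n. edist n x y < e \<longrightarrow> y \<in> U"
      using U by (auto simp: open_euc_def)
    obtain d where "d > 0" "\<And>y. dist x y < d \<Longrightarrow> edist n x y < e"
      using edist_small_dist[OF e(1)] by blast
    then show "\<exists>d>0. \<forall>y\<in>euc n. dist y x < d \<longrightarrow> y \<in> U"
      using e by (metis dist_commute)
  qed
next
  assume U: "openin (top_of_set (euc n)) U"
  then have sub: "U \<subseteq> euc n" by (simp add: openin_euclidean_subtopology_iff)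
  show "open_euc n U" unfolding open_euc_def
  proof (intro conjI ballI sub)
    fix x assume x: "x \<in> U"
    then obtain e where e: "e > 0" "\<forall>y\<in>euc n. dist y x < e \<longrightarrow> y \<in> U"
      using U unfolding openin_euclidean_subtopology_iff by blast
    have "y \<in> U" if "y \<in> euc n" "edist n x y < e / 2" for y
      using e(2) that dist_le_edist[of x n y] x sub by (auto simp: dist_commute)
    then show "\<exists>e>0. \<forall>y\<in>euc n. edist n x y < e \<longrightarrow> y \<in> U"
      using e(1) by (intro exI[of _ "e/2"]) auto
  qed
qed

lemma cont_euc_iff:
  assumes "U \<subseteq> euc n"
  shows "cont_euc n U f \<longleftrightarrow> continuous_on U f"
proof
  assume c: "cont_euc n U f"
  show "continuous_on U f" unfolding continuous_on_iff
  proof (intro ballI allI impI)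
    fix x and e :: real assume x: "x \<in> U" and "0 < e"
    then obtain d where d: "d > 0" "\<forall>y\<in>U. edist n x y < d \<longrightarrow> \<bar>f y - f x\<bar> < e"
      using c unfolding cont_euc_def by blast
    obtain d' where "d' > 0" "\<And>y. dist x y < d' \<Longrightarrow> edist n x y < d"
      using edist_small_dist[OF d(1)] by blast
    then show "\<exists>d>0. \<forall>x'\<in>U. dist x' x < d \<longrightarrow> dist (f x') (f x) < e"
      using d by (metis dist_commute dist_real_def)
  qed
next
  assume c: "continuous_on U f"
  show "cont_euc n U f" unfolding cont_euc_def
  proof (intro ballI allI impI)
    fix x and e :: real assume x: "x \<in> U" and "0 < e"
    then obtain d where d: "d > 0" "\<forall>y\<in>U. dist y x < d \<longrightarrow> dist (f y) (f x) < e"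
      using c unfolding continuous_on_iff by blast
    have "\<bar>f y - f x\<bar> < e" if "y \<in> U" "edist n x y < d / 2" for y
    proof -
      have "x \<in> euc n" "y \<in> euc n" using that x assms by auto
      then have "dist y x < d" using that dist_le_edist[of x n y] by (simp add: dist_commute)
      then show ?thesis using d(2) that by (auto simp: dist_real_def)
    qed
    then show "\<exists>d>0. \<forall>y\<in>U. edist n x y < d \<longrightarrow> \<bar>f y - f x\<bar> < e"
      using d(1) by (intro exI[of _ "d/2"]) auto
  qed
qed

lemma open_euc_subset: "open_euc n U \<Longrightarrow> U \<subseteq> euc n"
  by (simp add: open_euc_def)

lemma open_euc_Int: "open_euc n U \<Longrightarrow> open_euc n V \<Longrightarrow> open_euc n (U \<inter> V)"
  by (simp add: open_euc_iff openin_Int)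

lemma open_euc_Union: "(\<And>U. U \<in> F \<Longrightarrow> open_euc n U) \<Longrightarrow> open_euc n (\<Union>F)"
  by (simp add: open_euc_iff openin_Union)

lemma open_euc_euc [simp]: "open_euc n (euc n)"
  by (simp add: open_euc_iff)

lemma open_euc_local:
  assumes "\<And>x. x \<in> U \<Longrightarrow> \<exists>V. open_euc n V \<and> x \<in> V \<and> V \<subseteq> U"
  shows "open_euc n U"
proof -
  have "U = \<Union>{V. open_euc n V \<and> V \<subseteq> U}" using assms by blast
  then show ?thesis using open_euc_Union[of "{V. open_euc n V \<and> V \<subseteq> U}" n] by auto
qed

lemma open_euc_vimage:
  assumes "open_euc n U" "continuous_on U f" "open B"
  shows "open_euc n {x\<in>U. f x \<in> B}"
proof -
  have "openin (top_of_set U) (U \<inter> f -` B)"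
    using assms(2,3) by (simp add: continuous_openin_preimage_gen)
  moreover have "U \<inter> f -` B = {x\<in>U. f x \<in> B}" by auto
  ultimately show ?thesis
    using assms(1) by (metis (no_types, lifting) open_euc_iff openin_trans)
qed

lemma eventually_line:
  assumes "open_euc n U" "x \<in> U" "i < n"
  shows "\<forall>\<^sub>F t in nhds 0. x(i := x i + t) \<in> U"
proof -
  obtain e where e: "e > 0" "\<forall>y\<in>euc n. edist n x y < e \<longrightarrow> y \<in> U"
    using assms(1,2) by (auto simp: open_euc_def)
  have "x \<in> euc n" using assms(1,2) open_euc_subset by blast
  then have "x(i := x i + t) \<in> U" if "dist t 0 < e" for t
    using e(2) that assms(3) edist_upd[OF assms(3), of x t] by (auto simp: dist_real_def)
  then show ?thesis unfolding eventually_nhds_metric using e(1) by blast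
qed

section \<open>Functions of class C^r in finitely many coordinates\<close>

definition has_pd :: "nat \<Rightarrow> ((nat \<Rightarrow> real) \<Rightarrow> real) \<Rightarrow> real \<Rightarrow> (nat \<Rightarrow> real) \<Rightarrow> bool" where
  "has_pd i f d x \<longleftrightarrow> ((\<lambda>t. f (x(i := x i + t))) has_real_derivative d) (at 0)"

lemma has_pd_cong:
  assumes "open_euc n U" "x \<in> U" "i < n" "\<And>y. y \<in> U \<Longrightarrow> f y = g y" "has_pd i f d x"
  shows "has_pd i g d x"
proof -
  have ev: "\<forall>\<^sub>F t in nhds 0. f (x(i := x i + t)) = g (x(i := x i + t))"
    using eventually_line[OF assms(1-3)] by eventually_elim (rule assms(4))
  show ?thesis using assms(5) DERIV_cong_ev[OF refl ev refl, of d] unfolding has_pd_def by simp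
qed

lemma has_pd_unique: "has_pd i f d x \<Longrightarrow> has_pd i f e x \<Longrightarrow> d = e"
  unfolding has_pd_def by (rule DERIV_unique)

text \<open>Finite stages of the coinductive \<open>smooth_fun\<close>: closure properties are
  proved by induction on \<open>r\<close> and transferred by \<open>smooth_fun_iff_Ck\<close>.
  Continuity is demanded at each stage because the mere existence of partial derivatives does not
  imply it.\<close>

fun Ck :: "nat \<Rightarrow> nat \<Rightarrow> (nat \<Rightarrow> real) set \<Rightarrow> ((nat \<Rightarrow> real) \<Rightarrow> real) \<Rightarrow> bool" where
  "Ck 0 n U f \<longleftrightarrow> continuous_on U f"
| "Ck (Suc r) n U f \<longleftrightarrow> continuous_on U f \<and>
     (\<exists>g. \<forall>i<n. (\<forall>x\<in>U. has_pd i f (g i x) x) \<and> Ck r n U (g i))"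

lemma Ck_SucI:
  assumes "continuous_on U f" "\<And>i x. i < n \<Longrightarrow> x \<in> U \<Longrightarrow> has_pd i f (g i x) x"
    and "\<And>i. i < n \<Longrightarrow> Ck r n U (g i)"
  shows "Ck (Suc r) n U f"
  unfolding Ck.simps using assms by blast

lemma Ck_SucE:
  assumes "Ck (Suc r) n U f"
  obtains g where "\<forall>i<n. \<forall>x\<in>U. has_pd i f (g i x) x" and "\<forall>i<n. Ck r n U (g i)"
  using assms unfolding Ck.simps by blast

lemma Ck_continuous: "Ck r n U f \<Longrightarrow> continuous_on U f"
  by (cases r) auto

declare Ck.simps(2) [simp del]

lemma Ck_SucD: "Ck (Suc r) n U f \<Longrightarrow> Ck r n U f"
proof (induction r arbitrary: f)
  case 0
  then show ?case by (simp add: Ck_continuous)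
next
  case (Suc r)
  obtain g where "\<forall>i<n. \<forall>x\<in>U. has_pd i f (g i x) x"
    and "\<forall>i<n. Ck (Suc r) n U (g i)"
    using Ck_SucE[OF Suc.prems] by blast
  then show ?case using Ck_continuous[OF Suc.prems] Suc.IH by (intro Ck_SucI[where g=g]) auto
qed

lemma Ck_cong:
  assumes "open_euc n U" "\<And>x. x \<in> U \<Longrightarrow> f x = g x" "Ck r n U f"
  shows "Ck r n U g"
  using assms(2,3)
proof (induction r arbitrary: f g)
  case 0
  then show ?case using continuous_on_eq[of U f g] by simp
next
  case (Suc r)
  obtain h where h: "\<forall>i<n. \<forall>x\<in>U. has_pd i f (h i x) x" "\<forall>i<n. Ck r n U (h i)"
    using Ck_SucE[OF Suc.prems(2)] by blast
  have "has_pd i g (h i x) x" if "i < n" "x \<in> U" for i x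
    by (rule has_pd_cong[OF assms(1) that(2,1) Suc.prems(1)]) (use h that in auto)
  moreover have "continuous_on U g"
    using continuous_on_eq[OF Ck_continuous[OF Suc.prems(2)] Suc.prems(1)] .
  ultimately show ?case using h(2) by (intro Ck_SucI[where g=h]) auto
qed

lemma Ck_subset: "V \<subseteq> U \<Longrightarrow> Ck r n U f \<Longrightarrow> Ck r n V f"
proof (induction r arbitrary: f)
  case 0
  then show ?case by (auto intro: continuous_on_subset)
next
  case (Suc r)
  obtain h where "\<forall>i<n. \<forall>x\<in>U. has_pd i f (h i x) x" "\<forall>i<n. Ck r n U (h i)"
    using Ck_SucE[OF Suc.prems(2)] by blast
  then show ?case using Suc continuous_on_subset[OF Ck_continuous]
    by (intro Ck_SucI[where g=h]) auto
qed

lemma continuous_on_open_euc_local: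
  fixes f :: "(nat \<Rightarrow> real) \<Rightarrow> real"
  assumes "U \<subseteq> euc n"
    and "\<And>x. x \<in> U \<Longrightarrow> \<exists>V. open_euc n V \<and> x \<in> V \<and> V \<subseteq> U \<and> continuous_on V f"
  shows "continuous_on U f"
  unfolding cont_euc_iff[OF assms(1), symmetric] cont_euc_def
proof (intro ballI allI impI)
  fix x and e :: real assume x: "x \<in> U" and e: "e > 0"
  obtain V where V: "open_euc n V" "x \<in> V" "V \<subseteq> U" "continuous_on V f"
    using assms(2)[OF x] by blast
  have "cont_euc n V f" using V(4) cont_euc_iff[OF open_euc_subset[OF V(1)]] by simp
  then obtain d where d: "d > 0" "\<forall>y\<in>V. edist n x y < d \<longrightarrow> \<bar>f y - f x\<bar> < e"
    using V(2) e unfolding cont_euc_def by blast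
  obtain d' where d': "d' > 0" "\<forall>y\<in>euc n. edist n x y < d' \<longrightarrow> y \<in> V"
    using V(1,2) unfolding open_euc_def by blast
  have "\<bar>f y - f x\<bar> < e" if "y \<in> U" "edist n x y < min d d'" for y
    using that d d' assms(1) by auto
  then show "\<exists>d>0. \<forall>y\<in>U. edist n x y < d \<longrightarrow> \<bar>f y - f x\<bar> < e"
    using d(1) d'(1) by (intro exI[of _ "min d d'"]) simp
qed

lemma Ck_local:
  assumes "U \<subseteq> euc n"
    and "\<And>x. x \<in> U \<Longrightarrow> \<exists>V. open_euc n V \<and> x \<in> V \<and> V \<subseteq> U \<and> Ck r n V f"
  shows "Ck r n U f"
  using assms(2)
proof (induction r arbitrary: f)
  case 0
  then show ?case using continuous_on_open_euc_local[OF assms(1)] by auto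
next
  case (Suc r)
  \<comment> \<open>Uniqueness of partial derivatives makes this pointwise choice agree with the
    derivatives found on each neighbourhood.\<close>
  define g where "g = (\<lambda>i x. SOME d. has_pd i f d x)"
  have loc: "\<exists>V. open_euc n V \<and> x \<in> V \<and> V \<subseteq> U \<and> continuous_on V f \<and>
     (\<forall>i<n. (\<forall>x\<in>V. has_pd i f (g i x) x) \<and> Ck r n V (g i))" if x: "x \<in> U" for x
  proof -
    obtain V where V: "open_euc n V" "x \<in> V" "V \<subseteq> U" "Ck (Suc r) n V f"
      using Suc(2)[OF x] by auto
    obtain h where h: "\<forall>i<n. \<forall>x\<in>V. has_pd i f (h i x) x" "\<forall>i<n. Ck r n V (h i)"
      using Ck_SucE[OF V(4)] by blast
    have pd: "has_pd i f (g i y) y" if "i < n" "y \<in> V" for i y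
      unfolding g_def using someI[of "\<lambda>d. has_pd i f d y", OF h(1)[rule_format, OF that]] .
    have eq: "h i y = g i y" if "i < n" "y \<in> V" for i y
      using has_pd_unique[OF h(1)[rule_format, OF that] pd[OF that]] .
    have "Ck r n V (g i)" if "i < n" for i
      using Ck_cong[OF V(1) eq[OF that] h(2)[rule_format, OF that]] .
    then show ?thesis using V pd Ck_continuous by blast
  qed
  have "continuous_on U f"
  proof (rule continuous_on_open_euc_local[OF assms(1)])
    fix x assume "x \<in> U"
    with loc[OF this] show "\<exists>V. open_euc n V \<and> x \<in> V \<and> V \<subseteq> U \<and> continuous_on V f" by blast
  qed
  moreover have "has_pd i f (g i x) x" if "i < n" "x \<in> U" for i x
    using loc[OF that(2)] that(1) by blast
  moreover have "Ck r n U (g i)" if "i < n" for i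
  proof (rule Suc.IH)
    fix x assume "x \<in> U"
    with loc[OF this] that show "\<exists>V. open_euc n V \<and> x \<in> V \<and> V \<subseteq> U \<and> Ck r n V (g i)" by blast
  qed
  ultimately show ?case by (intro Ck_SucI[where g=g])
qed

text \<open>For the converse, coinduction needs one family of derivatives that works for all
  \<open>r\<close> at once, whereas each \<open>Ck\<close> brings its own; uniqueness of partial
  derivatives shows that these coincide on \<open>U\<close>.\<close>

lemma smooth_fun_iff_Ck:
  assumes U: "open_euc n U"
  shows "smooth_fun n U f \<longleftrightarrow> (\<forall>r. Ck r n U f)"
proof
  assume "smooth_fun n U f"
  then have "Ck r n U f" for r
  proof (induction r arbitrary: f)
    case 0
    then have "cont_euc n U f" by (rule smooth_fun.cases) blast
    then show ?case using cont_euc_iff[OF open_euc_subset[OF U]] by simp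
  next
    case (Suc r)
    obtain g where "cont_euc n U f"
        "\<forall>i<n. \<forall>x\<in>U. ((\<lambda>t. f (x(i := x i + t))) has_real_derivative g i x) (at 0)"
        "\<forall>i<n. smooth_fun n U (g i)"
      using Suc(2) by (rule smooth_fun.cases) blast
    then show ?case using Suc(1) cont_euc_iff[OF open_euc_subset[OF U]]
      by (intro Ck_SucI[where g=g]) (auto simp: has_pd_def)
  qed
  then show "\<forall>r. Ck r n U f" by blast
next
  assume "\<forall>r. Ck r n U f"
  then show "smooth_fun n U f"
  proof (coinduction arbitrary: f)
    case smooth_fun
    define g where "g = (\<lambda>i x. SOME d. has_pd i f d x)"
    have *: "(\<forall>i<n. (\<forall>x\<in>U. has_pd i f (g i x) x) \<and> Ck r n U (g i))" for r
    proof -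
      obtain h where h: "\<forall>i<n. \<forall>x\<in>U. has_pd i f (h i x) x" "\<forall>i<n. Ck r n U (h i)"
        using Ck_SucE[OF smooth_fun[rule_format, of "Suc r"]] by blast
      have pd: "has_pd i f (g i y) y" if "i < n" "y \<in> U" for i y
        unfolding g_def using someI[of "\<lambda>d. has_pd i f d y", OF h(1)[rule_format, OF that]] .
      have eq: "h i y = g i y" if "i < n" "y \<in> U" for i y
        using has_pd_unique[OF h(1)[rule_format, OF that] pd[OF that]] .
      have "Ck r n U (g i)" if "i < n" for i
        using Ck_cong[OF U eq[OF that] h(2)[rule_format, OF that]] .
      then show ?thesis using pd by blast
    qed
    have "cont_euc n U f" using smooth_fun Ck_continuous cont_euc_iff[OF open_euc_subset[OF U]] by blast
    then show ?case using * unfolding has_pd_def by (intro exI[of _ g] exI[of _ f]) auto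
  qed
qed

lemma Ck_const: "Ck r n U (\<lambda>_. c)"
  by (induction r arbitrary: c) (auto simp: has_pd_def intro!: Ck_SucI[where g="\<lambda>_ _. 0"])

lemma Ck_coord: "Ck r n U (\<lambda>x. x k)"
proof (cases r)
  case 0
  then show ?thesis by (auto intro: continuous_on_subset[OF continuous_on_product_coordinates])
next
  case (Suc r')
  have "has_pd i (\<lambda>x. x k) (if i = k then 1 else 0) x" for i x
    unfolding has_pd_def by (auto intro!: derivative_eq_intros)
  moreover have "Ck r' n U (\<lambda>x. if i = k then 1 else 0)" for i by (rule Ck_const)
  moreover have "continuous_on U (\<lambda>x. x k)"
    by (rule continuous_on_subset[OF continuous_on_product_coordinates]) simp
  ultimately show ?thesis unfolding Suc by (intro Ck_SucI[where g="\<lambda>i x. if i = k then 1 else 0"])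
qed

lemma Ck_add: "Ck r n U f \<Longrightarrow> Ck r n U g \<Longrightarrow> Ck r n U (\<lambda>x. f x + g x)"
proof (induction r arbitrary: f g)
  case 0
  then show ?case by (auto intro: continuous_intros)
next
  case (Suc r)
  obtain f' where f': "\<forall>i<n. \<forall>x\<in>U. has_pd i f (f' i x) x" "\<forall>i<n. Ck r n U (f' i)"
    using Ck_SucE[OF Suc(2)] by blast
  obtain g' where g': "\<forall>i<n. \<forall>x\<in>U. has_pd i g (g' i x) x" "\<forall>i<n. Ck r n U (g' i)"
    using Ck_SucE[OF Suc(3)] by blast
  have "has_pd i (\<lambda>x. f x + g x) (f' i x + g' i x) x" if "i < n" "x \<in> U" for i x
    using DERIV_add[OF f'(1)[rule_format, OF that, unfolded has_pd_def]
        g'(1)[rule_format, OF that, unfolded has_pd_def]] unfolding has_pd_def by simp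
  moreover have "Ck r n U (\<lambda>x. f' i x + g' i x)" if "i < n" for i
    by (rule Suc.IH) (use f' g' that in auto)
  ultimately show ?case using Suc(2,3) by (intro Ck_SucI[where g="\<lambda>i x. f' i x + g' i x"] continuous_intros Ck_continuous)
qed

lemma Ck_mult: "Ck r n U f \<Longrightarrow> Ck r n U g \<Longrightarrow> Ck r n U (\<lambda>x. f x * g x)"
proof (induction r arbitrary: f g)
  case 0
  then show ?case by (auto intro: continuous_intros)
next
  case (Suc r)
  obtain f' where f': "\<forall>i<n. \<forall>x\<in>U. has_pd i f (f' i x) x" "\<forall>i<n. Ck r n U (f' i)"
    using Ck_SucE[OF Suc(2)] by blast
  obtain g' where g': "\<forall>i<n. \<forall>x\<in>U. has_pd i g (g' i x) x" "\<forall>i<n. Ck r n U (g' i)"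
    using Ck_SucE[OF Suc(3)] by blast
  have "has_pd i (\<lambda>x. f x * g x) (f' i x * g x + g' i x * f x) x" if "i < n" "x \<in> U" for i x
    using DERIV_mult[OF f'(1)[rule_format, OF that, unfolded has_pd_def]
        g'(1)[rule_format, OF that, unfolded has_pd_def]] unfolding has_pd_def by simp
  moreover have "Ck r n U (\<lambda>x. f' i x * g x + g' i x * f x)" if "i < n" for i
    by (intro Ck_add Suc.IH) (use f' g' that Ck_SucD[OF Suc(2)] Ck_SucD[OF Suc(3)] in auto)
  ultimately show ?case using Suc(2,3)
    by (intro Ck_SucI[where g="\<lambda>i x. f' i x * g x + g' i x * f x"] continuous_intros Ck_continuous)
qed

lemma Ck_sum: "(\<And>a. a \<in> A \<Longrightarrow> Ck r n U (f a)) \<Longrightarrow> Ck r n U (\<lambda>x. \<Sum>a\<in>A. f a x)"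
  by (induction A rule: infinite_finite_induct) (auto intro: Ck_const Ck_add)

lemma Ck_prod: "(\<And>a. a \<in> A \<Longrightarrow> Ck r n U (f a)) \<Longrightarrow> Ck r n U (\<lambda>x. \<Prod>a\<in>A. f a x)"
  by (induction A rule: infinite_finite_induct) (auto intro: Ck_const Ck_mult)

text \<open>In contrast to \<open>Ck\<close> there is no clause for continuity: a derivative in one
  variable already forces it.\<close>

fun Ck1 :: "nat \<Rightarrow> real set \<Rightarrow> (real \<Rightarrow> real) \<Rightarrow> bool" where
  "Ck1 0 T f \<longleftrightarrow> continuous_on T f"
| "Ck1 (Suc r) T f \<longleftrightarrow> (\<exists>g. (\<forall>x\<in>T. (f has_real_derivative g x) (at x)) \<and> Ck1 r T g)"

lemma Ck1_continuous: "Ck1 r T f \<Longrightarrow> continuous_on T f"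
proof (cases r)
  case (Suc r')
  assume "Ck1 r T f"
  then obtain g where "\<forall>x\<in>T. (f has_real_derivative g x) (at x)" unfolding Suc Ck1.simps by blast
  then show ?thesis by (meson DERIV_continuous_on has_field_derivative_at_within)
qed simp

lemma Ck1_SucD: "Ck1 (Suc r) T f \<Longrightarrow> Ck1 r T f"
proof (induction r arbitrary: f)
  case 0
  then show ?case using Ck1_continuous Ck1.simps(1) by blast
next
  case (Suc r)
  from Suc(2) obtain g where "\<forall>x\<in>T. (f has_real_derivative g x) (at x)" "Ck1 (Suc r) T g"
    by (metis Ck1.simps(2))
  then show ?case using Suc.IH by auto
qed

lemma Ck_compose1:
  "Ck r n U f \<Longrightarrow> Ck1 r T \<phi> \<Longrightarrow> f ` U \<subseteq> T \<Longrightarrow> Ck r n U (\<lambda>x. \<phi> (f x))"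
proof (induction r arbitrary: \<phi>)
  case 0
  then show ?case by (auto intro: continuous_on_compose2)
next
  case (Suc r)
  obtain f' where f': "\<forall>i<n. \<forall>x\<in>U. has_pd i f (f' i x) x" "\<forall>i<n. Ck r n U (f' i)"
    using Ck_SucE[OF Suc(2)] by blast
  obtain g where g: "\<forall>x\<in>T. (\<phi> has_real_derivative g x) (at x)" "Ck1 r T g"
    using Suc(3) by auto
  have "has_pd i (\<lambda>x. \<phi> (f x)) (g (f x) * f' i x) x" if "i < n" "x \<in> U" for i x
  proof -
    have "(\<phi> has_real_derivative g (f x)) (at (f (x(i := x i + 0))))" using g that Suc(4) by auto
    moreover have "((\<lambda>t. f (x(i := x i + t))) has_real_derivative f' i x) (at 0)"
      using f' that by (auto simp: has_pd_def)
    ultimately show ?thesis unfolding has_pd_def using DERIV_chain2 by fast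
  qed
  moreover have "Ck r n U (\<lambda>x. g (f x) * f' i x)" if "i < n" for i
    using Suc.IH[OF Ck_SucD[OF Suc(2)] g(2) Suc(4)] f' that by (intro Ck_mult) auto
  moreover have "continuous_on U (\<lambda>x. \<phi> (f x))"
    using Ck_continuous[OF Suc(2)] Ck1_continuous[OF Suc(3)] Suc(4)
    by (auto intro: continuous_on_compose2)
  ultimately show ?case by (intro Ck_SucI[where g="\<lambda>i x. g (f x) * f' i x"])
qed

section \<open>The chain rule in several variables\<close>

lemma edist_mono: "(\<And>i. i < n \<Longrightarrow> \<bar>x i - z i\<bar> \<le> \<bar>x i - y i\<bar>) \<Longrightarrow> edist n x z \<le> edist n x y"
  unfolding edist_def by (auto intro!: sum_mono simp: abs_le_square_iff)

text \<open>Continuous partial derivatives give a first order expansion: pass from \<open>x\<close>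
  to \<open>y\<close> one coordinate at a time and apply the mean value inequality on each segment,
  where the partial derivative differs from its value at \<open>x\<close> by less than
  \<open>e\<close>.\<close>

lemma partials_expansion:
  assumes V: "open_euc N V" and pd: "\<And>i z. i < N \<Longrightarrow> z \<in> V \<Longrightarrow> has_pd i f (g i z) z"
    and cont: "\<And>i. i < N \<Longrightarrow> continuous_on V (g i)" and x: "x \<in> V" and e: "e > 0"
  shows "\<exists>d>0. \<forall>y\<in>euc N. edist N x y < d \<longrightarrow>
    \<bar>f y - f x - (\<Sum>i<N. g i x * (y i - x i))\<bar> \<le> e * (\<Sum>i<N. \<bar>y i - x i\<bar>)"
proof -
  have xe: "x \<in> euc N" using V x open_euc_subset by blast
  obtain d0 where d0: "d0 > 0" "\<forall>y\<in>euc N. edist N x y < d0 \<longrightarrow> y \<in> V"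
    using V x unfolding open_euc_def by blast
  have "\<forall>i\<in>{..<N}. \<exists>d>0. \<forall>z\<in>V. edist N x z < d \<longrightarrow> \<bar>g i z - g i x\<bar> < e"
  proof
    fix i assume "i \<in> {..<N}"
    then have "cont_euc N V (g i)" using cont cont_euc_iff[OF open_euc_subset[OF V]] by simp
    then show "\<exists>d>0. \<forall>z\<in>V. edist N x z < d \<longrightarrow> \<bar>g i z - g i x\<bar> < e"
      using x e unfolding cont_euc_def by blast
  qed
  then obtain D where D: "\<forall>i\<in>{..<N}. D i > 0 \<and> (\<forall>z\<in>V. edist N x z < D i \<longrightarrow> \<bar>g i z - g i x\<bar> < e)"
    by (rule bchoice[THEN exE])
  define d where "d = Min (insert d0 (D ` {..<N}))"
  have d: "d > 0" using d0 D by (simp add: d_def)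
  have d_le: "d \<le> d0" "\<And>i. i < N \<Longrightarrow> d \<le> D i" by (auto simp: d_def)
  have "\<bar>f y - f x - (\<Sum>i<N. g i x * (y i - x i))\<bar> \<le> e * (\<Sum>i<N. \<bar>y i - x i\<bar>)"
    if y: "y \<in> euc N" "edist N x y < d" for y
  proof -
    \<comment> \<open>\<open>zz k\<close> has the first \<open>k\<close> coordinates of
      \<open>y\<close> and the others of \<open>x\<close>; the segments between consecutive points
      stay within distance \<open>edist N x y\<close> of \<open>x\<close>.\<close>
    define zz where "zz = (\<lambda>k i. if i < k then y i else x i)"
    have zz0: "zz 0 = x" by (simp add: zz_def)
    have zzN: "zz N = y" using xe y by (auto simp: zz_def euc_def)
    have step: "\<bar>f (zz (Suc k)) - f (zz k) - g k x * (y k - x k)\<bar> \<le> e * \<bar>y k - x k\<bar>" if k: "k < N" for k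
    proof -
      let ?w = "\<lambda>t. (zz k)(k := t)"
      let ?S = "closed_segment (x k) (y k)"
      let ?h = "\<lambda>t. f (?w t) - g k x * t"
      have inV: "?w t \<in> V \<and> edist N x (?w t) < d" if t: "t \<in> ?S" for t
      proof -
        have "\<bar>x k - t\<bar> \<le> \<bar>x k - y k\<bar>" using t by (auto simp: closed_segment_eq_real_ivl split: if_splits)
        then have "edist N x (?w t) \<le> edist N x y" by (intro edist_mono) (auto simp: zz_def)
        then have "edist N x (?w t) < d" using y by simp
        moreover have "?w t \<in> euc N" using xe y k by (auto simp: zz_def euc_def)
        ultimately show ?thesis using d0 d_le by auto
      qed
      have der: "((\<lambda>t. f (?w t)) has_real_derivative g k (?w t)) (at t)" if t: "t \<in> ?S" for t
      proof -
        have "has_pd k f (g k (?w t)) (?w t)" using pd[OF k] inV[OF t] by blast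
        then have "((\<lambda>s. f (?w (s + t))) has_real_derivative g k (?w t)) (at 0)"
          by (simp add: has_pd_def add.commute)
        then show ?thesis using DERIV_shift[of "\<lambda>t. f (?w t)" "g k (?w t)" 0 t] by simp
      qed
      have "norm (?h (y k) - ?h (x k)) \<le> e * norm (y k - x k)"
      proof (rule field_differentiable_bound[of ?S ?h "\<lambda>t. g k (?w t) - g k x"])
        show "(?h has_field_derivative g k (?w t) - g k x) (at t within ?S)" if "t \<in> ?S" for t
          by (rule has_field_derivative_at_within)
            (use der[OF that] in \<open>auto intro!: derivative_eq_intros\<close>)
        show "norm (g k (?w t) - g k x) \<le> e" if "t \<in> ?S" for t
          using inV[OF that] D k d_le(2)[OF k] by force
      qed auto
      moreover have "?w (y k) = zz (Suc k)" "?w (x k) = zz k"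
        by (auto simp: zz_def fun_eq_iff less_Suc_eq)
      ultimately show ?thesis by (simp add: algebra_simps)
    qed
    have "f y - f x = (\<Sum>k<N. f (zz (Suc k)) - f (zz k))"
      using sum_lessThan_telescope[of "\<lambda>k. f (zz k)" N] zz0 zzN by simp
    then have "\<bar>f y - f x - (\<Sum>i<N. g i x * (y i - x i))\<bar>
        = \<bar>\<Sum>k<N. f (zz (Suc k)) - f (zz k) - g k x * (y k - x k)\<bar>"
      by (simp add: sum_subtractf)
    also have "\<dots> \<le> (\<Sum>k<N. \<bar>f (zz (Suc k)) - f (zz k) - g k x * (y k - x k)\<bar>)" by (rule sum_abs)
    also have "\<dots> \<le> (\<Sum>k<N. e * \<bar>y k - x k\<bar>)" using step by (intro sum_mono) auto
    finally show ?thesis by (simp add: sum_distrib_left)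
  qed
  then show ?thesis using d by blast
qed

text \<open>Only the coordinate \<open>i\<close> moves, so \<open>F\<close> reduces to a curve
  \<open>c\<close>. In the expansion of \<open>f\<close> at \<open>c 0\<close>, divided by
  \<open>t\<close>, the remainder is at most a small multiple of the difference quotients of
  \<open>c\<close>, which stay bounded.\<close>

lemma has_pd_compose:
  assumes V: "open_euc N V" and pd: "\<And>j z. j < N \<Longrightarrow> z \<in> V \<Longrightarrow> has_pd j f (g j z) z"
    and cont: "\<And>j. j < N \<Longrightarrow> continuous_on V (g j)"
    and U: "open_euc k U" "F ` U \<subseteq> V" "u \<in> U" "i < k"
    and F: "\<And>j. j < N \<Longrightarrow> has_pd i (\<lambda>x. F x j) (d j) u"
  shows "has_pd i (\<lambda>x. f (F x)) (\<Sum>j<N. g j (F u) * d j) u"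
proof -
  define c where "c = (\<lambda>t. F (u(i := u i + t)))"
  have c0: "c 0 = F u" by (simp add: c_def)
  have cV: "\<forall>\<^sub>F t in at 0. c t \<in> V"
    using eventually_line[OF U(1,3,4)] U(2) unfolding c_def eventually_at_filter
    by (auto elim!: eventually_mono)
  have dq: "((\<lambda>t. (c t j - c 0 j) / t) \<longlongrightarrow> d j) (at 0)" if "j < N" for j
    using F[OF that] unfolding has_pd_def DERIV_def c_def by simp
  have cc: "((\<lambda>t. c t j) \<longlongrightarrow> c 0 j) (at 0)" if "j < N" for j
    using DERIV_isCont[OF F[OF that, unfolded has_pd_def]] unfolding isCont_def c_def .
  have ed: "((\<lambda>t. edist N (c 0) (c t)) \<longlongrightarrow> 0) (at 0)"
  proof (rule tendsto_sandwich[of "\<lambda>_. 0"])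
    show "\<forall>\<^sub>F t in at 0. edist N (c 0) (c t) \<le> (\<Sum>j<N. \<bar>c 0 j - c t j\<bar>)"
      by (intro always_eventually allI edist_le_sum)
    have "((\<lambda>t. \<Sum>j<N. \<bar>c 0 j - c t j\<bar>) \<longlongrightarrow> (\<Sum>j<N. \<bar>c 0 j - c 0 j\<bar>)) (at 0)"
      by (intro tendsto_intros cc) auto
    then show "((\<lambda>t. \<Sum>j<N. \<bar>c 0 j - c t j\<bar>) \<longlongrightarrow> 0) (at 0)" by simp
  qed auto
  define R where "R = (\<lambda>t. f (c t) - f (c 0) - (\<Sum>j<N. g j (c 0) * (c t j - c 0 j)))"
  \<comment> \<open>The summand 1 makes \<open>M\<close> positive and strictly larger than the limit
    of the summed difference quotients, so it eventually bounds them.\<close>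
  define M where "M = (\<Sum>j<N. \<bar>d j\<bar>) + 1"
  have M: "M > 0" unfolding M_def by (simp add: add_nonneg_pos sum_nonneg)
  have "((\<lambda>t. R t / t) \<longlongrightarrow> 0) (at 0)"
  proof (rule tendstoI)
    fix e :: real assume e: "e > 0"
    define e' where "e' = e / (2 * M)"
    have e': "e' > 0" using e M by (simp add: e'_def)
    have "c 0 \<in> V" using U c0 by auto
    then obtain \<delta> where \<delta>: "\<delta> > 0" "\<forall>y\<in>euc N. edist N (c 0) y < \<delta> \<longrightarrow>
        \<bar>f y - f (c 0) - (\<Sum>j<N. g j (c 0) * (y j - c 0 j))\<bar> \<le> e' * (\<Sum>j<N. \<bar>y j - c 0 j\<bar>)"
      using partials_expansion[OF V pd cont _ e'] by blast
    have 1: "\<forall>\<^sub>F t in at 0. edist N (c 0) (c t) < \<delta>"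
      using order_tendstoD(2)[OF ed \<delta>(1)] .
    have "((\<lambda>t. \<Sum>j<N. \<bar>(c t j - c 0 j) / t\<bar>) \<longlongrightarrow> (\<Sum>j<N. \<bar>d j\<bar>)) (at 0)"
      by (intro tendsto_intros dq) auto
    then have 2: "\<forall>\<^sub>F t in at 0. (\<Sum>j<N. \<bar>(c t j - c 0 j) / t\<bar>) < M"
      using order_tendstoD(2) M_def by force
    have 3: "\<forall>\<^sub>F t in at (0::real). t \<noteq> 0" by (simp add: eventually_at_filter)
    show "\<forall>\<^sub>F t in at 0. dist (R t / t) 0 < e"
      using 1 2 3 cV
    proof eventually_elim
      case (elim t)
      have "c t \<in> euc N" using elim(4) V open_euc_subset by blast
      then have "\<bar>R t\<bar> \<le> e' * (\<Sum>j<N. \<bar>c t j - c 0 j\<bar>)" using \<delta>(2) elim(1) unfolding R_def by blast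
      then have "\<bar>R t\<bar> / \<bar>t\<bar> \<le> e' * (\<Sum>j<N. \<bar>c t j - c 0 j\<bar>) / \<bar>t\<bar>" by (simp add: divide_right_mono)
      also have "\<dots> = e' * (\<Sum>j<N. \<bar>(c t j - c 0 j) / t\<bar>)"
        by (simp flip: sum_divide_distrib)
      also have "\<dots> \<le> e' * M" using elim(2) e' by (intro mult_left_mono) auto
      also have "\<dots> < e" using e M by (simp add: e'_def)
      finally show ?case by (simp add: dist_real_def)
    qed
  qed
  moreover have "((\<lambda>t. \<Sum>j<N. g j (c 0) * ((c t j - c 0 j) / t)) \<longlongrightarrow> (\<Sum>j<N. g j (c 0) * d j)) (at 0)"
    by (intro tendsto_intros dq) auto
  ultimately have "((\<lambda>t. R t / t + (\<Sum>j<N. g j (c 0) * ((c t j - c 0 j) / t))) \<longlongrightarrow> 0 + (\<Sum>j<N. g j (c 0) * d j)) (at 0)"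
    by (rule tendsto_add)
  moreover have "R t / t + (\<Sum>j<N. g j (c 0) * ((c t j - c 0 j) / t)) = (f (c t) - f (c 0)) / t" for t
  proof -
    have "(\<Sum>j<N. g j (c 0) * ((c t j - c 0 j) / t)) = (\<Sum>j<N. g j (c 0) * (c t j - c 0 j)) / t"
      by (simp add: sum_divide_distrib)
    then show ?thesis by (simp add: R_def flip: add_divide_distrib)
  qed
  ultimately have "((\<lambda>t. (f (c t) - f (c 0)) / t) \<longlongrightarrow> (\<Sum>j<N. g j (c 0) * d j)) (at 0)" by simp
  then show ?thesis unfolding has_pd_def DERIV_def c0 by (simp add: c_def)
qed

lemma continuous_on_euc_map:
  assumes "\<And>j. j < N \<Longrightarrow> continuous_on U (\<lambda>x. F x j)" "F ` U \<subseteq> euc N"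
  shows "continuous_on U F"
proof (rule continuous_on_coordinatewise_then_product)
  fix j show "continuous_on U (\<lambda>x. F x j)"
  proof (cases "j < N")
    case False
    then have "\<And>x. x \<in> U \<Longrightarrow> 0 = F x j" using assms(2) by (auto simp: euc_def image_subset_iff)
    then show ?thesis by (rule continuous_on_eq[OF continuous_on_const])
  qed (use assms in auto)
qed

lemma Ck_compose:
  assumes V: "open_euc N V" and U: "open_euc k U" "F ` U \<subseteq> V"
    and "Ck r N V f" "\<And>j. j < N \<Longrightarrow> Ck r k U (\<lambda>x. F x j)"
  shows "Ck r k U (\<lambda>x. f (F x))"
  using assms(4,5)
proof (induction r arbitrary: f)
  case 0
  have cF: "continuous_on U F"
    by (rule continuous_on_euc_map[of N]) (use 0 U open_euc_subset[OF V] in auto)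
  show ?case using continuous_on_compose2[OF Ck_continuous[OF 0(1)] cF U(2)] by simp
next
  case (Suc r)
  obtain g where g: "\<forall>i<N. \<forall>x\<in>V. has_pd i f (g i x) x" "\<forall>i<N. Ck r N V (g i)"
    using Ck_SucE[OF Suc.prems(1)] by blast
  have "\<forall>j\<in>{..<N}. \<exists>h. (\<forall>i<k. \<forall>x\<in>U. has_pd i (\<lambda>x. F x j) (h i x) x) \<and> (\<forall>i<k. Ck r k U (h i))"
  proof
    fix j assume "j \<in> {..<N}"
    then have "Ck (Suc r) k U (\<lambda>x. F x j)" using Suc.prems(2) by simp
    then show "\<exists>h. (\<forall>i<k. \<forall>x\<in>U. has_pd i (\<lambda>x. F x j) (h i x) x) \<and> (\<forall>i<k. Ck r k U (h i))"
      by (rule Ck_SucE) blast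
  qed
  then obtain h where h: "\<forall>j\<in>{..<N}. (\<forall>i<k. \<forall>x\<in>U. has_pd i (\<lambda>x. F x j) (h j i x) x) \<and> (\<forall>i<k. Ck r k U (h j i))"
    by (rule bchoice[THEN exE])
  have Fr: "\<And>j. j < N \<Longrightarrow> Ck r k U (\<lambda>x. F x j)" using Suc.prems(2) Ck_SucD by blast
  have cF: "continuous_on U F"
    by (rule continuous_on_euc_map[of N])
      (use Ck_continuous[OF Fr] U open_euc_subset[OF V] in auto)
  have 1: "continuous_on U (\<lambda>x. f (F x))"
    by (rule continuous_on_compose2[OF Ck_continuous[OF Suc.prems(1)] cF U(2)])
  have 2: "has_pd i (\<lambda>x. f (F x)) (\<Sum>j<N. g j (F x) * h j i x) x" if "i < k" "x \<in> U" for i x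
    by (rule has_pd_compose[OF V _ _ U(1,2) that(2,1)]) (use g h that Ck_continuous in auto)
  have 3: "Ck r k U (\<lambda>x. \<Sum>j<N. g j (F x) * h j i x)" if "i < k" for i
  proof (rule Ck_sum, rule Ck_mult)
    fix j assume j: "j \<in> {..<N}"
    show "Ck r k U (\<lambda>x. g j (F x))" by (rule Suc.IH) (use g j Fr in auto)
    show "Ck r k U (h j i)" using h j that by blast
  qed
  show ?case using 1 2 3 by (rule Ck_SucI[where g="\<lambda>i x. \<Sum>j<N. g j (F x) * h j i x"])
qed

section \<open>Smooth functions\<close>

lemma smooth_continuous: "open_euc n U \<Longrightarrow> smooth_fun n U f \<Longrightarrow> continuous_on U f"
  using Ck_continuous smooth_fun_iff_Ck by blast

lemma smooth_partials:
  assumes "smooth_fun n U f"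
  obtains g where "\<forall>i<n. \<forall>x\<in>U. has_pd i f (g i x) x" "\<forall>i<n. smooth_fun n U (g i)"
  using assms unfolding has_pd_def by (rule smooth_fun.cases) blast

lemma smooth_cong:
  assumes "open_euc n U" "\<And>x. x \<in> U \<Longrightarrow> f x = g x" "smooth_fun n U f"
  shows "smooth_fun n U g"
  using assms Ck_cong[OF assms(1,2)] by (simp add: smooth_fun_iff_Ck)

lemma smooth_subset: "open_euc n U \<Longrightarrow> open_euc n V \<Longrightarrow> V \<subseteq> U \<Longrightarrow> smooth_fun n U f \<Longrightarrow> smooth_fun n V f"
  using Ck_subset by (simp add: smooth_fun_iff_Ck)

lemma smooth_local:
  assumes "open_euc n U"
    and "\<And>x. x \<in> U \<Longrightarrow> \<exists>V. open_euc n V \<and> x \<in> V \<and> V \<subseteq> U \<and> smooth_fun n V f"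
  shows "smooth_fun n U f"
proof -
  have "Ck r n U f" for r
  proof (rule Ck_local[OF open_euc_subset[OF assms(1)]])
    fix x assume "x \<in> U"
    with assms(2)[OF this] show "\<exists>V. open_euc n V \<and> x \<in> V \<and> V \<subseteq> U \<and> Ck r n V f"
      using smooth_fun_iff_Ck by blast
  qed
  then show ?thesis by (simp add: smooth_fun_iff_Ck[OF assms(1)])
qed

lemma smooth_const [intro]: "open_euc n U \<Longrightarrow> smooth_fun n U (\<lambda>_. c)"
  by (simp add: smooth_fun_iff_Ck Ck_const)

lemma smooth_coord: "open_euc n U \<Longrightarrow> smooth_fun n U (\<lambda>x. x k)"
  by (simp add: smooth_fun_iff_Ck Ck_coord)

lemma smooth_add: "open_euc n U \<Longrightarrow> smooth_fun n U f \<Longrightarrow> smooth_fun n U g \<Longrightarrow> smooth_fun n U (\<lambda>x. f x + g x)"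
  by (simp add: smooth_fun_iff_Ck Ck_add)

lemma smooth_mult: "open_euc n U \<Longrightarrow> smooth_fun n U f \<Longrightarrow> smooth_fun n U g \<Longrightarrow> smooth_fun n U (\<lambda>x. f x * g x)"
  by (simp add: smooth_fun_iff_Ck Ck_mult)

lemma smooth_diff:
  assumes "open_euc n U" "smooth_fun n U f" "smooth_fun n U g"
  shows "smooth_fun n U (\<lambda>x. f x - g x)"
  using smooth_add[OF assms(1,2) smooth_mult[OF assms(1) smooth_const[OF assms(1), of "-1"] assms(3)]]
  by simp

lemma smooth_sum: "open_euc n U \<Longrightarrow> (\<And>a. a \<in> A \<Longrightarrow> smooth_fun n U (f a)) \<Longrightarrow> smooth_fun n U (\<lambda>x. \<Sum>a\<in>A. f a x)"
  by (simp add: smooth_fun_iff_Ck Ck_sum)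

lemma smooth_prod: "open_euc n U \<Longrightarrow> (\<And>a. a \<in> A \<Longrightarrow> smooth_fun n U (f a)) \<Longrightarrow> smooth_fun n U (\<lambda>x. \<Prod>a\<in>A. f a x)"
  by (simp add: smooth_fun_iff_Ck Ck_prod)

lemma smooth_power2: "open_euc n U \<Longrightarrow> smooth_fun n U f \<Longrightarrow> smooth_fun n U (\<lambda>x. (f x)\<^sup>2)"
  by (simp add: power2_eq_square smooth_mult)

definition smooth1 :: "real set \<Rightarrow> (real \<Rightarrow> real) \<Rightarrow> bool" where
  "smooth1 T \<phi> \<longleftrightarrow> (\<forall>r. Ck1 r T \<phi>)"

lemma smooth_compose1:
  "open_euc n U \<Longrightarrow> smooth_fun n U f \<Longrightarrow> smooth1 T \<phi> \<Longrightarrow> f ` U \<subseteq> T \<Longrightarrow> smooth_fun n U (\<lambda>x. \<phi> (f x))"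
  using Ck_compose1[of _ n U f T \<phi>] by (simp add: smooth_fun_iff_Ck smooth1_def)

lemma smooth_compose:
  assumes "open_euc N V" "open_euc k U" "smooth_map k U N F" "F ` U \<subseteq> V" "smooth_fun N V f"
  shows "smooth_fun k U (\<lambda>x. f (F x))"
  using assms(3,5) Ck_compose[OF assms(1,2,4)] assms(1,2)
  by (simp add: smooth_fun_iff_Ck smooth_map_def)

lemma smooth_map_continuous: "open_euc k U \<Longrightarrow> smooth_map k U N F \<Longrightarrow> continuous_on U F"
  by (rule continuous_on_euc_map[of N]) (auto simp: smooth_map_def smooth_continuous)

lemma smooth_map_id: "open_euc k U \<Longrightarrow> smooth_map k U k (\<lambda>x. x)"
  using open_euc_subset by (auto simp: smooth_map_def smooth_coord)

lemma smooth_map_upd: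
  assumes U: "open_euc N U" and F: "smooth_map N U N F" and c: "smooth_fun N U c" and i: "i < N"
  shows "smooth_map N U N (\<lambda>x. (F x)(i := c x))"
  unfolding smooth_map_def
proof (intro conjI ballI allI impI)
  show "(F x)(i := c x) \<in> euc N" if "x \<in> U" for x
    using F i that by (simp add: smooth_map_def)
  show "smooth_fun N U (\<lambda>x. ((F x)(i := c x)) j)" if "j < N" for j
    using F c that by (cases "j = i") (auto simp: smooth_map_def)
qed

section \<open>One variable: inversion, \<open>ell\<close> and the profile function
  \<open>phi\<close>\<close>

lemma deriv_continuous_on:
  assumes "\<And>t. (f has_real_derivative g t) (at t)"
  shows "continuous_on S f"
  by (rule DERIV_continuous_on) (rule has_field_derivative_at_within[OF assms])

lemma deriv_nonneg_mono:
  fixes f :: "real \<Rightarrow> real"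
  assumes "\<And>t. (f has_real_derivative g t) (at t)" "\<And>t. 0 \<le> g t" "s \<le> t"
  shows "f s \<le> f t"
  by (rule DERIV_nonneg_imp_nondecreasing[OF assms(3)]) (use assms(1,2) in blast)

lemma Ck1_const: "Ck1 r T (\<lambda>_. c)"
  by (induction r arbitrary: c) (auto intro!: exI[of _ "\<lambda>_. 0"])

lemma Ck1_add: "Ck1 r T f \<Longrightarrow> Ck1 r T g \<Longrightarrow> Ck1 r T (\<lambda>x. f x + g x)"
proof (induction r arbitrary: f g)
  case 0
  then show ?case by (auto intro: continuous_intros)
next
  case (Suc r)
  obtain f' where f': "\<forall>x\<in>T. (f has_real_derivative f' x) (at x)" "Ck1 r T f'" using Suc.prems(1) by auto
  obtain g' where g': "\<forall>x\<in>T. (g has_real_derivative g' x) (at x)" "Ck1 r T g'" using Suc.prems(2) by auto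
  show ?case unfolding Ck1.simps
    using f' g' Suc.IH[of f' g'] by (intro exI[of _ "\<lambda>x. f' x + g' x"]) (auto intro!: DERIV_add)
qed

lemma Ck1_mult: "Ck1 r T f \<Longrightarrow> Ck1 r T g \<Longrightarrow> Ck1 r T (\<lambda>x. f x * g x)"
proof (induction r arbitrary: f g)
  case 0
  then show ?case by (auto intro: continuous_intros)
next
  case (Suc r)
  obtain f' where f': "\<forall>x\<in>T. (f has_real_derivative f' x) (at x)" "Ck1 r T f'" using Suc.prems(1) by auto
  obtain g' where g': "\<forall>x\<in>T. (g has_real_derivative g' x) (at x)" "Ck1 r T g'" using Suc.prems(2) by auto
  have "Ck1 r T (\<lambda>x. f' x * g x + g' x * f x)"
    using f' g' Suc Ck1_SucD by (intro Ck1_add Suc.IH) auto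
  then show ?case unfolding Ck1.simps
    using f' g' by (intro exI[of _ "\<lambda>x. f' x * g x + g' x * f x"]) (auto intro!: DERIV_mult)
qed

lemma Ck1_affine: "Ck1 r UNIV f \<Longrightarrow> Ck1 r UNIV (\<lambda>x. f (a * x + b))"
proof (induction r arbitrary: f)
  case 0
  then show ?case by (auto intro!: continuous_on_compose2[of UNIV f] continuous_intros)
next
  case (Suc r)
  obtain f' where f': "\<forall>x\<in>UNIV. (f has_real_derivative f' x) (at x)" "Ck1 r UNIV f'" using Suc.prems(1) by auto
  have "((\<lambda>x. f (a * x + b)) has_real_derivative f' (a * x + b) * a) (at x)" for x
    using f'(1) by (intro DERIV_chain2[of f]) (auto intro!: derivative_eq_intros)
  moreover have "Ck1 r UNIV (\<lambda>x. f' (a * x + b) * a)"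
    by (intro Ck1_mult Ck1_const Suc.IH f'(2))
  ultimately show ?case unfolding Ck1.simps by (intro exI[of _ "\<lambda>x. f' (a * x + b) * a"]) simp
qed

lemma smooth1_powr: "smooth1 {0<..} (\<lambda>t. t powr a)"
proof -
  have "Ck1 r {0<..} (\<lambda>t. c * t powr a)" for r c
  proof (induction r arbitrary: c a)
    case 0
    then show ?case by (auto intro!: continuous_intros)
  next
    case (Suc r)
    have "((\<lambda>t. c * t powr a) has_real_derivative (c * a) * t powr (a - 1)) (at t)" if "t > 0" for t
      using that by (auto intro!: derivative_eq_intros simp: has_real_derivative_powr)
    then show ?case unfolding Ck1.simps
      by (intro exI[of _ "\<lambda>t. (c * a) * t powr (a - 1)"]) (use Suc[of "c * a" "a - 1"] in simp)
  qed
  from this[of _ 1] show ?thesis by (simp add: smooth1_def)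
qed

lemma Ck1_cong:
  assumes "open T" "Ck1 r T f" "\<And>x. x \<in> T \<Longrightarrow> f x = g x"
  shows "Ck1 r T g"
proof (cases r)
  case 0
  then show ?thesis using assms continuous_on_eq[of T f g] by simp
next
  case (Suc r')
  obtain f' where f': "\<forall>x\<in>T. (f has_real_derivative f' x) (at x)" "Ck1 r' T f'"
    using assms(2) Suc by auto
  have "(g has_real_derivative f' x) (at x)" if "x \<in> T" for x
    by (rule has_field_derivative_transform_within_open[of f _ _ T]) (use f' that assms in auto)
  then show ?thesis using f' Suc by auto
qed

lemma smooth1_inverse: "smooth1 {0<..} inverse"
  unfolding smooth1_def
proof
  fix r
  show "Ck1 r {0<..} inverse"
  proof (rule Ck1_cong)
    show "Ck1 r {0<..} (\<lambda>t. t powr (-1))" using smooth1_powr[of "-1"] unfolding smooth1_def by simp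
  qed (auto simp: powr_minus)
qed

text \<open>The family \<open>exp (-1/t) / t^k\<close> is closed under differentiation up to linear combinations.\<close>

definition ellk :: "nat \<Rightarrow> real \<Rightarrow> real" where
  "ellk k t = (if t \<le> 0 then 0 else exp (- 1 / t) / t ^ k)"

lemma ellk_tendsto_0: "(ellk k \<longlongrightarrow> 0) (at 0)"
proof -
  have "((\<lambda>t. ellk k (inverse t)) \<longlongrightarrow> 0) at_top"
  proof (rule Lim_transform_eventually)
    show "((\<lambda>x::real. x ^ k / exp x) \<longlongrightarrow> 0) at_top" by (rule tendsto_power_div_exp_0)
    show "\<forall>\<^sub>F x in at_top. x ^ k / exp x = ellk k (inverse x)"
      using eventually_gt_at_top[of 0]
      by eventually_elim (simp add: ellk_def exp_minus divide_simps power_inverse)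
  qed
  then have "(ellk k \<longlongrightarrow> 0) (at_right 0)"
    unfolding filterlim_at_right_to_top .
  moreover have "(ellk k \<longlongrightarrow> 0) (at_left 0)"
    by (rule Lim_transform_eventually[OF tendsto_const])
      (auto simp: eventually_at_filter ellk_def)
  ultimately show ?thesis by (simp add: filterlim_split_at)
qed

lemma ellk_deriv: "(ellk k has_real_derivative ellk (k + 2) t - real k * ellk (k + 1) t) (at t)"
proof (cases t "0::real" rule: linorder_cases)
  case less
  have "(ellk k has_real_derivative 0) (at t)"
    by (rule has_field_derivative_transform_within_open[of "\<lambda>_. 0" _ _ "{..<0}"])
      (use less in \<open>auto simp: ellk_def\<close>)
  then show ?thesis using less by (simp add: ellk_def)
next
  case equal
  have "((\<lambda>h. (ellk k (0 + h) - ellk k 0) / h) \<longlongrightarrow> 0) (at 0)"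
  \<comment> \<open>The difference quotient of \<open>ellk k\<close> at 0 is
    \<open>ellk (Suc k)\<close>.\<close>
  proof (rule Lim_transform_eventually[OF ellk_tendsto_0[of "Suc k"]])
    show "\<forall>\<^sub>F h in at 0. ellk (Suc k) h = (ellk k (0 + h) - ellk k 0) / h"
      by (simp add: ellk_def eventually_at_filter)
  qed
  then show ?thesis unfolding equal DERIV_def by (simp add: ellk_def)
next
  case greater
  have "((\<lambda>t. exp (- 1 / t) / t ^ k) has_real_derivative
      (exp (- 1 / t) / t ^ (k + 2) - real k * (exp (- 1 / t) / t ^ (k + 1)))) (at t)"
  proof (cases k)
    case 0
    then show ?thesis using greater
      by (auto intro!: derivative_eq_intros simp: field_simps power2_eq_square)
  next
    case (Suc k')
    have p: "((\<lambda>t. t ^ k) has_real_derivative real k * t ^ k') (at t)"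
      using DERIV_pow[of k t UNIV] Suc by simp
    have e: "((\<lambda>t. exp (- 1 / t)) has_real_derivative exp (- 1 / t) * (1 / t ^ 2)) (at t)"
      using greater by (auto intro!: derivative_eq_intros simp: power2_eq_square)
    have "(exp (- 1 / t) * (1 / t ^ 2) * t ^ k - exp (- 1 / t) * (real k * t ^ k')) / (t ^ k * t ^ k)
        = exp (- 1 / t) / t ^ (k + 2) - real k * (exp (- 1 / t) / t ^ (k + 1))"
      using greater by (simp add: Suc field_simps power2_eq_square)
    then show ?thesis using DERIV_divide[OF e p] greater by simp
  qed
  then have "(ellk k has_real_derivative
      (exp (- 1 / t) / t ^ (k + 2) - real k * (exp (- 1 / t) / t ^ (k + 1)))) (at t)"
    by (rule has_field_derivative_transform_within_open[of _ _ _ "{0<..}"])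
      (use greater in \<open>auto simp: ellk_def\<close>)
  then show ?thesis using greater by (simp add: ellk_def)
qed

lemma smooth1_ell: "smooth1 UNIV ell"
proof -
  have "Ck1 r UNIV (ellk k)" for r k
  proof (induction r arbitrary: k)
    case 0
    show ?case using deriv_continuous_on[OF ellk_deriv] by simp
  next
    case (Suc r)
    have "Ck1 r UNIV (\<lambda>t. ellk (k + 2) t + (- real k) * ellk (k + 1) t)"
      by (intro Ck1_add Ck1_mult Ck1_const Suc)
    then show ?case unfolding Ck1.simps
      by (intro exI[of _ "\<lambda>t. ellk (k + 2) t - real k * ellk (k + 1) t"]) (use ellk_deriv[of k] in auto)
  qed
  moreover have "ellk 0 = ell" by (auto simp: ellk_def ell_def)
  ultimately show ?thesis unfolding smooth1_def by metis
qed

lemma ell_nonneg [simp]: "0 \<le> ell t" by (simp add: ell_def)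
lemma ell_pos_iff [simp]: "0 < ell t \<longleftrightarrow> 0 < t" by (simp add: ell_def)
lemma ell_eq_0_iff [simp]: "ell t = 0 \<longleftrightarrow> t \<le> 0" by (simp add: ell_def)

text \<open>The interval \<open>{0..t}\<close> is empty for negative \<open>t\<close>. As
  \<open>f\<close> vanishes on the left of 0, the function agrees near \<open>t\<close> with the
  integral from a fixed point \<open>-K\<close>, to which the fundamental theorem applies on both
  sides of 0.\<close>

lemma deriv_integral_from_0:
  fixes f :: "real \<Rightarrow> real"
  assumes c: "continuous_on UNIV f" and z: "\<And>x. x \<le> 0 \<Longrightarrow> f x = 0"
  shows "((\<lambda>t. integral {0..t} f) has_real_derivative f t) (at t)"
proof -
  define K where "K = \<bar>t\<bar> + 1"
  have K: "t \<in> {-K<..<K}" "K > 0" by (auto simp: K_def)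
  have int: "f integrable_on {a..b}" for a b
    by (intro integrable_continuous_real continuous_on_subset[OF c]) simp
  have z': "integral {a..b} f = 0" if "b \<le> 0" for a b
    using integral_cong[of "{a..b}" f "\<lambda>_. 0"] z that by simp
  have eq: "integral {-K..s} f = integral {0..s} f" if "s \<in> {-K<..<K}" for s
  proof (cases "s \<ge> 0")
    case True
    have "integral {-K..0} f + integral {0..s} f = integral {-K..s} f"
      using K True int by (intro Henstock_Kurzweil_Integration.integral_combine) auto
    then show ?thesis using z'[of 0 "-K"] by simp
  qed (use z' in auto)
  have "((\<lambda>s. integral {-K..s} f) has_real_derivative f t) (at t within {-K..K})"
    using K by (intro integral_has_real_derivative continuous_on_subset[OF c]) auto
  then have "((\<lambda>s. integral {-K..s} f) has_real_derivative f t) (at t)"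
    using K at_within_interior[of t "{-K..K}"] by simp
  then show ?thesis
    by (rule has_field_derivative_transform_within_open[of _ _ _ "{-K<..<K}"]) (use K eq in auto)
qed

definition bump0 :: "real \<Rightarrow> real" where "bump0 x = ell (3 * x) * ell (3 - 3 * x)"

lemma smooth1_bump0: "smooth1 UNIV bump0"
proof -
  have "Ck1 r UNIV (\<lambda>x. ell (3 * x + 0) * ell (-3 * x + 3))" for r
    using smooth1_ell unfolding smooth1_def by (intro Ck1_mult Ck1_affine) auto
  moreover have "(\<lambda>x. ell (3 * x + 0) * ell (-3 * x + 3)) = bump0"
    by (simp add: bump0_def fun_eq_iff algebra_simps)
  ultimately show ?thesis unfolding smooth1_def by metis
qed

lemma continuous_bump0: "continuous_on UNIV bump0"
  using smooth1_bump0 Ck1_continuous unfolding smooth1_def by blast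

lemma alpha0_pos: "alpha0 > 0"
proof -
  have c: "continuous_on {0..1} bump0" using continuous_bump0 continuous_on_subset by blast
  have "alpha0 = integral {0..1} bump0" by (simp add: alpha0_def bump0_def[abs_def])
  moreover have "integral {0..1} bump0 \<ge> 0"
    by (intro integral_nonneg integrable_continuous_real c) (simp add: bump0_def)
  moreover have "integral {0..1} bump0 \<noteq> 0"
  proof
    assume "integral {0..1} bump0 = 0"
    then have "\<forall>x\<in>{0..1}. bump0 x = 0"
      using integral_eq_0_iff[OF c] by (auto simp: bump0_def)
    then have "bump0 (1/2) = 0" by auto
    then show False by (simp add: bump0_def)
  qed
  ultimately show ?thesis by simp
qed

lemma lam_nonpos: "t \<le> 0 \<Longrightarrow> lam t = 0"
  by (cases "t = 0") (auto simp: lam_def)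

lemma lam_deriv: "(lam has_real_derivative bump0 t / alpha0) (at t)"
proof -
  have "((\<lambda>t. integral {0..t} bump0) has_real_derivative bump0 t) (at t)"
    by (rule deriv_integral_from_0[OF continuous_bump0]) (simp add: bump0_def)
  moreover have eq: "lam = (\<lambda>t. integral {0..t} bump0 / alpha0)" by (simp add: lam_def bump0_def[abs_def] fun_eq_iff)
  ultimately show ?thesis unfolding eq by (intro DERIV_cdivide)
qed

lemma continuous_lam: "continuous_on S lam"
  by (rule deriv_continuous_on[OF lam_deriv])

lemma lam_mono: "s \<le> t \<Longrightarrow> lam s \<le> lam t"
  by (rule deriv_nonneg_mono[OF lam_deriv]) (use alpha0_pos in \<open>simp add: bump0_def\<close>)

lemma lam_nonneg: "0 \<le> lam t"
  using lam_mono[of 0 t] lam_nonpos[of t] lam_nonpos[of 0] by linarith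

text \<open>\<open>bump0\<close> is symmetric about 1/2, so the derivative of the sum is zero; the
  constant is \<open>lam 1\<close>, which the normalisation by \<open>alpha0\<close> makes
  1.\<close>

lemma lam_sym: "lam x + lam (1 - x) = 1"
proof -
  have "((\<lambda>x. lam x + lam (1 - x)) has_real_derivative 0) (at x)" for x
  proof -
    have "((\<lambda>x. lam x + lam (1 - x)) has_real_derivative (bump0 x / alpha0 + bump0 (1 - x) / alpha0 * (-1))) (at x)"
      by (intro DERIV_add lam_deriv DERIV_chain2[of lam]) (auto intro!: derivative_eq_intros)
    moreover have "bump0 (1 - x) = bump0 x" by (simp add: bump0_def algebra_simps)
    ultimately show ?thesis by simp
  qed
  then have "lam x + lam (1 - x) = lam 0 + lam (1 - 0)"
    by (intro DERIV_isconst_all[of "\<lambda>x. lam x + lam (1 - x)"]) auto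
  moreover have "lam 1 = 1" using alpha0_pos by (simp add: lam_def alpha0_def)
  ultimately show ?thesis by (simp add: lam_nonpos)
qed

definition lamint :: "real \<Rightarrow> real" where "lamint t = integral {0..t} lam"

lemma lamint_deriv: "(lamint has_real_derivative lam t) (at t)"
  unfolding lamint_def[abs_def] by (rule deriv_integral_from_0[OF continuous_lam lam_nonpos])

lemma lamint_nonpos: "t \<le> 0 \<Longrightarrow> lamint t = 0"
  by (cases "t = 0") (auto simp: lamint_def)

lemma lamint_mono: "s \<le> t \<Longrightarrow> lamint s \<le> lamint t"
  by (rule deriv_nonneg_mono[OF lamint_deriv lam_nonneg])

lemma lamint_sym: "lamint x - lamint (1 - x) = x - 1/2"
proof -
  have "((\<lambda>x. lamint x - lamint (1 - x) - x) has_real_derivative 0) (at x)" for x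
  proof -
    have "((\<lambda>x. lamint x - lamint (1 - x) - x) has_real_derivative (lam x - lam (1 - x) * (-1) - 1)) (at x)"
      by (intro DERIV_diff lamint_deriv DERIV_chain2[of lamint]) (auto intro!: derivative_eq_intros)
    then show ?thesis using lam_sym[of x] by simp
  qed
  then have c: "lamint x - lamint (1 - x) - x = lamint y - lamint (1 - y) - y" for y
    by (intro DERIV_isconst_all[of "\<lambda>x. lamint x - lamint (1 - x) - x"]) auto
  \<comment> \<open>At 0 the constant is \<open>- lamint 1\<close>, at 1 it is
    \<open>lamint 1 - 1\<close>; together these force -1/2.\<close>
  show ?thesis using c[of 0] c[of 1] by (simp add: lamint_nonpos)
qed

lemma phi_lamint: "phi t = lamint (1/2 + t)"
  by (simp add: phi_def lamint_def)

text \<open>The symmetry of \<open>lamint\<close> reads \<open>phi t - t = lamint (1/2 - t)\<close>,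
  which is nonnegative and vanishes for \<open>t >= 1/2\<close>. These two facts later straighten
  the fat disk to \<open>|v| <= 1\<close> near \<open>u = 0\<close>.\<close>

lemma phi_ge: "t \<le> phi t"
  using lamint_sym[of "1/2 + t"] lamint_mono[of "min 0 (1/2 - t)" "1/2 - t"]
    lamint_nonpos[of "min 0 (1/2 - t)"]
  by (simp add: phi_lamint)

lemma phi_eq: "1/2 \<le> t \<Longrightarrow> phi t = t"
  using lamint_sym[of "1/2 + t"] lamint_nonpos[of "1/2 - t"] by (simp add: phi_lamint)

lemma phi_mono: "s \<le> t \<Longrightarrow> phi s \<le> phi t"
  by (simp add: phi_lamint lamint_mono)

lemma smooth1_phi: "smooth1 UNIV phi"
proof -
  have 1: "Ck1 r UNIV (\<lambda>t. bump0 t * (1 / alpha0))" for r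
    using smooth1_bump0 unfolding smooth1_def by (intro Ck1_mult Ck1_const) auto
  have 2: "Ck1 (Suc r) UNIV lam" for r
    unfolding Ck1.simps using 1[of r] lam_deriv by (intro exI[of _ "\<lambda>t. bump0 t * (1 / alpha0)"]) auto
  have 3: "Ck1 (Suc (Suc r)) UNIV lamint" for r
    unfolding Ck1.simps(2)[of "Suc r"] using 2[of r] lamint_deriv by (intro exI[of _ lam]) auto
  have "Ck1 r UNIV lamint" for r using Ck1_SucD[OF Ck1_SucD[OF 3]] .
  from Ck1_affine[OF this, of _ 1 "1/2"] have "Ck1 r UNIV (\<lambda>t. lamint (1 * t + 1/2))" for r .
  moreover have "(\<lambda>t. lamint (1 * t + 1/2)) = phi" by (auto simp: phi_lamint add.commute)
  ultimately show ?thesis unfolding smooth1_def by metis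
qed

section \<open>Partitions of unity from countably many functions\<close>

text \<open>The conclusion of the theorem as a predicate, as it is established twice: for covers of
  a single fat disk, where it serves to extend functions over one cell, and for
  \<open>X\<close>.\<close>

definition subordinate_partition :: "'a set \<Rightarrow> 'a plots \<Rightarrow> 'a set set \<Rightarrow> ('a set \<Rightarrow> 'a \<Rightarrow> real) \<Rightarrow> bool" where
  "subordinate_partition X Pl \<U> \<rho> \<longleftrightarrow>
    (\<forall>U\<in>\<U>. smooth_real Pl (\<rho> U)) \<and>
    (\<forall>U\<in>\<U>. \<forall>x\<in>X. 0 \<le> \<rho> U x \<and> \<rho> U x \<le> 1) \<and>
    (\<forall>U\<in>\<U>. D_support X Pl (\<rho> U) \<subseteq> U) \<and>
    (\<forall>x\<in>X. \<exists>W. D_open X Pl W \<and> x \<in> W \<and>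
        finite {U\<in>\<U>. D_support X Pl (\<rho> U) \<inter> W \<noteq> {}}) \<and>
    (\<forall>x\<in>X. (\<Sum>U\<in>{U\<in>\<U>. \<rho> U x \<noteq> 0}. \<rho> U x) = 1)"

text \<open>A setting shared by \<open>X\<close> and by subsets of R^n with \<open>euc_plot\<close>,
  so that the countable criterion below also applies inside a single disk.\<close>

locale plot_space =
  fixes X :: "'a set" and Pl :: "'a plots"
  assumes plot_open: "Pl k U P \<Longrightarrow> open_euc k U"
    and plot_image: "Pl k U P \<Longrightarrow> P ` U \<subseteq> X"
begin

lemma D_open_subset: "D_open X Pl W \<Longrightarrow> W \<subseteq> X"
  by (simp add: D_open_def)

lemma D_openD: "D_open X Pl W \<Longrightarrow> Pl k U P \<Longrightarrow> open_euc k {u\<in>U. P u \<in> W}"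
  by (simp add: D_open_def)

lemma D_open_space: "D_open X Pl X"
  unfolding D_open_def
proof (intro conjI allI impI)
  fix k U P assume P: "Pl k U P"
  then have "{u\<in>U. P u \<in> X} = U" using plot_image by blast
  then show "open_euc k {u\<in>U. P u \<in> X}" using plot_open[OF P] by simp
qed simp

lemma D_open_Union:
  assumes "\<And>W. W \<in> F \<Longrightarrow> D_open X Pl W"
  shows "D_open X Pl (\<Union>F)"
  unfolding D_open_def
proof (intro conjI allI impI)
  show "\<Union>F \<subseteq> X" using assms D_open_subset by blast
  fix k U P assume P: "Pl k U P"
  have "open_euc k (\<Union>W\<in>F. {u\<in>U. P u \<in> W})"
    by (rule open_euc_Union) (use assms D_openD[OF _ P] in auto)
  moreover have "(\<Union>W\<in>F. {u\<in>U. P u \<in> W}) = {u\<in>U. P u \<in> \<Union>F}" by blast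
  ultimately show "open_euc k {u\<in>U. P u \<in> \<Union>F}" by simp
qed

lemma D_open_Int:
  assumes "D_open X Pl V" "D_open X Pl W"
  shows "D_open X Pl (V \<inter> W)"
  unfolding D_open_def
proof (intro conjI allI impI)
  show "V \<inter> W \<subseteq> X" using assms D_open_subset by blast
  fix k U P assume P: "Pl k U P"
  have "{u\<in>U. P u \<in> V \<inter> W} = {u\<in>U. P u \<in> V} \<inter> {u\<in>U. P u \<in> W}" by blast
  then show "open_euc k {u\<in>U. P u \<in> V \<inter> W}"
    using open_euc_Int assms D_openD[OF _ P] by simp
qed

lemma D_open_Inter_finite:
  assumes "finite A" "\<And>a. a \<in> A \<Longrightarrow> D_open X Pl (W a)"
  shows "D_open X Pl (X \<inter> (\<Inter>a\<in>A. W a))"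
  using assms
proof (induction A)
  case empty
  then show ?case using D_open_space by simp
next
  case (insert a A)
  have "X \<inter> (\<Inter>a\<in>insert a A. W a) = W a \<inter> (X \<inter> (\<Inter>a\<in>A. W a))" by auto
  then show ?case using insert D_open_Int by simp
qed

lemma D_open_locally:
  assumes "\<And>x. x \<in> W \<Longrightarrow> \<exists>V. D_open X Pl V \<and> x \<in> V \<and> V \<subseteq> W"
  shows "D_open X Pl W"
proof -
  have "W = \<Union>{V. D_open X Pl V \<and> V \<subseteq> W}" using assms by blast
  then show ?thesis using D_open_Union[of "{V. D_open X Pl V \<and> V \<subseteq> W}"] by auto
qed

lemma smooth_realD: "smooth_real Pl f \<Longrightarrow> Pl k U P \<Longrightarrow> smooth_fun k U (\<lambda>u. f (P u))"
  by (simp add: smooth_real_def comp_def)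

lemma smooth_realI: "(\<And>k U P. Pl k U P \<Longrightarrow> smooth_fun k U (\<lambda>u. f (P u))) \<Longrightarrow> smooth_real Pl f"
  by (simp add: smooth_real_def comp_def)

lemma D_open_vimage:
  assumes "smooth_real Pl f" "open B"
  shows "D_open X Pl {x\<in>X. f x \<in> B}"
  unfolding D_open_def
proof (intro conjI allI impI)
  fix k U P assume P: "Pl k U P"
  have "open_euc k {u\<in>U. f (P u) \<in> B}"
    by (rule open_euc_vimage[OF plot_open[OF P] smooth_continuous[OF plot_open[OF P] smooth_realD[OF assms(1) P]] assms(2)])
  moreover have "{u\<in>U. P u \<in> {x\<in>X. f x \<in> B}} = {u\<in>U. f (P u) \<in> B}" using plot_image[OF P] by auto
  ultimately show "open_euc k {u\<in>U. P u \<in> {x\<in>X. f x \<in> B}}" by simp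
qed auto

lemma smooth_real_const: "smooth_real Pl (\<lambda>_. c)"
  by (rule smooth_realI) (simp add: plot_open smooth_const)

lemma smooth_real_mult: "smooth_real Pl f \<Longrightarrow> smooth_real Pl g \<Longrightarrow> smooth_real Pl (\<lambda>x. f x * g x)"
  by (rule smooth_realI) (simp add: plot_open smooth_mult smooth_realD)

lemma smooth_real_diff: "smooth_real Pl f \<Longrightarrow> smooth_real Pl g \<Longrightarrow> smooth_real Pl (\<lambda>x. f x - g x)"
  by (rule smooth_realI) (simp add: plot_open smooth_diff smooth_realD)

lemma smooth_real_sum: "(\<And>a. a \<in> A \<Longrightarrow> smooth_real Pl (f a)) \<Longrightarrow> smooth_real Pl (\<lambda>x. \<Sum>a\<in>A. f a x)"
  by (rule smooth_realI) (simp add: plot_open smooth_sum smooth_realD)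

lemma smooth_real_prod: "(\<And>a. a \<in> A \<Longrightarrow> smooth_real Pl (f a)) \<Longrightarrow> smooth_real Pl (\<lambda>x. \<Prod>a\<in>A. f a x)"
  by (rule smooth_realI) (simp add: plot_open smooth_prod smooth_realD)

lemma smooth_real_compose1:
  assumes "smooth_real Pl f" "smooth1 T \<phi>" "f ` X \<subseteq> T"
  shows "smooth_real Pl (\<lambda>x. \<phi> (f x))"
proof (rule smooth_realI)
  fix k U P assume P: "Pl k U P"
  then have "(\<lambda>u. f (P u)) ` U \<subseteq> T" using plot_image[OF P] assms(3) by blast
  then show "smooth_fun k U (\<lambda>u. \<phi> (f (P u)))"
    by (rule smooth_compose1[OF plot_open[OF P] smooth_realD[OF assms(1) P] assms(2)])
qed

lemma smooth_real_local:
  assumes "\<And>x. x \<in> X \<Longrightarrow> \<exists>W g. D_open X Pl W \<and> x \<in> W \<and> smooth_real Pl g \<and> (\<forall>y\<in>W. f y = g y)"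
  shows "smooth_real Pl f"
proof (rule smooth_realI)
  fix k U P assume P: "Pl k U P"
  show "smooth_fun k U (\<lambda>u. f (P u))"
  proof (rule smooth_local[OF plot_open[OF P]])
    fix u assume u: "u \<in> U"
    then have "P u \<in> X" using plot_image[OF P] by blast
    from assms[OF this] obtain W g where W: "D_open X Pl W" "P u \<in> W" "smooth_real Pl g"
      "\<forall>y\<in>W. f y = g y" by blast
    let ?V = "{u\<in>U. P u \<in> W}"
    have V: "open_euc k ?V" by (rule D_openD[OF W(1) P])
    have "smooth_fun k ?V (\<lambda>u. g (P u))"
      by (rule smooth_subset[OF plot_open[OF P] V _ smooth_realD[OF W(3) P]]) auto
    then have "smooth_fun k ?V (\<lambda>u. f (P u))"
      by (rule smooth_cong[OF V, rotated]) (use W(4) in auto)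
    then show "\<exists>V. open_euc k V \<and> u \<in> V \<and> V \<subseteq> U \<and> smooth_fun k V (\<lambda>u. f (P u))"
      using V u W(2) by (intro exI[of _ ?V]) auto
  qed
qed

lemma D_closure_subset: "C \<subseteq> X \<Longrightarrow> D_open X Pl (X - C) \<Longrightarrow> A \<subseteq> C \<Longrightarrow> D_closure X Pl A \<subseteq> C"
  unfolding D_closure_def by blast

text \<open>The functions \<open>F p\<close> are made locally finite by damping \<open>F p\<close> wherever an earlier one exceeds
  \<open>1/p\<close>; the disjoint open sets \<open>Y p U\<close> distribute each of them over the members of the cover.\<close>

theorem partition_of_unity_countable:
  fixes F :: "nat \<Rightarrow> 'a \<Rightarrow> real" and Y :: "nat \<Rightarrow> 'a set \<Rightarrow> 'a set"
  assumes F: "\<And>p. smooth_real Pl (F p)"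
    and Y: "\<And>p U. U \<in> \<U> \<Longrightarrow> D_open X Pl (Y p U)" "\<And>p U. U \<in> \<U> \<Longrightarrow> Y p U \<subseteq> U"
    and disj: "\<And>p U V. U \<in> \<U> \<Longrightarrow> V \<in> \<U> \<Longrightarrow> U \<noteq> V \<Longrightarrow> Y p U \<inter> Y p V = {}"
    and sub: "\<And>p x. x \<in> X \<Longrightarrow> F p x \<ge> 0 \<Longrightarrow> \<exists>U\<in>\<U>. x \<in> Y p U"
    and cov: "\<And>x. x \<in> X \<Longrightarrow> \<exists>p. F p x > 0"
  shows "\<exists>\<rho>. subordinate_partition X Pl \<U> \<rho>"
proof -
  define a where "a = (\<lambda>p x. ell (F p x))"
  have a: "smooth_real Pl (a p)" for p
    unfolding a_def by (rule smooth_real_compose1[OF F smooth1_ell]) simp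
  \<comment> \<open>A factor vanishes as soon as an earlier \<open>a q\<close> reaches
    \<open>1 / real p\<close>. For \<open>p = 0\<close> the product is empty, so the default value
    of \<open>1 / 0\<close> never enters.\<close>
  define H where "H = (\<lambda>p x. a p x * (\<Prod>q<p. ell (1 / real p - a q x)))"
  have H: "smooth_real Pl (H p)" for p
    unfolding H_def
    by (intro smooth_real_mult a smooth_real_prod smooth_real_compose1[OF _ smooth1_ell]
        smooth_real_diff smooth_real_const) auto
  have H0: "H p x \<ge> 0" for p x by (simp add: H_def a_def prod_nonneg)
  \<comment> \<open>The weak inequalities make \<open>C p\<close> D-closed, and it contains all
    points where \<open>H p\<close> is nonzero; the supports are controlled through it.\<close>
  define C where "C = (\<lambda>p. {x\<in>X. F p x \<ge> 0 \<and> (\<forall>q<p. a q x \<le> 1 / real p)})"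
  have HC: "x \<in> C p" if "x \<in> X" "H p x \<noteq> 0" for p x
    using that by (auto simp: H_def C_def a_def not_le intro: less_imp_le)
  have Hcov: "\<exists>p. H p x > 0" if x: "x \<in> X" for x
  proof -
    \<comment> \<open>At the least index with \<open>F p x > 0\<close> all earlier
      \<open>a q\<close> vanish at \<open>x\<close>, so nothing is damped to zero.\<close>
    define p where "p = (LEAST p. F p x > 0)"
    have p: "F p x > 0" unfolding p_def using cov[OF x] by (rule LeastI_ex)
    have "a q x = 0" if "q < p" for q
      using not_less_Least[of q "\<lambda>p. F p x > 0"] that unfolding p_def a_def by simp
    then have "(\<Prod>q<p. ell (1 / real p - a q x)) > 0" by (intro prod_pos) auto
    then have "H p x > 0" using p by (simp add: H_def a_def)
    then show ?thesis ..
  qed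
  have Cclosed: "D_open X Pl (X - C p)" for p
  proof -
    have "X - C p = {x\<in>X. F p x \<in> {..<0}} \<union> (\<Union>q<p. {x\<in>X. a q x \<in> {1 / real p<..}})"
      by (auto simp: C_def)
    also have "\<dots> = \<Union>(insert {x\<in>X. F p x \<in> {..<0}} ((\<lambda>q. {x\<in>X. a q x \<in> {1 / real p<..}}) ` {..<p}))"
      by simp
    also have "D_open X Pl \<dots>"
      by (rule D_open_Union) (use D_open_vimage[OF F open_lessThan] D_open_vimage[OF a open_greaterThan] in auto)
    finally show ?thesis .
  qed
  have nbhd: "\<exists>W P u. D_open X Pl W \<and> x \<in> W \<and> (\<forall>p\<ge>P. C p \<inter> W = {}) \<and>
     (\<forall>p<P. \<forall>U\<in>\<U>. C p \<inter> Y p U \<inter> W \<noteq> {} \<longrightarrow> U = u p \<and> x \<in> C p \<and> x \<in> Y p U)" if x: "x \<in> X" for x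
  proof -
    obtain p0 where p0: "a p0 x > 0" using cov[OF x] by (auto simp: a_def)
    \<comment> \<open>Where \<open>a p0\<close> exceeds \<open>c\<close>, every
      \<open>p > p0\<close> with \<open>1 / real p < c\<close> violates the condition for
      \<open>q = p0\<close> in \<open>C p\<close>; hence almost all \<open>C p\<close> miss this
      neighbourhood of \<open>x\<close>.\<close>
    define c where "c = a p0 x / 2"
    have c: "c > 0" using p0 by (simp add: c_def)
    define N where "N = {y\<in>X. a p0 y \<in> {c<..}}"
    have N: "D_open X Pl N" unfolding N_def by (rule D_open_vimage[OF a open_greaterThan])
    have xN: "x \<in> N" using x p0 by (simp add: N_def c_def)
    obtain P0 :: nat where P0: "1 / c < real P0" using reals_Archimedean2 by blast
    define P where "P = max (Suc p0) P0"
    have far: "C p \<inter> N = {}" if p: "p \<ge> P" for p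
    proof -
      have "1 / c < real p" "p0 < p" "p > 0" using P0 p by (auto simp: P_def)
      then have "1 / real p < c" using c by (simp add: field_simps)
      then show ?thesis using \<open>p0 < p\<close> by (force simp: C_def N_def)
    qed
    have "\<forall>p. \<exists>U. x \<in> C p \<longrightarrow> U \<in> \<U> \<and> x \<in> Y p U"
    proof
      fix p show "\<exists>U. x \<in> C p \<longrightarrow> U \<in> \<U> \<and> x \<in> Y p U"
        using sub[OF x, of p] unfolding C_def by blast
    qed
    then obtain u where u: "\<And>p. x \<in> C p \<Longrightarrow> u p \<in> \<U> \<and> x \<in> Y p (u p)" by metis
    \<comment> \<open>If \<open>x\<close> lies in \<open>C p\<close>, shrinking into its own
      \<open>Y p (u p)\<close> excludes the other members by disjointness; otherwise all of
      \<open>C p\<close> is avoided.\<close>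
    define V where "V = (\<lambda>p. if x \<in> C p then Y p (u p) else X - C p)"
    have V: "D_open X Pl (V p)" "x \<in> V p" for p
      using u Y Cclosed x by (auto simp: V_def)
    define W where "W = N \<inter> (X \<inter> (\<Inter>p\<in>{..<P}. V p))"
    have W: "D_open X Pl W"
      unfolding W_def by (intro D_open_Int N D_open_Inter_finite V(1)) simp
    have xW: "x \<in> W" using V(2) xN x by (simp add: W_def)
    have "\<forall>p\<ge>P. C p \<inter> W = {}" using far unfolding W_def by blast
    moreover have "U = u p \<and> x \<in> C p \<and> x \<in> Y p U"
      if pU: "p < P" "U \<in> \<U>" "C p \<inter> Y p U \<inter> W \<noteq> {}" for p U
    proof -
      obtain y where y: "y \<in> C p" "y \<in> Y p U" "y \<in> V p" using pU by (auto simp: W_def)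
      then have xC: "x \<in> C p" by (auto simp: V_def split: if_splits)
      then have "y \<in> Y p (u p)" using y by (simp add: V_def)
      then have "U = u p" using disj[OF pU(2), of "u p" p] u[OF xC] y by blast
      then show ?thesis using u xC by simp
    qed
    ultimately show ?thesis using W xW by blast
  qed
  define T where "T = (\<lambda>x. \<Sum>p. H p x)"
  \<comment> \<open>Cutting \<open>H p\<close> off outside \<open>Y p U\<close> keeps it smooth: a
    point of \<open>X\<close> outside \<open>Y p U\<close> lies either in another, disjoint
    \<open>Y p V\<close> or outside the closed set \<open>C p\<close>, and the result is zero near
    it in both cases.\<close>
  define G where "G = (\<lambda>p U x. if x \<in> Y p U then H p x else 0)"
  define R where "R = (\<lambda>U x. \<Sum>p. G p U x)"
  have G0: "G p U x \<ge> 0" "G p U x \<le> H p x" for p U x using H0 by (auto simp: G_def)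
  have GH: "H p x = 0 \<Longrightarrow> G p U x = 0" for p U x by (simp add: G_def)
  have finsum: "T y = (\<Sum>p<P. H p y)" "R U y = (\<Sum>p<P. G p U y)"
    if "\<forall>p\<ge>P. C p \<inter> W = {}" "y \<in> W" "W \<subseteq> X" for P W y U
  proof -
    have z: "H p y = 0" if "p \<notin> {..<P}" for p
    proof -
      have "C p \<inter> W = {}" using \<open>\<forall>p\<ge>P. C p \<inter> W = {}\<close> that by simp
      then show ?thesis using HC[of y p] \<open>y \<in> W\<close> \<open>W \<subseteq> X\<close> by blast
    qed
    show "T y = (\<Sum>p<P. H p y)" unfolding T_def by (rule suminf_finite) (use z in auto)
    show "R U y = (\<Sum>p<P. G p U y)" unfolding R_def by (rule suminf_finite) (use z GH in auto)
  qed
  have G: "smooth_real Pl (G p U)" if U: "U \<in> \<U>" for p U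
  proof (rule smooth_real_local)
    fix x assume x: "x \<in> X"
    show "\<exists>W g. D_open X Pl W \<and> x \<in> W \<and> smooth_real Pl g \<and> (\<forall>y\<in>W. G p U y = g y)"
    proof (cases "x \<in> Y p U")
      case True
      then show ?thesis using Y(1)[OF U] H
        by (intro exI[of _ "Y p U"] exI[of _ "H p"]) (auto simp: G_def)
    next
      case nY: False
      show ?thesis
      proof (cases "x \<in> C p")
        case True
        then obtain V where V: "V \<in> \<U>" "x \<in> Y p V" using sub[OF x, of p] unfolding C_def by blast
        then have "Y p V \<inter> Y p U = {}" using disj[OF V(1) U] nY by blast
        then show ?thesis using Y(1)[OF V(1)] V smooth_real_const[of 0]
          by (intro exI[of _ "Y p V"] exI[of _ "\<lambda>_. 0"]) (auto simp: G_def)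
      next
        case False
        then show ?thesis using Cclosed x smooth_real_const[of 0] HC
          by (intro exI[of _ "X - C p"] exI[of _ "\<lambda>_. 0"]) (auto simp: G_def)
      qed
    qed
  qed
  have T: "smooth_real Pl T"
  proof (rule smooth_real_local)
    fix x assume x: "x \<in> X"
    obtain W P where W: "D_open X Pl W" "x \<in> W" "\<forall>p\<ge>P. C p \<inter> W = {}" using nbhd[OF x] by blast
    have "\<forall>y\<in>W. T y = (\<Sum>p<P. H p y)"
      using finsum(1)[OF W(3) _ D_open_subset[OF W(1)]] by blast
    moreover have "smooth_real Pl (\<lambda>y. \<Sum>p<P. H p y)" by (rule smooth_real_sum) (rule H)
    ultimately show "\<exists>W g. D_open X Pl W \<and> x \<in> W \<and> smooth_real Pl g \<and> (\<forall>y\<in>W. T y = g y)"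
      using W by blast
  qed
  have R: "smooth_real Pl (R U)" if "U \<in> \<U>" for U
  proof (rule smooth_real_local)
    fix x assume x: "x \<in> X"
    obtain W P where W: "D_open X Pl W" "x \<in> W" "\<forall>p\<ge>P. C p \<inter> W = {}" using nbhd[OF x] by blast
    have "\<forall>y\<in>W. R U y = (\<Sum>p<P. G p U y)"
      using finsum(2)[OF W(3) _ D_open_subset[OF W(1)]] by blast
    moreover have "smooth_real Pl (\<lambda>y. \<Sum>p<P. G p U y)" by (rule smooth_real_sum) (rule G[OF that])
    ultimately show "\<exists>W g. D_open X Pl W \<and> x \<in> W \<and> smooth_real Pl g \<and> (\<forall>y\<in>W. R U y = g y)"
      using W by blast
  qed
  have Tpos: "T x > 0" if x: "x \<in> X" for x
  proof -
    obtain W P where W: "D_open X Pl W" "x \<in> W" "\<forall>p\<ge>P. C p \<inter> W = {}" using nbhd[OF x] by blast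
    have Tx: "T x = (\<Sum>p<P. H p x)" by (rule finsum(1)[OF W(3,2) D_open_subset[OF W(1)]])
    obtain p where p: "H p x > 0" using Hcov[OF x] by blast
    then have "x \<in> C p" using HC x by auto
    then have "p < P" using W by (meson disjoint_iff not_le)
    then have "H p x \<le> T x" unfolding Tx using H0 by (intro member_le_sum) auto
    then show ?thesis using p by linarith
  qed
  define \<rho> where "\<rho> = (\<lambda>U x. R U x * inverse (T x))"
  have smooth: "smooth_real Pl (\<rho> U)" if "U \<in> \<U>" for U
    unfolding \<rho>_def using Tpos
    by (intro smooth_real_mult R[OF that] smooth_real_compose1[OF T smooth1_inverse]) auto
  have bounds: "0 \<le> \<rho> U x \<and> \<rho> U x \<le> 1" if x: "x \<in> X" for U x
  proof -
    obtain W P where W: "D_open X Pl W" "x \<in> W" "\<forall>p\<ge>P. C p \<inter> W = {}" using nbhd[OF x] by blast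
    have "T x = (\<Sum>p<P. H p x)" "R U x = (\<Sum>p<P. G p U x)"
      by (rule finsum[OF W(3,2) D_open_subset[OF W(1)]])+
    then have "0 \<le> R U x" "R U x \<le> T x" using G0 by (auto intro!: sum_nonneg sum_mono)
    then show ?thesis using Tpos[OF x] by (simp add: \<rho>_def field_simps)
  qed
  \<comment> \<open>A piece \<open>C p \<inter> Y p U\<close> meets the neighbourhood of
    \<open>x\<close> from \<open>nbhd\<close> only if it contains \<open>x\<close>, so this infinite
    union is still D-closed and encloses the support.\<close>
  define E where "E = (\<lambda>U. \<Union>p. C p \<inter> Y p U)"
  have supp: "D_support X Pl (\<rho> U) \<subseteq> E U" if U: "U \<in> \<U>" for U
    unfolding D_support_def
  proof (rule D_closure_subset)
    show "E U \<subseteq> X" by (auto simp: E_def C_def)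
    show "{x\<in>X. \<rho> U x \<noteq> 0} \<subseteq> E U"
    proof
      fix x assume x: "x \<in> {x\<in>X. \<rho> U x \<noteq> 0}"
      then have "R U x \<noteq> 0" by (auto simp: \<rho>_def)
      moreover have "R U x = 0" if "\<And>p. G p U x = 0" using that by (simp add: R_def)
      ultimately obtain p where "G p U x \<noteq> 0" by blast
      then have "x \<in> Y p U" "H p x \<noteq> 0" by (auto simp: G_def split: if_splits)
      then show "x \<in> E U" using HC[of x p] x by (auto simp: E_def)
    qed
    show "D_open X Pl (X - E U)"
    proof (rule D_open_locally)
      fix x assume x: "x \<in> X - E U"
      then obtain W P u where W: "D_open X Pl W" "x \<in> W" "\<forall>p\<ge>P. C p \<inter> W = {}"
        "\<forall>p<P. \<forall>U\<in>\<U>. C p \<inter> Y p U \<inter> W \<noteq> {} \<longrightarrow> U = u p \<and> x \<in> C p \<and> x \<in> Y p U"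
        using nbhd[of x] by blast
      have "W \<inter> E U = {}"
      proof (rule ccontr)
        assume "W \<inter> E U \<noteq> {}"
        then obtain p where p: "C p \<inter> Y p U \<inter> W \<noteq> {}" by (auto simp: E_def)
        then have "p < P" using W(3) by (meson disjoint_iff not_le IntD1 IntD2)
        then have "x \<in> C p \<and> x \<in> Y p U" using W(4) U p by blast
        then show False using x by (auto simp: E_def)
      qed
      then show "\<exists>V. D_open X Pl V \<and> x \<in> V \<and> V \<subseteq> X - E U"
        using W D_open_subset[OF W(1)] by blast
    qed
  qed
  have EU: "E U \<subseteq> U" if "U \<in> \<U>" for U using Y(2)[OF that] by (auto simp: E_def)
  have locfin: "\<exists>W. D_open X Pl W \<and> x \<in> W \<and> finite {U\<in>\<U>. D_support X Pl (\<rho> U) \<inter> W \<noteq> {}}"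
    if x: "x \<in> X" for x
  proof -
    obtain W P u where W: "D_open X Pl W" "x \<in> W" "\<forall>p\<ge>P. C p \<inter> W = {}"
        "\<forall>p<P. \<forall>U\<in>\<U>. C p \<inter> Y p U \<inter> W \<noteq> {} \<longrightarrow> U = u p \<and> x \<in> C p \<and> x \<in> Y p U"
      using nbhd[OF x] by blast
    have "{U\<in>\<U>. D_support X Pl (\<rho> U) \<inter> W \<noteq> {}} \<subseteq> u ` {..<P}"
    proof
      fix U assume "U \<in> {U\<in>\<U>. D_support X Pl (\<rho> U) \<inter> W \<noteq> {}}"
      then have U: "U \<in> \<U>" "E U \<inter> W \<noteq> {}" using supp by blast+
      then obtain p where p: "C p \<inter> Y p U \<inter> W \<noteq> {}" by (auto simp: E_def)
      then have "p < P" using W(3) by (meson disjoint_iff not_le IntD1 IntD2)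
      then show "U \<in> u ` {..<P}" using W(4) U(1) p by blast
    qed
    then have "finite {U\<in>\<U>. D_support X Pl (\<rho> U) \<inter> W \<noteq> {}}" by (rule finite_subset) simp
    then show ?thesis using W(1,2) by blast
  qed
  have total: "(\<Sum>U\<in>{U\<in>\<U>. \<rho> U x \<noteq> 0}. \<rho> U x) = 1" if x: "x \<in> X" for x
  proof -
    obtain W P u where W: "D_open X Pl W" "x \<in> W" "\<forall>p\<ge>P. C p \<inter> W = {}"
        "\<forall>p<P. \<forall>U\<in>\<U>. C p \<inter> Y p U \<inter> W \<noteq> {} \<longrightarrow> U = u p \<and> x \<in> C p \<and> x \<in> Y p U"
      using nbhd[OF x] by blast
    have Tx: "T x = (\<Sum>p<P. H p x)" and Rx: "\<And>U. R U x = (\<Sum>p<P. G p U x)"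
      by (rule finsum[OF W(3,2) D_open_subset[OF W(1)]])+
    define B where "B = \<U> \<inter> u ` {..<P}"
    have uB: "U \<in> B" if "p < P" "U \<in> \<U>" "x \<in> C p" "x \<in> Y p U" for p U
    proof -
      have "C p \<inter> Y p U \<inter> W \<noteq> {}" using W(2) that by blast
      then have "U = u p" using W(4) that by blast
      then show ?thesis using that by (simp add: B_def)
    qed
    \<comment> \<open>The sets \<open>Y p U\<close> are disjoint in \<open>U\<close>, so all of
      \<open>H p x\<close> goes to a single member of the cover.\<close>
    have row: "(\<Sum>U\<in>B. G p U x) = H p x" if p: "p < P" for p
    proof (cases "H p x = 0")
      case True
      then show ?thesis using GH by simp
    next
      case False
      then have xC: "x \<in> C p" using HC x by blast
      then obtain V where V: "V \<in> \<U>" "x \<in> Y p V" using sub[OF x, of p] unfolding C_def by blast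
      then have VB: "V \<in> B" using uB p xC by blast
      have "(\<Sum>U\<in>B. G p U x) = (\<Sum>U\<in>B. if U = V then H p x else 0)"
      proof (rule sum.cong)
        fix U assume "U \<in> B"
        then have "U \<in> \<U>" by (simp add: B_def)
        then show "G p U x = (if U = V then H p x else 0)"
          using disj[OF \<open>U \<in> \<U>\<close> V(1), of p] V by (auto simp: G_def)
      qed simp
      then show ?thesis using VB by (simp add: B_def)
    qed
    have sub': "{U\<in>\<U>. \<rho> U x \<noteq> 0} \<subseteq> B"
    proof
      fix U assume U: "U \<in> {U\<in>\<U>. \<rho> U x \<noteq> 0}"
      then have "R U x \<noteq> 0" by (auto simp: \<rho>_def)
      moreover have "R U x = 0" if "\<And>p. p < P \<Longrightarrow> G p U x = 0" using that by (simp add: Rx)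
      ultimately obtain p where "p < P" "G p U x \<noteq> 0" by blast
      then have "x \<in> Y p U" "H p x \<noteq> 0" by (auto simp: G_def split: if_splits)
      then show "U \<in> B" using uB[OF \<open>p < P\<close>, of U] HC[OF x, of p] U by blast
    qed
    have "(\<Sum>U\<in>{U\<in>\<U>. \<rho> U x \<noteq> 0}. \<rho> U x) = (\<Sum>U\<in>B. \<rho> U x)"
      by (rule sum.mono_neutral_left) (use sub' in \<open>auto simp: B_def\<close>)
    also have "\<dots> = (\<Sum>U\<in>B. \<Sum>p<P. G p U x) * inverse (T x)"
      by (simp add: \<rho>_def Rx sum_distrib_right)
    also have "(\<Sum>U\<in>B. \<Sum>p<P. G p U x) = (\<Sum>p<P. \<Sum>U\<in>B. G p U x)" by (rule sum.swap)
    also have "\<dots> = T x" unfolding Tx by (intro sum.cong) (use row in auto)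
    finally show ?thesis using Tpos[OF x] by simp
  qed
  show ?thesis unfolding subordinate_partition_def
  proof (intro exI[of _ \<rho>] conjI ballI)
    show "D_support X Pl (\<rho> U) \<subseteq> U" if "U \<in> \<U>" for U using supp[OF that] EU[OF that] by blast
  qed (use smooth bounds locfin total in auto)
qed

end

section \<open>Seeley's coefficients\<close>

text \<open>The entire function \<open>B z = \<Sum> \<beta>\<^sub>k z\<^sup>k\<close> satisfies
  \<open>B (2z) = (1 - 2z) B z\<close>, hence vanishes at all \<open>2\<^sup>i\<close>; therefore \<open>A z = \<Sum> \<beta>\<^sub>k / (2\<^sup>k + 1) z\<^sup>k\<close>, which
  satisfies \<open>A (2z) + A z = B z\<close>, alternates in sign along the powers of 2.\<close>

primrec seeley_beta :: "nat \<Rightarrow> real" where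
  "seeley_beta 0 = 1"
| "seeley_beta (Suc k) = - 2 * seeley_beta k / (2 ^ Suc k - 1)"

lemma two_power_gt_1: "(1::real) < 2 ^ Suc k"
  by (rule one_less_power) auto

lemma seeley_beta_ratio:
  "\<bar>seeley_beta (Suc k)\<bar> = \<bar>seeley_beta k\<bar> * (2 / (2 ^ Suc k - 1))"
  using two_power_gt_1[of k] by (simp add: abs_mult)

declare seeley_beta.simps(2) [simp del]

lemma summable_seeley_beta: "summable (\<lambda>k. \<bar>seeley_beta k * z ^ k\<bar>)"
proof -
  \<comment> \<open>Consecutive terms have the ratio \<open>2 * |z| / (2 ^ Suc k - 1)\<close> in
    absolute value, at most 1/2 from \<open>M\<close> on.\<close>
  obtain M where M: "4 * \<bar>z\<bar> + 1 < 2 ^ M" using real_arch_pow[of 2] by auto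
  show ?thesis
  proof (rule summable_ratio_test[of "1/2" M])
    fix k assume k: "k \<ge> M"
    have "(2::real) ^ M \<le> 2 ^ Suc k" using k by (intro power_increasing) auto
    then have "4 * \<bar>z\<bar> \<le> 2 ^ Suc k - 1" using M by linarith
    then have "2 / (2 ^ Suc k - 1) * \<bar>z\<bar> \<le> 1 / 2"
      using two_power_gt_1[of k] by (simp add: field_simps)
    then have "\<bar>seeley_beta k * z ^ k\<bar> * (2 / (2 ^ Suc k - 1) * \<bar>z\<bar>) \<le> \<bar>seeley_beta k * z ^ k\<bar> * (1 / 2)"
      by (intro mult_left_mono) auto
    moreover have "\<bar>seeley_beta (Suc k) * z ^ Suc k\<bar> = \<bar>seeley_beta k * z ^ k\<bar> * (2 / (2 ^ Suc k - 1) * \<bar>z\<bar>)"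
      unfolding abs_mult seeley_beta_ratio by (simp add: power_abs abs_mult)
    ultimately show "norm \<bar>seeley_beta (Suc k) * z ^ Suc k\<bar> \<le> 1 / 2 * norm \<bar>seeley_beta k * z ^ k\<bar>"
      unfolding real_norm_def abs_abs by linarith
  qed simp
qed

definition seeley_B :: "real \<Rightarrow> real" where "seeley_B z = (\<Sum>k. seeley_beta k * z ^ k)"

text \<open>Comparison of coefficients: the recursion says
  \<open>(2 ^ Suc k - 1) * seeley_beta (Suc k) = - 2 * seeley_beta k\<close>.\<close>

lemma seeley_B_double: "seeley_B (2 * z) = (1 - 2 * z) * seeley_B z"
proof -
  have s: "summable (\<lambda>k. seeley_beta k * z ^ k)" for z
    using summable_seeley_beta by (rule summable_rabs_cancel)
  have rec: "seeley_beta (Suc k) * (2 * z) ^ Suc k = seeley_beta (Suc k) * z ^ Suc k - 2 * z * (seeley_beta k * z ^ k)" for k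
  proof -
    have "seeley_beta (Suc k) * (2 ^ Suc k - 1) = - 2 * seeley_beta k"
      using two_power_gt_1[of k] by (simp add: seeley_beta.simps(2))
    then have "seeley_beta (Suc k) * (2 ^ Suc k - 1) * z ^ Suc k = - 2 * seeley_beta k * z ^ Suc k" by simp
    then show ?thesis by (simp add: power_mult_distrib algebra_simps)
  qed
  have "seeley_B (2 * z) = 1 + (\<Sum>k. seeley_beta (Suc k) * (2 * z) ^ Suc k)"
    unfolding seeley_B_def using suminf_split_head[OF s[of "2 * z"]] by simp
  also have "\<dots> = 1 + ((\<Sum>k. seeley_beta (Suc k) * z ^ Suc k) - (\<Sum>k. 2 * z * (seeley_beta k * z ^ k)))"
    unfolding rec
    by (subst suminf_diff) (use s[of z] summable_mult[OF s[of z]] summable_Suc_iff[of "\<lambda>k. seeley_beta k * z ^ k"] in auto)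
  also have "(\<Sum>k. seeley_beta (Suc k) * z ^ Suc k) = seeley_B z - 1"
    unfolding seeley_B_def using suminf_split_head[OF s[of z]] by simp
  also have "(\<Sum>k. 2 * z * (seeley_beta k * z ^ k)) = 2 * z * seeley_B z"
    unfolding seeley_B_def by (rule suminf_mult[OF s])
  finally show ?thesis by (simp add: algebra_simps)
qed

lemma seeley_B_power: "seeley_B (2 ^ i) = 0"
proof (induction i)
  case 0
  then show ?case using seeley_B_double[of "1/2"] by simp
next
  case (Suc i)
  then show ?case using seeley_B_double[of "2 ^ i"] by simp
qed

definition seeley_gam :: "nat \<Rightarrow> real" where "seeley_gam k = seeley_beta k / (2 ^ k + 1)"
definition seeley_A :: "real \<Rightarrow> real" where "seeley_A z = (\<Sum>k. seeley_gam k * z ^ k)"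

lemma summable_seeley_gam: "summable (\<lambda>k. \<bar>seeley_gam k * z ^ k\<bar>)"
proof (rule summable_comparison_test'[OF summable_seeley_beta[of z], of 0])
  fix k :: nat
  have "(1::real) \<le> 2 ^ k + 1" "(2::real) ^ k + 1 > 0" by (auto intro: add_pos_pos)
  then have "\<bar>seeley_beta k\<bar> / (2 ^ k + 1) \<le> \<bar>seeley_beta k\<bar> / 1" by (intro divide_left_mono) auto
  then have "\<bar>seeley_gam k\<bar> \<le> \<bar>seeley_beta k\<bar>" by (simp add: seeley_gam_def)
  then show "norm \<bar>seeley_gam k * z ^ k\<bar> \<le> \<bar>seeley_beta k * z ^ k\<bar>"
    by (simp add: abs_mult mult_right_mono)
qed

lemma seeley_A_power: "seeley_A (2 ^ i) = (-1) ^ i * seeley_A 1"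
proof (induction i)
  case (Suc i)
  have s: "summable (\<lambda>k. seeley_gam k * z ^ k)" for z
    using summable_seeley_gam by (rule summable_rabs_cancel)
  have "seeley_A (2 * z) + seeley_A z = seeley_B z" for z
  proof -
    have "seeley_A (2 * z) + seeley_A z = (\<Sum>k. seeley_gam k * (2 * z) ^ k + seeley_gam k * z ^ k)"
      unfolding seeley_A_def by (rule suminf_add[OF s s])
    also have "(\<lambda>k. seeley_gam k * (2 * z) ^ k + seeley_gam k * z ^ k) = (\<lambda>k. seeley_beta k * z ^ k)"
    proof
      fix k
      have "(2::real) ^ k + 1 > 0" by (simp add: add_pos_pos)
      then have "seeley_gam k * (2 ^ k + 1) = seeley_beta k" by (simp add: seeley_gam_def)
      then show "seeley_gam k * (2 * z) ^ k + seeley_gam k * z ^ k = seeley_beta k * z ^ k"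
        by (simp add: power_mult_distrib algebra_simps flip: \<open>seeley_gam k * (2 ^ k + 1) = seeley_beta k\<close>)
    qed
    finally show ?thesis by (simp add: seeley_B_def)
  qed
  from this[of "2 ^ i"] show ?case using Suc seeley_B_power[of i] by simp
qed simp

text \<open>The first three coefficients 1/2, -2/3, 4/15 add up to 1/10. From index 3 on the
  absolute values start at 8/189 and at least halve each time, so the tail is at most 16/189, which
  is less than 1/10.\<close>

lemma seeley_A1_nonzero: "seeley_A 1 \<noteq> 0"
proof -
  have s: "summable seeley_gam" using summable_rabs_cancel[OF summable_seeley_gam[of 1]] by simp
  have b1: "seeley_beta 1 = -2" unfolding One_nat_def seeley_beta.simps by simp
  have b2: "seeley_beta 2 = 4/3" unfolding numeral_2_eq_2 seeley_beta.simps by simp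
  have b3: "seeley_beta 3 = -8/21" unfolding numeral_3_eq_3 seeley_beta.simps by simp
  have g: "seeley_gam 0 = 1/2" "seeley_gam 1 = -2/3" "seeley_gam 2 = 4/15" "seeley_gam 3 = -8/189"
    by (simp_all add: seeley_gam_def b1[simplified] b2 b3)
  have gs: "\<bar>seeley_gam (Suc n)\<bar> = \<bar>seeley_beta n\<bar> * (2 / (2 * 2 ^ n - 1)) / (2 * 2 ^ n + 1)" for n
    by (simp add: seeley_gam_def abs_divide seeley_beta_ratio)
  have tail: "\<bar>seeley_gam (k + 3)\<bar> \<le> 8/189 * (1/2) ^ k" for k
  proof (induction k)
    case 0
    then show ?case using g by simp
  next
    case (Suc k)
    let ?p = "(2::real) ^ (k + 3)"
    have p: "?p \<ge> 8" using power_increasing[of 3 "k + 3" "2::real"] by simp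
    have "\<bar>seeley_gam (Suc k + 3)\<bar> = \<bar>seeley_beta (k + 3)\<bar> * (2 / (2 * ?p - 1)) / (2 * ?p + 1)"
      using gs[of "k + 3"] by simp
    also have "\<dots> \<le> \<bar>seeley_beta (k + 3)\<bar> * (1 / 2) / (?p + 1)"
    proof (rule frac_le)
      have "2 / (2 * ?p - 1) \<le> 1 / 2" using p by (simp add: field_simps)
      then show "\<bar>seeley_beta (k + 3)\<bar> * (2 / (2 * ?p - 1)) \<le> \<bar>seeley_beta (k + 3)\<bar> * (1 / 2)"
        by (intro mult_left_mono) auto
    qed (use p in auto)
    also have "\<dots> = \<bar>seeley_gam (k + 3)\<bar> * (1/2)" using p by (simp add: seeley_gam_def)
    also have "\<dots> \<le> 8/189 * (1/2) ^ k * (1/2)" using Suc by (intro mult_right_mono) auto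
    finally show ?case by simp
  qed
  have sg: "summable (\<lambda>k. 8/189 * (1/2::real) ^ k)" by (intro summable_mult summable_geometric) simp
  have st: "summable (\<lambda>k. \<bar>seeley_gam (k + 3)\<bar>)"
    by (rule summable_comparison_test'[OF sg, of 0]) (use tail in auto)
  have "\<bar>\<Sum>k. seeley_gam (k + 3)\<bar> \<le> (\<Sum>k. \<bar>seeley_gam (k + 3)\<bar>)" by (rule summable_rabs[OF st])
  also have "\<dots> \<le> (\<Sum>k. 8/189 * (1/2::real) ^ k)" by (rule suminf_le[OF tail st sg])
  also have "\<dots> = 16/189" using suminf_geometric[of "1/2::real"] by (subst suminf_mult) (auto intro: summable_geometric)
  finally have t: "\<bar>\<Sum>k. seeley_gam (k + 3)\<bar> \<le> 16/189" .
  have "seeley_A 1 = (\<Sum>k. seeley_gam (k + 3)) + (\<Sum>k<3. seeley_gam k)"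
    unfolding seeley_A_def using suminf_split_initial_segment[OF s, of 3] by simp
  also have "(\<Sum>k<3. seeley_gam k) = 1/10" using g by (simp add: numeral_3_eq_3 numeral_2_eq_2)
  finally show ?thesis using t by auto
qed

text \<open>Weights of the values of \<open>f\<close> at the reflected heights
  \<open>- (2 ^ k) * t\<close>. The exponent \<open>i\<close> counts the normal derivatives taken,
  each of which brings out a factor \<open>- (2 ^ k)\<close>. That the weights add up to 1 for every
  \<open>i\<close> makes the derivatives of each order match at \<open>t = 0\<close>.\<close>

definition seeley_coeff :: "nat \<Rightarrow> nat \<Rightarrow> real" where
  "seeley_coeff i k = seeley_gam k / seeley_A 1 * (- (2 ^ k)) ^ i"

lemma seeley_coeff_Suc: "seeley_coeff (Suc i) k = seeley_coeff i k * (- (2 ^ k))"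
  by (simp add: seeley_coeff_def)

lemma summable_seeley_coeff: "summable (\<lambda>k. \<bar>seeley_coeff i k\<bar>)"
proof -
  have "\<bar>seeley_coeff i k\<bar> = \<bar>seeley_gam k * (2 ^ i) ^ k\<bar> * (1 / \<bar>seeley_A 1\<bar>)" for k
    by (simp add: seeley_coeff_def abs_mult power_abs power_mult[symmetric] mult.commute)
  then show ?thesis using summable_mult2[OF summable_seeley_gam[of "2 ^ i"]] by presburger
qed

text \<open>Rewriting \<open>(- (2 ^ k)) ^ i\<close> as \<open>(-1) ^ i * (2 ^ i) ^ k\<close> turns
  the sum into \<open>(-1) ^ i * seeley_A (2 ^ i) / seeley_A 1\<close>, where the alternating sign
  of \<open>seeley_A\<close> cancels.\<close>

lemma suminf_seeley_coeff: "(\<Sum>k. seeley_coeff i k) = 1"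
proof -
  have s: "summable (\<lambda>k. seeley_gam k * (2 ^ i) ^ k)"
    using summable_seeley_gam by (rule summable_rabs_cancel)
  have "seeley_coeff i k = seeley_gam k * (2 ^ i) ^ k * ((-1) ^ i / seeley_A 1)" for k
    using power_mult_distrib[of "-1::real" "2 ^ k" i]
    by (simp add: seeley_coeff_def power_mult[symmetric] mult.commute)
  then have "(\<Sum>k. seeley_coeff i k) = (\<Sum>k. seeley_gam k * (2 ^ i) ^ k * ((-1) ^ i / seeley_A 1))" by presburger
  also have "\<dots> = seeley_A (2 ^ i) * ((-1) ^ i / seeley_A 1)"
    unfolding seeley_A_def by (rule suminf_mult2[OF s, symmetric])
  also have "\<dots> = 1" using seeley_A1_nonzero unfolding seeley_A_power
    by (simp add: power_mult_distrib[symmetric])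
  finally show ?thesis .
qed

section \<open>Derivatives along coordinate lines and a cutoff\<close>

lemma continuous_on_upd:
  fixes g :: "'b::topological_space \<Rightarrow> nat \<Rightarrow> real"
  assumes "continuous_on S g" "continuous_on S c"
  shows "continuous_on S (\<lambda>z. (g z)(i := c z))"
proof (rule continuous_on_coordinatewise_then_product)
  fix j show "continuous_on S (\<lambda>x. ((g x)(i := c x)) j)"
    using assms continuous_on_product_then_coordinatewise[OF assms(1)] by (cases "j = i") auto
qed

lemma has_pd_line:
  assumes "has_pd i f d (z(i := z i + c * t))"
  shows "((\<lambda>s. f (z(i := z i + c * s))) has_real_derivative d * c) (at t)"
proof -
  have "((\<lambda>s. f (z(i := z i + c * t + s))) has_real_derivative d) (at 0)"
    using assms by (simp add: has_pd_def)
  then have 1: "((\<lambda>s. f (z(i := z i + s))) has_real_derivative d) (at (c * t))"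
    using DERIV_shift[of "\<lambda>s. f (z(i := z i + s))" d 0 "c * t"] by (simp add: add_ac)
  have 2: "((\<lambda>s. c * s) has_real_derivative c) (at t)" by (auto intro!: derivative_eq_intros)
  show ?thesis
    using DERIV_chain2[where f="\<lambda>s. f (z(i := z i + s))" and g="\<lambda>s. c * s" and x=t, OF 1 2] .
qed

text \<open>By the mean value theorem the difference quotient at \<open>t\<close> is a value of
  \<psi> strictly between 0 and \<open>t\<close>. At the boundary of the half space a continuous
  candidate for the derivative is therefore enough.\<close>

lemma deriv_from_limit:
  fixes \<phi> :: "real \<Rightarrow> real"
  assumes e: "e > 0" and c: "continuous_on {-e<..<e} \<phi>"
    and d: "\<And>t. t \<noteq> 0 \<Longrightarrow> \<bar>t\<bar> < e \<Longrightarrow> (\<phi> has_real_derivative \<psi> t) (at t)"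
    and l: "(\<psi> \<longlongrightarrow> L) (at 0)"
  shows "(\<phi> has_real_derivative L) (at 0)"
  unfolding DERIV_def
proof (rule tendstoI)
  fix r :: real assume "r > 0"
  then have "\<forall>\<^sub>F t in at 0. dist (\<psi> t) L < r" using l by (simp add: tendstoD)
  then obtain s where s: "s > 0" "\<And>t. t \<noteq> 0 \<Longrightarrow> \<bar>t\<bar> < s \<Longrightarrow> dist (\<psi> t) L < r"
    unfolding eventually_at by (auto simp: dist_real_def)
  have dd: "\<phi> differentiable (at t)" if "t \<noteq> 0" "\<bar>t\<bar> < e" for t
    using d[OF that] real_differentiable_def by blast
  have key: "\<exists>z. z \<noteq> 0 \<and> \<bar>z\<bar> < \<bar>t\<bar> \<and> (\<phi> t - \<phi> 0) / t = \<psi> z" if t: "t \<noteq> 0" "\<bar>t\<bar> < e" for t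
  proof (cases "t > 0")
    case True
    have "\<exists>l z. 0 < z \<and> z < t \<and> (\<phi> has_real_derivative l) (at z) \<and> \<phi> t - \<phi> 0 = (t - 0) * l"
      by (rule MVT) (use True t in \<open>auto intro!: continuous_on_subset[OF c] dd\<close>)
    then obtain l z where z: "0 < z" "z < t" "(\<phi> has_real_derivative l) (at z)" "\<phi> t - \<phi> 0 = t * l" by auto
    then have "l = \<psi> z" using d[of z] t by (intro DERIV_unique[OF z(3)]) auto
    then show ?thesis using z t by (intro exI[of _ z]) (auto simp: field_simps)
  next
    case False
    have "\<exists>l z. t < z \<and> z < 0 \<and> (\<phi> has_real_derivative l) (at z) \<and> \<phi> 0 - \<phi> t = (0 - t) * l"
      by (rule MVT) (use False t in \<open>auto intro!: continuous_on_subset[OF c] dd\<close>)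
    then obtain l z where z: "t < z" "z < 0" "(\<phi> has_real_derivative l) (at z)" "\<phi> 0 - \<phi> t = - t * l" by auto
    then have "l = \<psi> z" using d[of z] t by (intro DERIV_unique[OF z(3)]) auto
    then show ?thesis using z t False by (intro exI[of _ z]) (auto simp: field_simps)
  qed
  have "dist ((\<phi> (0 + t) - \<phi> 0) / t) L < r" if "t \<noteq> 0" "dist t 0 < min e s" for t
    using key[of t] that s(2) by (auto simp: dist_real_def)
  then show "\<forall>\<^sub>F t in at 0. dist ((\<phi> (0 + t) - \<phi> 0) / t) L < r"
    unfolding eventually_at using e s(1) by (intro exI[of _ "min e s"]) auto
qed

definition cutoff :: "real \<Rightarrow> real" where
  "cutoff s = ell (1/2 - s) * inverse (ell (1/2 - s) + ell (s - 1/4))"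

lemma cutoff_denom: "ell (1/2 - s) + ell (s - 1/4) > 0"
  by (cases "s < 1/2") (auto intro: add_pos_nonneg add_nonneg_pos)

lemma cutoff_0: "s \<ge> 1/2 \<Longrightarrow> cutoff s = 0"
  by (simp add: cutoff_def)

lemma cutoff_1: "s \<le> 1/4 \<Longrightarrow> cutoff s = 1"
proof -
  assume s: "s \<le> 1/4"
  then have "ell (s - 1/4) = 0" "ell (1/2 - s) \<noteq> 0" by (auto simp del: ell_eq_0_iff simp: ell_def)
  then show ?thesis by (simp add: cutoff_def del: ell_eq_0_iff)
qed

lemma smooth_cutoff:
  assumes U: "open_euc n U" and c: "smooth_fun n U c"
  shows "smooth_fun n U (\<lambda>x. cutoff (c x))"
proof -
  have e: "smooth_fun n U (\<lambda>x. ell (1/2 - c x))" "smooth_fun n U (\<lambda>x. ell (c x - 1/4))"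
    using smooth_compose1[OF U smooth_diff[OF U smooth_const[OF U] c] smooth1_ell]
      smooth_compose1[OF U smooth_diff[OF U c smooth_const[OF U]] smooth1_ell] by auto
  have "smooth_fun n U (\<lambda>x. inverse (ell (1/2 - c x) + ell (c x - 1/4)))"
    by (rule smooth_compose1[OF U smooth_add[OF U e] smooth1_inverse]) (use cutoff_denom in auto)
  then show ?thesis unfolding cutoff_def by (rule smooth_mult[OF U e(1)])
qed

section \<open>Extension from a half space\<close>

text \<open>Points of \<open>Y \<times> \<real>\<close> are functions whose coordinate \<open>N\<close> is the real variable; the half space is
  the part where it is nonnegative.\<close>

locale half_space =
  fixes N :: nat and Y :: "(nat \<Rightarrow> real) set"
  assumes Y: "open_euc N Y"
begin

text \<open>The product of \<open>Y\<close> with the whole line rather than a half line, so that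
  squaring, negating, averaging and reflecting the last coordinate all stay inside.\<close>

definition cyl :: "(nat \<Rightarrow> real) set" where
  "cyl = {x \<in> euc (Suc N). x(N := 0) \<in> Y}"

lemma cyl_upd: "x \<in> cyl \<Longrightarrow> x(N := c) \<in> cyl"
  by (simp add: cyl_def)

lemma cyl_euc: "x \<in> cyl \<Longrightarrow> x \<in> euc (Suc N)"
  by (simp add: cyl_def)

lemma open_cyl: "open_euc (Suc N) cyl"
  unfolding open_euc_def
proof (intro conjI ballI)
  fix x assume x: "x \<in> cyl"
  then obtain e where e: "e > 0" "\<forall>y\<in>euc N. edist N (x(N := 0)) y < e \<longrightarrow> y \<in> Y"
    using Y by (auto simp: cyl_def open_euc_def)
  have "y \<in> cyl" if y: "y \<in> euc (Suc N)" "edist (Suc N) x y < e" for y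
  proof -
    have "edist N (x(N := 0)) (y(N := 0)) \<le> edist (Suc N) x y"
      unfolding edist_def by (auto intro!: sum_mono2)
    moreover have "y(N := 0) \<in> euc N" using y by (auto simp: euc_def)
    ultimately show ?thesis using e y by (auto simp: cyl_def)
  qed
  then show "\<exists>e>0. \<forall>y\<in>euc (Suc N). edist (Suc N) x y < e \<longrightarrow> y \<in> cyl" using e(1) by blast
qed (auto simp: cyl_def)

lemma continuous_on_coord: "continuous_on S (\<lambda>x. (x::nat \<Rightarrow> real) i)"
  by (rule continuous_on_subset[OF continuous_on_product_coordinates]) simp

lemma open_cyl_sub: "open B \<Longrightarrow> open_euc (Suc N) {x\<in>cyl. x N \<in> B}"
  by (rule open_euc_vimage[OF open_cyl continuous_on_coord])

lemma open_cyl_pos: "open_euc (Suc N) {x\<in>cyl. x N > c}"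
  using open_cyl_sub[OF open_greaterThan, of c] by simp

lemma open_cyl_less: "open_euc (Suc N) {x\<in>cyl. x N < c}"
  using open_cyl_sub[OF open_lessThan, of c] by simp

text \<open>Smoothness up to the boundary of a function on the half space, tested on the plot \<open>t \<mapsto> t\<^sup>2\<close>.\<close>

definition half :: "((nat \<Rightarrow> real) \<Rightarrow> real) \<Rightarrow> bool" where
  "half f \<longleftrightarrow> smooth_fun (Suc N) cyl (\<lambda>x. f (x(N := (x N)\<^sup>2)))"

text \<open>Makes the reflection series finite, uniformly below any negative height, and lets a
  bound on a compact range of heights serve for entire vertical half lines.\<close>

definition small :: "((nat \<Rightarrow> real) \<Rightarrow> real) \<Rightarrow> bool" where
  "small f \<longleftrightarrow> (\<forall>x\<in>cyl. x N > 1/2 \<longrightarrow> f x = 0)"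

lemma half_continuous: 
  assumes "half f"
  shows "continuous_on {x\<in>cyl. x N \<ge> 0} f"
proof -
  define g where "g = (\<lambda>x. f (x(N := (x N)\<^sup>2)))"
  have g: "continuous_on cyl g"
    using assms smooth_continuous[OF open_cyl] unfolding half_def g_def by blast
  have c: "continuous_on {x\<in>cyl. x N \<ge> 0} (\<lambda>x. x(N := sqrt (x N)))"
    by (intro continuous_on_upd continuous_on_id continuous_intros continuous_on_coord)
  have "continuous_on {x\<in>cyl. x N \<ge> 0} (\<lambda>x. g (x(N := sqrt (x N))))"
    by (rule continuous_on_compose2[OF g c]) (auto intro: cyl_upd)
  then show ?thesis by (rule continuous_on_eq) (simp add: g_def)
qed

lemma smooth_map_upd_cyl:
  assumes "smooth_fun (Suc N) U c" "open_euc (Suc N) U"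
  shows "smooth_map (Suc N) U (Suc N) (\<lambda>x. x(N := c x))"
  by (rule smooth_map_upd[OF assms(2) smooth_map_id[OF assms(2)] assms(1)]) simp

text \<open>The square root, written as a power with exponent 1/2, is smooth at positive heights and
  undoes the squaring in \<open>half\<close>.\<close>

lemma half_smooth_pos:
  assumes "half f"
  shows "smooth_fun (Suc N) {x\<in>cyl. x N > 0} f"
proof -
  let ?U = "{x\<in>cyl. x N > 0}"
  define g where "g = (\<lambda>x. f (x(N := (x N)\<^sup>2)))"
  have g: "smooth_fun (Suc N) cyl g" using assms by (simp add: half_def g_def)
  have "smooth_fun (Suc N) ?U (\<lambda>x. x N powr (1/2))"
    by (rule smooth_compose1[OF open_cyl_pos smooth_coord[OF open_cyl_pos] smooth1_powr]) auto
  then have m: "smooth_map (Suc N) ?U (Suc N) (\<lambda>x. x(N := x N powr (1/2)))"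
    by (rule smooth_map_upd_cyl[OF _ open_cyl_pos])
  have "smooth_fun (Suc N) ?U (\<lambda>x. g (x(N := x N powr (1/2))))"
    by (rule smooth_compose[OF open_cyl open_cyl_pos m _ g]) (auto intro: cyl_upd)
  then show ?thesis
    by (rule smooth_cong[OF open_cyl_pos, rotated]) (simp add: g_def powr_half_sqrt)
qed

section \<open>Whitney's theorem on even functions\<close>

lemma cyl_line:
  assumes "x \<in> cyl" "i < Suc N"
  obtains e where "e > 0" "\<forall>t. \<bar>t\<bar> < e \<longrightarrow> x(i := x i + t) \<in> cyl"
  using eventually_line[OF open_cyl assms] unfolding eventually_nhds_metric
  by (auto simp: dist_real_def)

text \<open>Differentiation under the integral sign. A normal derivative brings out a factor
  \<theta> by the chain rule and raises the exponent \<open>m\<close>, a tangential one leaves it;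
  admitting all exponents lets the induction on \<open>r\<close> close.\<close>

lemma Ck_average:
  assumes "smooth_fun (Suc N) cyl k"
  shows "Ck r (Suc N) cyl (\<lambda>x. integral {0..1} (\<lambda>\<theta>. \<theta> ^ m * k (x(N := \<theta> * x N))))"
  using assms
proof (induction r arbitrary: k m)
  case 0
  have k: "continuous_on cyl k" by (rule smooth_continuous[OF open_cyl 0])
  have "continuous_on (cyl \<times> cbox 0 1) (\<lambda>p. (fst p)(N := snd p * fst p N))"
    by (intro continuous_on_upd continuous_intros
        continuous_on_compose2[OF continuous_on_coord[of UNIV N] continuous_on_fst[OF continuous_on_id]]) auto
  then have "continuous_on (cyl \<times> cbox 0 1) (\<lambda>p. k ((fst p)(N := snd p * fst p N)))"
    by (rule continuous_on_compose2[OF k]) (auto intro: cyl_upd)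
  then have "continuous_on (cyl \<times> cbox 0 (1::real)) (\<lambda>(x, \<theta>). \<theta> ^ m * k (x(N := \<theta> * x N)))"
    unfolding case_prod_beta by (intro continuous_intros)
  from integral_continuous_on_param[OF this] show ?case unfolding Ck.simps by (simp only: cbox_interval)
next
  case (Suc r)
  have k: "continuous_on cyl k" by (rule smooth_continuous[OF open_cyl Suc.prems])
  obtain k' where k': "\<forall>i<Suc N. \<forall>x\<in>cyl. has_pd i k (k' i x) x" "\<forall>i<Suc N. smooth_fun (Suc N) cyl (k' i)"
    using smooth_partials[OF Suc.prems] .
  define m' where "m' = (\<lambda>i. if i = N then Suc m else m)"
  show ?case
  proof (rule Ck_SucI[where g="\<lambda>i x. integral {0..1} (\<lambda>\<theta>. \<theta> ^ m' i * k' i (x(N := \<theta> * x N)))"])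
    fix i x assume i: "i < Suc N" and x: "x \<in> cyl"
    obtain e where e: "e > 0" "\<forall>t. \<bar>t\<bar> < e \<longrightarrow> x(i := x i + t) \<in> cyl" using cyl_line[OF x i] .
    let ?S = "{-e<..<e}"
    define w where "w = (\<lambda>t \<theta>. (x(i := x i + t))(N := \<theta> * (x(i := x i + t)) N))"
    have w: "w t \<theta> \<in> cyl" if "t \<in> ?S" for t \<theta>
      unfolding w_def using e that by (intro cyl_upd e(2)[rule_format]) auto
    have cw: "continuous_on (?S \<times> cbox 0 1) (\<lambda>p. w (fst p) (snd p))"
    proof -
      have 1: "continuous_on (?S \<times> cbox 0 (1::real)) (\<lambda>p. x(i := x i + fst p))"
        by (intro continuous_on_upd continuous_intros)
      show ?thesis unfolding w_def
        by (intro continuous_on_upd 1 continuous_on_mult continuous_intros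
            continuous_on_product_then_coordinatewise[OF 1])
    qed
    have ci: "continuous_on cyl (k' i)" using k'(2) i smooth_continuous[OF open_cyl] by blast
    have "((\<lambda>t. integral (cbox 0 1) (\<lambda>\<theta>. \<theta> ^ m * k (w t \<theta>))) has_field_derivative
        integral (cbox 0 1) (\<lambda>\<theta>. \<theta> ^ m' i * k' i (w 0 \<theta>))) (at 0 within ?S)"
    proof (rule leibniz_rule_field_derivative[where fx="\<lambda>t \<theta>. \<theta> ^ m' i * k' i (w t \<theta>)"])
      fix t \<theta> :: real assume t: "t \<in> ?S" and \<theta>: "\<theta> \<in> cbox 0 1"
      define z where "z = w 0 \<theta>"
      define c where "c = (if i = N then \<theta> else 1)"
      have wz: "w s \<theta> = z(i := z i + c * s)" for s
        by (auto simp: w_def z_def c_def fun_eq_iff algebra_simps)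
      have "has_pd i k (k' i (z(i := z i + c * t))) (z(i := z i + c * t))"
        using k'(1) i w[OF t, of \<theta>] unfolding wz by blast
      from has_pd_line[OF this]
      have "((\<lambda>s. k (w s \<theta>)) has_real_derivative k' i (w t \<theta>) * c) (at t)" by (simp only: wz)
      then have "((\<lambda>s. \<theta> ^ m * k (w s \<theta>)) has_real_derivative \<theta> ^ m * (k' i (w t \<theta>) * c)) (at t)"
        by (rule DERIV_cmult)
      moreover have "\<theta> ^ m * (k' i (w t \<theta>) * c) = \<theta> ^ m' i * k' i (w t \<theta>)"
        by (simp add: m'_def c_def)
      ultimately show "((\<lambda>t. \<theta> ^ m * k (w t \<theta>)) has_field_derivative \<theta> ^ m' i * k' i (w t \<theta>)) (at t within ?S)"
        by (simp add: has_field_derivative_at_within)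
    next
      fix t assume t: "t \<in> ?S"
      have "continuous_on (cbox 0 1) (w t)"
        using continuous_on_compose2[OF cw continuous_on_Pair[OF continuous_on_const[of _ t] continuous_on_id], of "cbox 0 1"] t
        by (auto simp: image_subset_iff)
      then have "continuous_on (cbox 0 1) (\<lambda>\<theta>. k (w t \<theta>))"
        by (rule continuous_on_compose2[OF k]) (use w[OF t] in auto)
      then show "(\<lambda>\<theta>. \<theta> ^ m * k (w t \<theta>)) integrable_on cbox 0 1"
        by (intro integrable_continuous continuous_intros)
    next
      have "continuous_on (?S \<times> cbox 0 1) (\<lambda>p. k' i (w (fst p) (snd p)))"
        by (rule continuous_on_compose2[OF ci cw]) (use w in auto)
      then show "continuous_on (?S \<times> cbox 0 1) (\<lambda>(t, \<theta>). \<theta> ^ m' i * k' i (w t \<theta>))"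
        unfolding case_prod_beta by (intro continuous_intros)
    qed (use e in auto)
    then have "((\<lambda>t. integral {0..1} (\<lambda>\<theta>. \<theta> ^ m * k (w t \<theta>))) has_real_derivative
        integral {0..1} (\<lambda>\<theta>. \<theta> ^ m' i * k' i (w 0 \<theta>))) (at 0)"
      using e at_within_open[of 0 ?S] by simp
    then show "has_pd i (\<lambda>x. integral {0..1} (\<lambda>\<theta>. \<theta> ^ m * k (x(N := \<theta> * x N))))
        (integral {0..1} (\<lambda>\<theta>. \<theta> ^ m' i * k' i (x(N := \<theta> * x N)))) x"
      unfolding has_pd_def w_def by simp
  next
    show "continuous_on cyl (\<lambda>x. integral {0..1} (\<lambda>\<theta>. \<theta> ^ m * k (x(N := \<theta> * x N))))"
      using Ck_continuous[OF Suc.IH[OF Suc.prems]] .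
    show "Ck r (Suc N) cyl (\<lambda>x. integral {0..1} (\<lambda>\<theta>. \<theta> ^ m' i * k' i (x(N := \<theta> * x N))))" if "i < Suc N" for i
      using Suc.IH k'(2) that by blast
  qed
qed

lemma half_even_extend:
  assumes g: "smooth_fun (Suc N) cyl g" and even: "\<And>x. x \<in> cyl \<Longrightarrow> g (x(N := - x N)) = g x"
  shows "half (\<lambda>x. g (x(N := sqrt (x N))))"
  unfolding half_def
proof (rule smooth_cong[OF open_cyl _ g])
  fix x assume x: "x \<in> cyl"
  have "g (x(N := \<bar>x N\<bar>)) = g x" using even[OF x] by (cases "x N \<ge> 0") auto
  then show "g x = g (x(N := (x N)\<^sup>2, N := sqrt ((x(N := (x N)\<^sup>2)) N)))" by simp
qed

text \<open>Tangential derivatives of an even function are even.\<close>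

lemma half_partial:
  assumes "half f" and i: "i < N"
  obtains f' where "half f'" "\<And>x. x \<in> cyl \<Longrightarrow> x N \<ge> 0 \<Longrightarrow> has_pd i f (f' x) x"
proof -
  define g where "g = (\<lambda>x. f (x(N := (x N)\<^sup>2)))"
  have g: "smooth_fun (Suc N) cyl g" using assms by (simp add: half_def g_def)
  obtain h where h: "\<forall>i<Suc N. \<forall>x\<in>cyl. has_pd i g (h i x) x" "\<forall>i<Suc N. smooth_fun (Suc N) cyl (h i)"
    using smooth_partials[OF g] .
  have comm: "x(N := c, i := (x(N := c)) i + t) = (x(i := x i + t))(N := c)" for x :: "nat \<Rightarrow> real" and c t
    using i by (auto simp: fun_eq_iff)
  have "h i (x(N := - x N)) = h i x" if x: "x \<in> cyl" for x
  proof (rule has_pd_unique)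
    have "has_pd i g (h i (x(N := - x N))) (x(N := - x N))" using h i cyl_upd[OF x] by auto
    then show "has_pd i g (h i (x(N := - x N))) x"
      using i unfolding has_pd_def comm by (simp add: g_def)
    show "has_pd i g (h i x) x" using h i x by auto
  qed
  then have 1: "half (\<lambda>x. h i (x(N := sqrt (x N))))"
    by (rule half_even_extend[rotated]) (use h i in auto)
  have 2: "has_pd i f (h i (x(N := sqrt (x N)))) x" if x: "x \<in> cyl" "x N \<ge> 0" for x
  proof -
    have "has_pd i g (h i (x(N := sqrt (x N)))) (x(N := sqrt (x N)))" using h i cyl_upd[OF x(1)] by auto
    moreover have "(x(i := c))(N := x N) = x(i := c)" for c using i by (auto simp: fun_eq_iff)
    ultimately show ?thesis using i x(2) unfolding has_pd_def comm by (simp add: g_def)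
  qed
  show ?thesis using 1 2 by (rule that)
qed

text \<open>Whitney: for \<open>g t = f (t\<^sup>2)\<close> one has \<open>f' (t\<^sup>2) = g' t / (2 t)\<close>, an average of the second
  derivative of \<open>g\<close>.\<close>

lemma half_normal_derivative:
  assumes "half f"
  obtains f' where "half f'" "\<And>x. x \<in> cyl \<Longrightarrow> x N > 0 \<Longrightarrow> has_pd N f (f' x) x"
proof -
  define g where "g = (\<lambda>x. f (x(N := (x N)\<^sup>2)))"
  have g: "smooth_fun (Suc N) cyl g" using assms by (simp add: half_def g_def)
  obtain h0 where h0: "\<forall>i<Suc N. \<forall>x\<in>cyl. has_pd i g (h0 i x) x" "\<forall>i<Suc N. smooth_fun (Suc N) cyl (h0 i)"
    using smooth_partials[OF g] .
  define h where "h = h0 N"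
  have h: "\<And>x. x \<in> cyl \<Longrightarrow> has_pd N g (h x) x" "smooth_fun (Suc N) cyl h" using h0 by (auto simp: h_def)
  obtain k0 where k0: "\<forall>i<Suc N. \<forall>x\<in>cyl. has_pd i h (k0 i x) x" "\<forall>i<Suc N. smooth_fun (Suc N) cyl (k0 i)"
    using smooth_partials[OF h(2)] .
  define k where "k = k0 N"
  have k: "\<And>x. x \<in> cyl \<Longrightarrow> has_pd N h (k x) x" "smooth_fun (Suc N) cyl k" using k0 by (auto simp: k_def)
  have line: "((\<lambda>s. g (x(N := s))) has_real_derivative h (x(N := t))) (at t)"
    "((\<lambda>s. h (x(N := s))) has_real_derivative k (x(N := t))) (at t)" if "x \<in> cyl" for x t
  proof -
    let ?z = "x(N := 0)"
    have 1: "has_pd N g (h (x(N := t))) (?z(N := ?z N + 1 * t))" "has_pd N h (k (x(N := t))) (?z(N := ?z N + 1 * t))"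
      using h(1)[OF cyl_upd[OF that], of t] k(1)[OF cyl_upd[OF that], of t] by simp_all
    show "((\<lambda>s. g (x(N := s))) has_real_derivative h (x(N := t))) (at t)"
      "((\<lambda>s. h (x(N := s))) has_real_derivative k (x(N := t))) (at t)"
      using has_pd_line[OF 1(1)] has_pd_line[OF 1(2)] by simp_all
  qed
  \<comment> \<open>\<open>g\<close> depends on the last coordinate only through its square, so it
    is even there and its normal derivative \<open>h\<close> is odd; in particular \<open>h\<close>
    vanishes at height 0.\<close>
  have odd: "h (x(N := - t)) = - h (x(N := t))" if "x \<in> cyl" for x t
  proof -
    have neg: "((\<lambda>s::real. - s) has_real_derivative - 1) (at t)" by (auto intro!: derivative_eq_intros)
    have "((\<lambda>s. g (x(N := - s))) has_real_derivative h (x(N := - t)) * (- 1)) (at t)"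
      using DERIV_chain2[where f="\<lambda>s. g (x(N := s))" and g="\<lambda>s. - s" and x=t, OF line(1)[OF that] neg] .
    moreover have "(\<lambda>s. g (x(N := - s))) = (\<lambda>s. g (x(N := s)))" by (simp add: g_def)
    ultimately show ?thesis using DERIV_unique line(1)[OF that, of t] by fastforce
  qed
  \<comment> \<open>As \<open>h\<close> vanishes at height 0, integrating its normal derivative
    \<open>k\<close> gives \<open>h = t * q\<close> with \<open>q\<close> the average of
    \<open>k\<close> over the vertical segment down to height 0. This divides \<open>h\<close> by
    \<open>t\<close> without loss of smoothness.\<close>
  define q where "q = (\<lambda>x. integral {0..1} (\<lambda>\<theta>. k (x(N := \<theta> * x N))))"
  have q: "smooth_fun (Suc N) cyl q"
    using Ck_average[OF k(2), of _ 0] by (simp add: smooth_fun_iff_Ck[OF open_cyl] q_def)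
  have tq: "x N * q x = h x" if x: "x \<in> cyl" for x
  proof -
    have "((\<lambda>\<theta>. k (x(N := \<theta> * x N)) * x N) has_integral h (x(N := 1 * x N)) - h (x(N := 0 * x N))) {0..1}"
    proof (rule fundamental_theorem_of_calculus)
      fix \<theta> :: real
      have lin: "((\<lambda>s. s * x N) has_real_derivative x N) (at \<theta>)" by (auto intro!: derivative_eq_intros)
      have "((\<lambda>s. h (x(N := s * x N))) has_real_derivative k (x(N := \<theta> * x N)) * x N) (at \<theta>)"
        using DERIV_chain2[where f="\<lambda>s. h (x(N := s))" and g="\<lambda>s. s * x N" and x=\<theta>, OF line(2)[OF x] lin] .
      then show "((\<lambda>s. h (x(N := s * x N))) has_vector_derivative k (x(N := \<theta> * x N)) * x N) (at \<theta> within {0..1})"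
        by (simp add: has_real_derivative_iff_has_vector_derivative has_vector_derivative_at_within)
    qed simp
    moreover have "h (x(N := 0)) = 0" using odd[OF x, of 0] by simp
    ultimately have I: "((\<lambda>\<theta>. k (x(N := \<theta> * x N)) * x N) has_integral h x) {0..1}" by simp
    show ?thesis using integral_unique[OF I] by (simp add: q_def mult.commute)
  qed
  have "((\<lambda>s. - h (x(N := s))) has_real_derivative k (x(N := - t)) * (- 1)) (at t)" if "x \<in> cyl" for x t
  proof -
    have neg: "((\<lambda>s::real. - s) has_real_derivative - 1) (at t)" by (auto intro!: derivative_eq_intros)
    show ?thesis unfolding odd[OF that, symmetric]
      using DERIV_chain2[where f="\<lambda>s. h (x(N := s))" and g="\<lambda>s. - s" and x=t, OF line(2)[OF that] neg] .
  qed
  then have keven: "k (x(N := - t)) = k (x(N := t))" if "x \<in> cyl" for x t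
    using DERIV_unique[OF _ DERIV_minus[OF line(2)[OF that, of t]]] that by fastforce
  have "q (x(N := - x N)) = q x" if "x \<in> cyl" for x
    using keven[OF that] by (simp add: q_def)
  then have "half (\<lambda>x. q (x(N := sqrt (x N))))" by (rule half_even_extend[OF q])
  then have 1: "half (\<lambda>x. 1/2 * q (x(N := sqrt (x N))))"
    unfolding half_def by (rule smooth_mult[OF open_cyl smooth_const[OF open_cyl]])
  \<comment> \<open>From \<open>f s = g (sqrt s)\<close> along the vertical line, the derivative is
    \<open>h (sqrt s) / (2 * sqrt s)\<close>, which is half of \<open>q (sqrt s)\<close>.\<close>
  have 2: "has_pd N f (1/2 * q (x(N := sqrt (x N)))) x" if x: "x \<in> cyl" "x N > 0" for x
  proof -
    let ?s = "sqrt (x N)"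
    have s: "?s > 0" using x by simp
    have r: "(sqrt has_real_derivative inverse ?s / 2) (at (x N))" using DERIV_real_sqrt[OF x(2)] .
    have "((\<lambda>s. g (x(N := sqrt s))) has_real_derivative h (x(N := ?s)) * (inverse ?s / 2)) (at (x N))"
      using DERIV_chain2[where f="\<lambda>s. g (x(N := s))" and g=sqrt and x="x N", OF line(1)[OF x(1)] r] .
    moreover have "h (x(N := ?s)) = ?s * q (x(N := ?s))" using tq[OF cyl_upd[OF x(1)], of ?s] by simp
    ultimately have "((\<lambda>s. g (x(N := sqrt s))) has_real_derivative 1/2 * q (x(N := ?s))) (at (x N))"
      using s by (simp add: field_simps)
    then have "((\<lambda>s. f (x(N := s))) has_real_derivative 1/2 * q (x(N := ?s))) (at (x N))"
      by (rule has_field_derivative_transform_within_open[of _ _ _ "{0<..}"]) (use x in \<open>auto simp: g_def\<close>)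
    then show ?thesis unfolding has_pd_def
      using DERIV_shift[of "\<lambda>s. f (x(N := s))" _ 0 "x N"] by (simp add: add.commute)
  qed
  show ?thesis using 1 2 by (rule that)
qed

lemma small_derivative:
  assumes "small f" "i < Suc N" and pd: "\<And>x. x \<in> cyl \<Longrightarrow> x N > 0 \<Longrightarrow> has_pd i f (f' x) x"
  shows "small f'"
  unfolding small_def
proof (intro ballI impI)
  fix x assume x: "x \<in> cyl" "1/2 < x N"
  have "has_pd i (\<lambda>_. 0) (f' x) x"
    by (rule has_pd_cong[OF open_cyl_pos[of "1/2"] _ assms(2) _ pd])
      (use x assms(1) in \<open>auto simp: small_def\<close>)
  moreover have "has_pd i (\<lambda>_. 0) 0 x" by (simp add: has_pd_def)
  ultimately show "f' x = 0" by (rule has_pd_unique)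
qed

text \<open>The two directions differ at the boundary: a tangential line through a boundary point
  stays in the half space, but a normal line leaves it and \<open>has_pd\<close> is two-sided. So
  normal derivatives are claimed at positive height only.\<close>

lemma half_partials:
  assumes "half f" "small f"
  shows "\<exists>F. \<forall>i<Suc N. half (F i) \<and> small (F i) \<and>
    (\<forall>x\<in>cyl. (if i = N then x N > 0 else x N \<ge> 0) \<longrightarrow> has_pd i f (F i x) x)"
proof -
  have "\<forall>i. \<exists>f'. i < Suc N \<longrightarrow> half f' \<and> small f' \<and>
    (\<forall>x\<in>cyl. (if i = N then x N > 0 else x N \<ge> 0) \<longrightarrow> has_pd i f (f' x) x)"
  proof
    fix i
    consider "i < N" | "i = N" | "i > N" by linarith
    then show "\<exists>f'. i < Suc N \<longrightarrow> half f' \<and> small f' \<and>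
      (\<forall>x\<in>cyl. (if i = N then x N > 0 else x N \<ge> 0) \<longrightarrow> has_pd i f (f' x) x)"
    proof cases
      case 1
      obtain f' where "half f'" "\<And>x. x \<in> cyl \<Longrightarrow> x N \<ge> 0 \<Longrightarrow> has_pd i f (f' x) x"
        using half_partial[OF assms(1) 1] by metis
      moreover from this have "small f'" using 1 by (intro small_derivative[OF assms(2), of i]) auto
      ultimately show ?thesis using 1 by auto
    next
      case 2
      obtain f' where "half f'" "\<And>x. x \<in> cyl \<Longrightarrow> x N > 0 \<Longrightarrow> has_pd N f (f' x) x"
        using half_normal_derivative[OF assms(1)] by metis
      moreover from this have "small f'" by (intro small_derivative[OF assms(2), of N]) auto
      ultimately show ?thesis using 2 by auto
    qed simp
  qed
  then show ?thesis by metis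
qed

section \<open>Seeley's reflection\<close>

definition seeley :: "nat \<Rightarrow> ((nat \<Rightarrow> real) \<Rightarrow> real) \<Rightarrow> (nat \<Rightarrow> real) \<Rightarrow> real" where
  "seeley i f x = (if x N \<ge> 0 then f x else (\<Sum>k. seeley_coeff i k * f (x(N := - (2 ^ k) * x N))))"

text \<open>The two branches agree at height 0, since all reflected points coincide there and the
  weights add up to 1.\<close>

lemma seeley_nonpos:
  assumes "x N \<le> 0"
  shows "seeley i f x = (\<Sum>k. seeley_coeff i k * f (x(N := - (2 ^ k) * x N)))"
proof (cases "x N = 0")
  case True
  have upd: "x(N := 0) = x" using True by auto
  have "(\<Sum>k. seeley_coeff i k * f x) = (\<Sum>k. seeley_coeff i k) * f x"
    using suminf_mult2[OF summable_rabs_cancel[OF summable_seeley_coeff]] by simp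
  then show ?thesis using True by (simp add: seeley_def suminf_seeley_coeff upd)
qed (use assms in \<open>simp add: seeley_def\<close>)

text \<open>All terms with \<open>2 ^ k > 1 / (2 * - c)\<close> evaluate \<open>f\<close> above
  height 1/2, where it is zero. The bound \<open>K\<close> serves every \<open>i\<close>,
  \<open>f\<close> and \<open>x\<close>, so a series and the series of its derivatives are cut at
  the same place.\<close>

lemma seeley_finite:
  assumes "c < 0"
  obtains K where "\<forall>i f x. small f \<longrightarrow> x \<in> cyl \<longrightarrow> x N < c \<longrightarrow>
    seeley i f x = (\<Sum>k<K. seeley_coeff i k * f (x(N := - (2 ^ k) * x N)))"
proof -
  obtain K where K: "1 / (2 * - c) < 2 ^ K" using real_arch_pow[of 2] by auto
  have "seeley i f x = (\<Sum>k<K. seeley_coeff i k * f (x(N := - (2 ^ k) * x N)))"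
    if f: "small f" and x: "x \<in> cyl" "x N < c" for i f x
  proof -
    have "f (x(N := - (2 ^ k) * x N)) = 0" if k: "k \<notin> {..<K}" for k
    proof -
      have "(2::real) ^ K \<le> 2 ^ k" using k by (intro power_increasing) auto
      then have "1 / (2 * - c) < 2 ^ k" using K by linarith
      then have "1 / 2 < 2 ^ k * - c" using assms by (simp add: field_simps)
      also have "\<dots> \<le> 2 ^ k * - x N" using x by (intro mult_left_mono) auto
      finally have "1 / 2 < - (2 ^ k) * x N" by simp
      then show ?thesis using f cyl_upd[OF x(1)] unfolding small_def by auto
    qed
    then have "(\<Sum>k. seeley_coeff i k * f (x(N := - (2 ^ k) * x N))) = (\<Sum>k<K. seeley_coeff i k * f (x(N := - (2 ^ k) * x N)))"
      by (intro suminf_finite) auto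
    then show ?thesis using x assms seeley_nonpos[of x i f] by simp
  qed
  then show ?thesis using that by blast
qed

text \<open>Supplies the majorant for the Weierstrass test. Continuity bounds \<open>f\<close> on a
  compact box around the foot of \<open>x0\<close> with heights in \<open>{0..1}\<close>; above
  height 1 the function vanishes.\<close>

lemma half_bounded_nearby:
  assumes "half f" "small f" "x0 \<in> cyl"
  obtains V M where "open_euc (Suc N) V" "x0 \<in> V" "V \<subseteq> cyl" "M \<ge> 0"
    "\<And>x s. x \<in> V \<Longrightarrow> s \<ge> 0 \<Longrightarrow> \<bar>f (x(N := s))\<bar> \<le> M"
proof -
  let ?y = "x0(N := 0)"
  obtain d where d: "d > 0" "\<forall>y\<in>euc N. edist N ?y y < d \<longrightarrow> y \<in> Y"
    using Y assms(3) unfolding cyl_def open_euc_def by blast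
  \<comment> \<open>If each of the \<open>N\<close> coordinates is off by at most \<open>e\<close>,
    the distance is at most \<open>N * e\<close>, which is less than \<open>d\<close>.\<close>
  define e where "e = d / (N + 1)"
  have e: "e > 0" using d by (simp add: e_def)
  \<comment> \<open>Coordinates beyond \<open>N\<close> are confined to \<open>{0}\<close>, so the
    product of all \<open>I i\<close> is compact by Tychonoff and lies in
    \<open>euc (Suc N)\<close>.\<close>
  define I where "I = (\<lambda>i. if i < N then {x0 i - e .. x0 i + e} else if i = N then {0..1} else {0::real})"
  define K where "K = PiE UNIV I"
  have "compactin (product_topology (\<lambda>i::nat. euclideanreal) UNIV) K"
    unfolding K_def compactin_PiE by (auto simp: I_def)
  then have K: "compact K" by (simp add: euclidean_product_topology)
  have memY: "y \<in> Y" if y: "y \<in> euc N" "\<And>i. i < N \<Longrightarrow> \<bar>y i - x0 i\<bar> \<le> e" for y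
  proof -
    have "edist N ?y y \<le> (\<Sum>i<N. \<bar>?y i - y i\<bar>)" by (rule edist_le_sum)
    also have "\<dots> \<le> (\<Sum>i<N. e)" using y by (intro sum_mono) (auto simp: abs_minus_commute)
    also have "\<dots> < d" using d by (simp add: e_def field_simps)
    finally show ?thesis using d y by blast
  qed
  have Ksub: "K \<subseteq> {x\<in>cyl. x N \<ge> 0}"
  proof
    fix x assume "x \<in> K"
    then have x: "x i \<in> I i" for i by (auto simp: K_def PiE_def Pi_def)
    have eu: "x i = 0" if "i > N" for i using x[of i] that by (auto simp: I_def)
    have "x N \<ge> 0" using x[of N] by (auto simp: I_def)
    moreover have "x \<in> euc (Suc N)" using eu by (auto simp: euc_def)
    moreover have "x(N := 0) \<in> Y"
    proof (rule memY)
      show "x(N := 0) \<in> euc N" using eu by (auto simp: euc_def le_less)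
      fix i assume "i < N"
      then show "\<bar>(x(N := 0)) i - x0 i\<bar> \<le> e" using x[of i] by (auto simp: I_def abs_le_iff)
    qed
    ultimately show "x \<in> {x\<in>cyl. x N \<ge> 0}" by (simp add: cyl_def)
  qed
  have "compact (f ` K)"
    by (rule compact_continuous_image[OF continuous_on_subset[OF half_continuous[OF assms(1)] Ksub] K])
  then obtain M where M: "M > 0" "\<forall>z\<in>f ` K. norm z \<le> M"
    using compact_imp_bounded bounded_pos by blast
  define V where "V = cyl \<inter> {x\<in>euc (Suc N). \<forall>i<N. \<bar>x i - x0 i\<bar> < e}"
  have "open_euc (Suc N) V"
  proof -
    define W where "W = cyl \<inter> (\<Inter>i\<in>{..<N}. {x\<in>cyl. \<bar>x i - x0 i\<bar> \<in> {..<e}})"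
    have "open_euc (Suc N) (cyl \<inter> (\<Inter>i\<in>A. {x\<in>cyl. \<bar>x i - x0 i\<bar> \<in> {..<e}}))" if "finite A" for A
      using that
    proof (induction A)
      case empty
      then show ?case using open_cyl by simp
    next
      case (insert a A)
      have "open_euc (Suc N) {x\<in>cyl. \<bar>x a - x0 a\<bar> \<in> {..<e}}"
        by (intro open_euc_vimage[OF open_cyl] continuous_intros continuous_on_coord)
      from open_euc_Int[OF this insert.IH] show ?case by (simp add: Int_left_commute)
    qed
    then have "open_euc (Suc N) W" by (simp add: W_def)
    moreover have "W = V" unfolding W_def V_def by (auto simp: cyl_euc)
    ultimately show ?thesis by simp
  qed
  moreover have "x0 \<in> V" using assms(3) e by (auto simp: V_def cyl_euc)
  moreover have "\<bar>f (x(N := s))\<bar> \<le> M" if x: "x \<in> V" "s \<ge> 0" for x s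
  proof (cases "s \<le> 1")
    case True
    have "(x(N := s)) i \<in> I i" for i
      using x True by (auto simp: I_def V_def euc_def abs_less_iff)
    then have "x(N := s) \<in> K" by (auto simp: K_def)
    then show ?thesis using M by auto
  next
    case False
    have "x(N := s) \<in> cyl" using x by (auto simp: V_def intro: cyl_upd)
    then have "f (x(N := s)) = 0" using False assms(2) by (simp add: small_def)
    then show ?thesis using M by simp
  qed
  ultimately show ?thesis using that[of V M] M by (auto simp: V_def)
qed

lemma seeley_continuous:
  assumes f: "half f" "small f"
  shows "continuous_on cyl (seeley i f)"
proof (rule continuous_on_open_euc_local[OF open_euc_subset[OF open_cyl]])
  fix x0 assume "x0 \<in> cyl"
  then obtain V M where V: "open_euc (Suc N) V" "x0 \<in> V" "V \<subseteq> cyl" "M \<ge> 0"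
    "\<And>x s. x \<in> V \<Longrightarrow> s \<ge> 0 \<Longrightarrow> \<bar>f (x(N := s))\<bar> \<le> M"
    using half_bounded_nearby[OF f] by metis
  let ?A = "{x\<in>V. x N \<le> 0}" and ?B = "{x\<in>V. x N \<ge> 0}"
  let ?t = "\<lambda>k x. seeley_coeff i k * f (x(N := - (2 ^ k) * x N))"
  have "uniform_limit ?A (\<lambda>n x. \<Sum>k<n. ?t k x) (\<lambda>x. \<Sum>k. ?t k x) sequentially"
  proof (rule Weierstrass_m_test)
    show "summable (\<lambda>k. \<bar>seeley_coeff i k\<bar> * M)" by (rule summable_mult2[OF summable_seeley_coeff])
    fix k x assume x: "x \<in> ?A"
    then have "- (2 ^ k) * x N \<ge> 0" by (simp add: mult_nonneg_nonpos)
    then show "norm (?t k x) \<le> \<bar>seeley_coeff i k\<bar> * M"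
      using V(5) x by (auto simp: abs_mult intro!: mult_left_mono)
  qed
  moreover have "continuous_on ?A (\<lambda>x. \<Sum>k<n. ?t k x)" for n
  proof (intro continuous_intros)
    fix k
    have "continuous_on ?A (\<lambda>x. x(N := - (2 ^ k) * x N))"
      by (intro continuous_on_upd continuous_on_id continuous_on_mult continuous_on_const continuous_on_coord)
    then show "continuous_on ?A (\<lambda>x. f (x(N := - (2 ^ k) * x N)))"
      by (rule continuous_on_compose2[OF half_continuous[OF f(1)]])
        (use V(3) cyl_upd in \<open>auto simp: mult_nonneg_nonpos subset_iff\<close>)
  qed
  ultimately have "continuous_on ?A (\<lambda>x. \<Sum>k. ?t k x)"
    by (intro uniform_limit_theorem[where F=sequentially]) (auto intro!: always_eventually)
  then have A: "continuous_on ?A (seeley i f)"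
    by (rule continuous_on_eq) (simp add: seeley_nonpos)
  have B: "continuous_on ?B (seeley i f)"
    by (rule continuous_on_eq[OF continuous_on_subset[OF half_continuous[OF f(1)]]])
      (use V(3) in \<open>auto simp: seeley_def\<close>)
  have cl: "closedin (top_of_set V) {x\<in>V. x N \<in> C}" if "closed C" for C
    using continuous_closedin_preimage[OF continuous_on_coord[of V N] that]
    by (simp add: vimage_def Int_def conj_commute)
  have "closedin (top_of_set V) ?A" "closedin (top_of_set V) ?B"
    using cl[OF closed_atMost[of 0]] cl[OF closed_atLeast[of 0]] by simp_all
  moreover have "?A \<union> ?B = V" by auto
  ultimately have "continuous_on V (seeley i f)"
    using continuous_on_Un_local[of ?A ?B] A B by simp
  then show "\<exists>V. open_euc (Suc N) V \<and> x0 \<in> V \<and> V \<subseteq> cyl \<and> continuous_on V (seeley i f)"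
    using V by blast
qed

lemma seeley_has_pd_neg:
  assumes f: "small f" "small f'" and j: "j < Suc N" and x: "x \<in> cyl" "x N < 0"
    and pd: "\<And>x. x \<in> cyl \<Longrightarrow> x N > 0 \<Longrightarrow> has_pd j f (f' x) x"
  shows "has_pd j (seeley i f) (seeley (if j = N then Suc i else i) f' x) x"
proof -
  define c where "c = x N / 2"
  have c: "c < 0" "x N < c" using x by (auto simp: c_def)
  obtain K where "\<forall>i f x. small f \<longrightarrow> x \<in> cyl \<longrightarrow> x N < c \<longrightarrow>
    seeley i f x = (\<Sum>k<K. seeley_coeff i k * f (x(N := - (2 ^ k) * x N)))"
    using seeley_finite[OF c(1)] .
  note K = this[rule_format]
  let ?i = "if j = N then Suc i else i"
  have each: "has_pd j (\<lambda>x. seeley_coeff i k * f (x(N := - (2 ^ k) * x N)))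
      (seeley_coeff ?i k * f' (x(N := - (2 ^ k) * x N))) x" for k
  proof -
    let ?z = "x(N := - (2 ^ k) * x N)"
    \<comment> \<open>The inner derivative of the reflection: \<open>- (2 ^ k)\<close> in the normal
      direction, where it is absorbed into \<open>seeley_coeff (Suc i) k\<close>, and 1 in a
      tangential one.\<close>
    let ?c = "if j = N then - (2 ^ k) else 1 :: real"
    have "?z N > 0" using x by (simp add: mult_pos_neg)
    then have "has_pd j f (f' ?z) ?z" by (rule pd[OF cyl_upd[OF x(1)]])
    then have "has_pd j f (f' ?z) (?z(j := ?z j + ?c * 0))"
      by (simp only: mult_zero_right add_0_right fun_upd_triv)
    from has_pd_line[OF this]
    have 1: "((\<lambda>s. f (?z(j := ?z j + ?c * s))) has_real_derivative f' ?z * ?c) (at 0)" .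
    have eq: "?z(j := ?z j + ?c * s) = (x(j := x j + s))(N := - (2 ^ k) * (x(j := x j + s)) N)" for s
      by (auto simp: fun_eq_iff algebra_simps)
    have "((\<lambda>s. f ((x(j := x j + s))(N := - (2 ^ k) * (x(j := x j + s)) N))) has_real_derivative f' ?z * ?c) (at 0)"
      using 1 unfolding eq .
    from DERIV_cmult[OF this, of "seeley_coeff i k"] show ?thesis
      unfolding has_pd_def by (auto simp: seeley_coeff_Suc mult_ac)
  qed
  have "has_pd j (\<lambda>x. \<Sum>k<K. seeley_coeff i k * f (x(N := - (2 ^ k) * x N)))
      (\<Sum>k<K. seeley_coeff ?i k * f' (x(N := - (2 ^ k) * x N))) x"
    using each unfolding has_pd_def by (intro DERIV_sum) auto
  then have "has_pd j (seeley i f) (\<Sum>k<K. seeley_coeff ?i k * f' (x(N := - (2 ^ k) * x N))) x"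
    by (rule has_pd_cong[OF open_cyl_less[of c] _ j, rotated -1]) (use x c K[OF f(1)] in auto)
  then show ?thesis using K[OF f(2) x(1) c(2), of ?i] by simp
qed

lemma seeley_has_pd:
  assumes f: "half f" "small f" "half f'" "small f'" and j: "j < Suc N" and x: "x \<in> cyl"
    and pd: "\<And>x. x \<in> cyl \<Longrightarrow> (if j = N then x N > 0 else x N \<ge> 0) \<Longrightarrow> has_pd j f (f' x) x"
  shows "has_pd j (seeley i f) (seeley (if j = N then Suc i else i) f' x) x"
proof -
  have pd': "\<And>x. x \<in> cyl \<Longrightarrow> x N > 0 \<Longrightarrow> has_pd j f (f' x) x" using pd by (auto split: if_splits)
  have pos: "has_pd j (seeley i f) (seeley (if j = N then Suc i else i) f' x) x" if x: "x \<in> cyl" "x N > 0" for x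
  proof -
    have "has_pd j (seeley i f) (f' x) x"
      by (rule has_pd_cong[OF open_cyl_pos[of 0] _ j _ pd'[OF x]]) (use x in \<open>auto simp: seeley_def\<close>)
    then show ?thesis using x by (simp add: seeley_def)
  qed
  consider "x N < 0" | "x N > 0" | "x N = 0" "j < N" | "x N = 0" "j = N" using j by linarith
  then show ?thesis
  proof cases
    case 1
    then show ?thesis using seeley_has_pd_neg[OF f(2,4) j x _ pd'] by blast
  next
    case 2
    then show ?thesis using pos x by blast
  next
    case 3
    then have "has_pd j f (f' x) x" using pd[OF x] by simp
    then show ?thesis using 3 by (simp add: has_pd_def seeley_def)
  next
    case 4
    \<comment> \<open>The normal derivative at height 0: it is known on both sides, and the
      candidate \<open>seeley (Suc i) f'\<close> is continuous across, so its value at 0 is the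
      derivative there too.\<close>
    let ?\<phi> = "\<lambda>t. seeley i f (x(N := t))" and ?\<psi> = "\<lambda>t. seeley (Suc i) f' (x(N := t))"
    have up: "continuous_on UNIV (\<lambda>t. x(N := t))"
      by (intro continuous_on_upd continuous_on_const continuous_on_id)
    have c: "continuous_on UNIV ?\<phi>" "continuous_on UNIV ?\<psi>"
      by (rule continuous_on_compose2[OF seeley_continuous up]; use f x in \<open>auto intro: cyl_upd\<close>)+
    have "(?\<phi> has_real_derivative ?\<psi> 0) (at 0)"
    proof (rule deriv_from_limit[of 1])
      show "continuous_on {-1<..<1} ?\<phi>" by (rule continuous_on_subset[OF c(1)]) simp
      show "(?\<psi> \<longlongrightarrow> ?\<psi> 0) (at 0)" using c(2) by (simp add: continuous_on_def)
      fix t :: real assume t: "t \<noteq> 0"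
      let ?z = "x(N := t)"
      have "has_pd N (seeley i f) (?\<psi> t) ?z"
        using pos[OF cyl_upd[OF x], of t] seeley_has_pd_neg[OF f(2,4) j cyl_upd[OF x], of t i] pd' t 4
        by (cases "t > 0") auto
      then have "((\<lambda>s. ?\<phi> (s + t)) has_real_derivative ?\<psi> t) (at 0)"
        by (simp add: has_pd_def add.commute)
      then show "(?\<phi> has_real_derivative ?\<psi> t) (at t)"
        using DERIV_shift[of ?\<phi> "?\<psi> t" 0 t] by simp
    qed simp
    moreover have "x(N := 0) = x" using 4 by auto
    ultimately show ?thesis using 4 by (simp add: has_pd_def)
  qed
qed

lemma seeley_Ck: "half f \<Longrightarrow> small f \<Longrightarrow> Ck r (Suc N) cyl (seeley i f)"
proof (induction r arbitrary: f i)
  case 0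
  then show ?case using seeley_continuous by simp
next
  case (Suc r)
  obtain F where F: "\<forall>j<Suc N. half (F j) \<and> small (F j) \<and>
    (\<forall>x\<in>cyl. (if j = N then x N > 0 else x N \<ge> 0) \<longrightarrow> has_pd j f (F j x) x)"
    using half_partials[OF Suc.prems] by blast
  show ?case
  proof (rule Ck_SucI[where g="\<lambda>j. seeley (if j = N then Suc i else i) (F j)"])
    show "continuous_on cyl (seeley i f)" by (rule seeley_continuous[OF Suc.prems])
    show "has_pd j (seeley i f) (seeley (if j = N then Suc i else i) (F j) x) x"
      if "j < Suc N" "x \<in> cyl" for j x
      using F that by (intro seeley_has_pd Suc.prems) auto
    show "Ck r (Suc N) cyl (seeley (if j = N then Suc i else i) (F j))" if "j < Suc N" for j
      using F that by (intro Suc.IH) auto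
  qed
qed

text \<open>Only \<open>cutoff * f\<close> is reflected; the rest vanishes near the boundary and is
  continued by 0. Below height -1/2 every reflected point lies where the cutoff is zero, and this
  vanishing later lets the radial extension from the fat sphere pass smoothly over
  \<open>u = 0\<close>.\<close>

theorem half_extension:
  assumes f: "half f"
  obtains F where "smooth_fun (Suc N) cyl F" "\<forall>x\<in>cyl. x N \<ge> 0 \<longrightarrow> F x = f x"
    "\<forall>x\<in>cyl. x N < - 1/2 \<longrightarrow> F x = 0"
proof -
  let ?f = "\<lambda>x. cutoff (x N) * f x"
  let ?g = "\<lambda>x. if x N > 0 then (1 - cutoff (x N)) * f x else 0"
  have co: "smooth_fun (Suc N) U (\<lambda>x. cutoff (x N))" if "open_euc (Suc N) U" for U
    by (rule smooth_cutoff[OF that smooth_coord[OF that]])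
  have "smooth_fun (Suc N) cyl (\<lambda>x. cutoff ((x N)\<^sup>2))"
    by (rule smooth_cutoff[OF open_cyl smooth_power2[OF open_cyl smooth_coord[OF open_cyl]]])
  then have h: "half ?f" using f unfolding half_def by (simp add: smooth_mult open_cyl)
  have s: "small ?f" by (simp add: small_def cutoff_0)
  have 1: "smooth_fun (Suc N) cyl (seeley 0 ?f)"
    using seeley_Ck[OF h s] by (simp add: smooth_fun_iff_Ck[OF open_cyl])
  have 2: "smooth_fun (Suc N) cyl ?g"
  proof (rule smooth_local[OF open_cyl])
    fix x assume x: "x \<in> cyl"
    show "\<exists>V. open_euc (Suc N) V \<and> x \<in> V \<and> V \<subseteq> cyl \<and> smooth_fun (Suc N) V ?g"
    proof (cases "x N < 1/4")
      case True
      have "smooth_fun (Suc N) {x\<in>cyl. x N < 1/4} ?g"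
        by (rule smooth_cong[OF open_cyl_less _ smooth_const[OF open_cyl_less, of _ 0]])
          (auto simp: cutoff_1)
      then show ?thesis using True x open_cyl_less by blast
    next
      case False
      have "smooth_fun (Suc N) {x\<in>cyl. x N > 0} (\<lambda>x. (1 - cutoff (x N)) * f x)"
        by (intro smooth_mult smooth_diff smooth_const open_cyl_pos co half_smooth_pos f)
      then have "smooth_fun (Suc N) {x\<in>cyl. x N > 0} ?g"
        by (rule smooth_cong[OF open_cyl_pos, rotated]) simp
      then show ?thesis using False x open_cyl_pos[of 0] by (intro exI[of _ "{x\<in>cyl. x N > 0}"]) auto
    qed
  qed
  have 3: "seeley 0 ?f x + ?g x = f x" if "x N \<ge> 0" for x
    using that by (auto simp: seeley_def cutoff_1 algebra_simps)
  have 4: "seeley 0 ?f x + ?g x = 0" if x: "x \<in> cyl" "x N < - 1/2" for x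
  proof -
    have "cutoff (- (2 ^ k) * x N) = 0" for k
    proof (rule cutoff_0)
      have "1 \<le> (2::real) ^ k" by simp
      then have "1 * (1/2) \<le> 2 ^ k * - x N" using x by (intro mult_mono) auto
      then show "1/2 \<le> - (2 ^ k) * x N" by simp
    qed
    then show ?thesis using x by (simp add: seeley_def)
  qed
  show ?thesis
    by (rule that[OF smooth_add[OF open_cyl 1 2]]) (use 3 4 in auto)
qed

end

section \<open>Fat spheres and fat disks\<close>

lemma continuous_on_unorm: "continuous_on S (unorm n)"
  unfolding unorm_def[abs_def]
  by (intro continuous_intros continuous_on_subset[OF continuous_on_product_coordinates]) auto

lemma continuous_on_vnorm: "continuous_on S (vnorm n m)"
  unfolding vnorm_def[abs_def]
  by (intro continuous_intros continuous_on_subset[OF continuous_on_product_coordinates]) auto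

lemma unorm_nonneg [simp]: "0 \<le> unorm n w"
  by (simp add: unorm_def sum_nonneg)

lemma vnorm_nonneg [simp]: "0 \<le> vnorm n m w"
  by (simp add: vnorm_def sum_nonneg)

lemma unorm_upd [simp]: "n \<le> k \<Longrightarrow> unorm n (w(k := c)) = unorm n w"
  by (simp add: unorm_def)

lemma vnorm_upd [simp]: "n + m \<le> k \<Longrightarrow> vnorm n m (w(k := c)) = vnorm n m w"
  by (simp add: vnorm_def)

lemma smooth_unorm:
  assumes U: "open_euc k U" and pos: "\<And>x. x \<in> U \<Longrightarrow> unorm n x > 0"
  shows "smooth_fun k U (unorm n)"
proof -
  have 1: "smooth_fun k U (\<lambda>w. \<Sum>i<n. (w i)\<^sup>2)"
    by (intro smooth_sum smooth_power2 smooth_coord U)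
  have "(\<lambda>w. \<Sum>i<n. (w i)\<^sup>2) ` U \<subseteq> {0<..}" using pos by (auto simp: unorm_def)
  from smooth_compose1[OF U 1 smooth1_powr[of "1/2"] this] show ?thesis
    by (rule smooth_cong[OF U, rotated]) (simp add: unorm_def powr_half_sqrt sum_nonneg)
qed

lemma smooth_vnorm_sq: "open_euc k U \<Longrightarrow> smooth_fun k U (\<lambda>w. (vnorm n m w)\<^sup>2)"
  by (simp add: vnorm_def sum_nonneg smooth_sum smooth_power2 smooth_coord)

lemma smooth_vnorm:
  assumes U: "open_euc k U" and pos: "\<And>x. x \<in> U \<Longrightarrow> vnorm n m x > 0"
  shows "smooth_fun k U (vnorm n m)"
proof -
  have "(\<lambda>w. (vnorm n m w)\<^sup>2) ` U \<subseteq> {0<..}" using pos by fastforce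
  from smooth_compose1[OF U smooth_vnorm_sq[OF U] smooth1_powr[of "1/2"] this] show ?thesis
    by (rule smooth_cong[OF U, rotated]) (simp add: powr_half_sqrt)
qed

lemma smooth_divide:
  assumes U: "open_euc k U" and "smooth_fun k U f" "smooth_fun k U g" "\<And>x. x \<in> U \<Longrightarrow> g x > 0"
  shows "smooth_fun k U (\<lambda>x. f x / g x)"
  unfolding divide_inverse
  by (intro smooth_mult[OF U] assms(2) smooth_compose1[OF U assms(3) smooth1_inverse]) (use assms(4) in auto)

text \<open>Coordinates from \<open>n + m\<close> on are cleared, so the result lies in R^(n+m) even
  if the argument carries the additional coordinate \<open>t\<close>.\<close>

definition scale_uv :: "nat \<Rightarrow> nat \<Rightarrow> real \<Rightarrow> real \<Rightarrow> (nat \<Rightarrow> real) \<Rightarrow> nat \<Rightarrow> real" where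
  "scale_uv n m c d w = (\<lambda>i. if i < n then c * w i else if i < n + m then d * w i else 0)"

lemma scale_uv_euc [simp]: "scale_uv n m c d w \<in> euc (n + m)"
  by (simp add: scale_uv_def euc_def)

lemma unorm_scale [simp]: "unorm n (scale_uv n m c d w) = \<bar>c\<bar> * unorm n w"
proof -
  have "(\<Sum>i<n. (scale_uv n m c d w i)\<^sup>2) = c\<^sup>2 * (\<Sum>i<n. (w i)\<^sup>2)"
    by (simp add: scale_uv_def power_mult_distrib sum_distrib_left)
  then show ?thesis by (simp add: unorm_def real_sqrt_mult)
qed

lemma vnorm_scale [simp]: "vnorm n m (scale_uv n m c d w) = \<bar>d\<bar> * vnorm n m w"
proof -
  have "(\<Sum>i<m. (scale_uv n m c d w (n + i))\<^sup>2) = d\<^sup>2 * (\<Sum>i<m. (w (n + i))\<^sup>2)"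
    by (simp add: scale_uv_def power_mult_distrib sum_distrib_left)
  then show ?thesis by (simp add: vnorm_def real_sqrt_mult)
qed

lemma scale_uv_1: "w \<in> euc (n + m) \<Longrightarrow> scale_uv n m 1 1 w = w"
  by (auto simp: scale_uv_def euc_def fun_eq_iff)

lemma scale_uv_upd [simp]: "n + m \<le> k \<Longrightarrow> scale_uv n m c d (w(k := a)) = scale_uv n m c d w"
  by (auto simp: scale_uv_def fun_eq_iff)

lemma scale_uv_scale [simp]: "scale_uv n m c d (scale_uv n m c' d' w) = scale_uv n m (c * c') (d * d') w"
  by (auto simp: scale_uv_def fun_eq_iff)

lemma smooth_map_scale_uv:
  assumes U: "open_euc k U" and c: "smooth_fun k U c" and d: "smooth_fun k U d"
  shows "smooth_map k U (n + m) (\<lambda>x. scale_uv n m (c x) (d x) x)"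
  unfolding smooth_map_def
proof (intro conjI ballI allI impI)
  fix i assume i: "i < n + m"
  show "smooth_fun k U (\<lambda>x. scale_uv n m (c x) (d x) x i)"
    using i c d smooth_mult[OF U _ smooth_coord[OF U]] by (cases "i < n") (auto simp: scale_uv_def)
qed simp

lemma continuous_on_scale_uv:
  assumes "continuous_on S c" "continuous_on S d"
  shows "continuous_on S (\<lambda>w. scale_uv n m (c w) (d w) w)"
proof (rule continuous_on_coordinatewise_then_product)
  fix i
  have "continuous_on S (\<lambda>w. (w::nat\<Rightarrow>real) i)"
    by (rule continuous_on_subset[OF continuous_on_product_coordinates]) simp
  then show "continuous_on S (\<lambda>w. scale_uv n m (c w) (d w) w i)"
    using assms by (cases "i < n"; cases "i < n + m") (auto simp: scale_uv_def intro!: continuous_intros)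
qed

text \<open>The base of the half space. Polar coordinates are used redundantly: the direction is
  read off from \<open>u\<close> itself and the radius from an additional variable, so no charts of
  the unit sphere enter.\<close>

definition nonzero_u :: "nat \<Rightarrow> nat \<Rightarrow> (nat \<Rightarrow> real) set" where
  "nonzero_u n m = {w \<in> euc (n + m). unorm n w > 0}"

text \<open>The plot \<open>(t, u, v) \<mapsto> ((1 + t\<^sup>2) u / \<parallel>u\<parallel>, v)\<close> onto the fat sphere; \<open>t\<close> is coordinate \<open>n + m\<close>.\<close>

definition sphere_plot :: "nat \<Rightarrow> nat \<Rightarrow> (nat \<Rightarrow> real) \<Rightarrow> nat \<Rightarrow> real" where
  "sphere_plot n m x = scale_uv n m ((1 + (x (n + m))\<^sup>2) / unorm n x) 1 x"

lemma open_nonzero_u: "open_euc (n + m) (nonzero_u n m)"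
  using open_euc_vimage[OF open_euc_euc continuous_on_unorm open_greaterThan, of "n + m" n 0]
  by (simp add: nonzero_u_def)

lemma half_space_nonzero_u: "half_space (n + m) (nonzero_u n m)"
  by unfold_locales (rule open_nonzero_u)

lemma cyl_nonzero_u: "half_space.cyl (n + m) (nonzero_u n m) = {x \<in> euc (Suc (n + m)). unorm n x > 0}"
  unfolding half_space.cyl_def[OF half_space_nonzero_u] by (auto simp: nonzero_u_def euc_def)

lemma sphere_plot: "euc_plot (n + m) (fat_sphere n m) (Suc (n + m))
    (half_space.cyl (n + m) (nonzero_u n m)) (sphere_plot n m)"
proof -
  interpret half_space "n + m" "nonzero_u n m" by (rule half_space_nonzero_u)
  have pos: "unorm n x > 0" if "x \<in> cyl" for x using that by (simp add: cyl_nonzero_u)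
  have "smooth_map (Suc (n + m)) cyl (n + m) (sphere_plot n m)"
    unfolding sphere_plot_def[abs_def]
    by (intro smooth_map_scale_uv smooth_divide smooth_add smooth_const smooth_power2 smooth_coord
        smooth_unorm open_cyl pos)
  moreover have "sphere_plot n m x \<in> fat_sphere n m" if "x \<in> cyl" for x
    using pos[OF that] by (simp add: fat_sphere_def sphere_plot_def abs_of_pos add_pos_nonneg)
  ultimately show ?thesis using open_cyl by (auto simp: euc_plot_def)
qed

text \<open>\<open>f'\<close> is \<open>f\<close> in the redundant polar coordinates, height
  \<open>s\<close> standing for radius \<open>1 + s\<close>. Substituting \<open>s = |u| - 1\<close>
  into its extension returns \<open>f\<close> on the sphere, as the scaling factor becomes 1. For
  \<open>|u| < 1/2\<close> the height is below -1/2, so the result is zero near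
  \<open>u = 0\<close>.\<close>

lemma sphere_extension:
  assumes f: "\<And>k U Q. euc_plot (n + m) (fat_sphere n m) k U Q \<Longrightarrow> smooth_fun k U (\<lambda>u. f (Q u))"
  obtains E where "smooth_fun (n + m) (euc (n + m)) E" "\<forall>w\<in>fat_sphere n m. E w = f w"
proof -
  let ?N = "n + m"
  interpret half_space ?N "nonzero_u n m" by (rule half_space_nonzero_u)
  define f' where "f' = (\<lambda>x. f (scale_uv n m ((1 + x ?N) / unorm n x) 1 x))"
  have "half f'"
    unfolding half_def f'_def using f[OF sphere_plot] by (simp add: sphere_plot_def)
  then obtain F where F: "smooth_fun (Suc ?N) cyl F" "\<forall>x\<in>cyl. x ?N \<ge> 0 \<longrightarrow> F x = f' x"
    "\<forall>x\<in>cyl. x ?N < - 1/2 \<longrightarrow> F x = 0"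
    using half_extension by blast
  define E where "E = (\<lambda>w. if unorm n w > 0 then F (w(?N := unorm n w - 1)) else 0)"
  have eu: "euc ?N \<subseteq> euc (Suc ?N)" by (auto simp: euc_def)
  have mem: "w(?N := c) \<in> cyl" if "w \<in> nonzero_u n m" for w c
    unfolding cyl_nonzero_u using that eu by (auto simp: nonzero_u_def)
  have "smooth_fun ?N (euc ?N) E"
  proof (rule smooth_local[OF open_euc_euc])
    fix w assume w: "w \<in> euc ?N"
    show "\<exists>V. open_euc ?N V \<and> w \<in> V \<and> V \<subseteq> euc ?N \<and> smooth_fun ?N V E"
    proof (cases "unorm n w > 0")
      case True
      let ?V = "nonzero_u n m"
      have s: "smooth_fun ?N ?V (\<lambda>w. unorm n w - 1)"
        by (intro smooth_diff smooth_unorm smooth_const open_nonzero_u) (simp add: nonzero_u_def)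
      have "smooth_map ?N ?V (Suc ?N) (\<lambda>w. w(?N := unorm n w - 1))"
        unfolding smooth_map_def
      proof (intro conjI ballI allI impI)
        show "w(?N := unorm n w - 1) \<in> euc (Suc ?N)" if "w \<in> ?V" for w
          using mem[OF that] cyl_euc by blast
        show "smooth_fun ?N ?V (\<lambda>w. (w(?N := unorm n w - 1)) i)" for i
          using s smooth_coord[OF open_nonzero_u] by (cases "i = ?N") auto
      qed
      then have "smooth_fun ?N ?V (\<lambda>w. F (w(?N := unorm n w - 1)))"
        by (rule smooth_compose[OF open_cyl open_nonzero_u _ _ F(1)]) (use mem in auto)
      then have "smooth_fun ?N ?V E"
        by (rule smooth_cong[OF open_nonzero_u, rotated]) (simp add: E_def nonzero_u_def)
      then show ?thesis using True w open_nonzero_u by (intro exI[of _ ?V]) (auto simp: nonzero_u_def)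
    next
      case False
      let ?V = "{w\<in>euc ?N. unorm n w < 1/2}"
      have V: "open_euc ?N ?V"
        using open_euc_vimage[OF open_euc_euc continuous_on_unorm open_lessThan, of ?N n "1/2"] by simp
      have "E w = 0" if "w \<in> ?V" for w
        using F(3)[rule_format, OF mem, of w "unorm n w - 1"] that by (auto simp: E_def nonzero_u_def)
      then have "smooth_fun ?N ?V E"
        by (intro smooth_cong[OF V _ smooth_const[OF V, of 0]]) auto
      then show ?thesis using False w V by (intro exI[of _ ?V]) auto
    qed
  qed
  moreover have "E w = f w" if w: "w \<in> fat_sphere n m" for w
  proof -
    have u: "unorm n w \<ge> 1" "w \<in> euc ?N" using w by (auto simp: fat_sphere_def)
    then have "E w = f' (w(?N := unorm n w - 1))"
      using F(2)[rule_format, OF mem, of w "unorm n w - 1"] by (auto simp: E_def nonzero_u_def)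
    also have "\<dots> = f w" using u by (simp add: f'_def scale_uv_1)
    finally show ?thesis .
  qed
  ultimately show ?thesis using that by blast
qed

section \<open>D-topology and subspace topology\<close>

lemma openin_via_sections:
  assumes S: "S \<subseteq> euc N" and W: "W \<subseteq> S"
    and op: "\<And>k U Q. euc_plot N S k U Q \<Longrightarrow> open_euc k {u\<in>U. Q u \<in> W}"
    and sec: "\<And>x. x \<in> S \<Longrightarrow> \<exists>R k U Q \<sigma>. openin (top_of_set S) R \<and> x \<in> R \<and> euc_plot N S k U Q \<and>
      continuous_on R \<sigma> \<and> \<sigma> ` R \<subseteq> U \<and> (\<forall>y\<in>R. Q (\<sigma> y) = y)"
  shows "openin (top_of_set S) W"
proof (subst openin_subopen, intro ballI)
  fix x assume x: "x \<in> W"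
  then obtain R k U Q \<sigma> where R: "openin (top_of_set S) R" "x \<in> R" "euc_plot N S k U Q"
    "continuous_on R \<sigma>" "\<sigma> ` R \<subseteq> U" "\<forall>y\<in>R. Q (\<sigma> y) = y"
    using sec[of x] W by blast
  let ?O = "{u\<in>U. Q u \<in> W}"
  have "open_euc k U" using R(3) by (simp add: euc_plot_def)
  then have Ue: "U \<subseteq> euc k" by (rule open_euc_subset)
  have "openin (top_of_set (euc k)) ?O" using op[OF R(3)] by (simp add: open_euc_iff)
  then have "openin (top_of_set R) (R \<inter> \<sigma> -` ?O)"
    by (rule continuous_openin_preimage[OF R(4), rotated]) (use R(5) Ue in auto)
  \<comment> \<open>As \<open>Q\<close> inverts the section on \<open>R\<close>, the parameters that
    \<open>Q\<close> sends into \<open>W\<close> pull back to \<open>R \<inter> W\<close>. A section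
    is only asked to be continuous, which admits square roots up to the boundary.\<close>
  moreover have "R \<inter> \<sigma> -` ?O = R \<inter> W" using R(5,6) by auto
  ultimately have "openin (top_of_set S) (R \<inter> W)" using R(1) openin_trans by metis
  then show "\<exists>T. openin (top_of_set S) T \<and> x \<in> T \<and> T \<subseteq> W" using x R(2) by blast
qed

lemma D_open_euc_plot_iff:
  "D_open S (euc_plot N S) W \<longleftrightarrow> W \<subseteq> S \<and> (\<forall>k U Q. euc_plot N S k U Q \<longrightarrow> open_euc k {u\<in>U. Q u \<in> W})"
  by (simp add: D_open_def)

lemma plot_space_euc: "plot_space S (euc_plot N S)"
  by unfold_locales (auto simp: euc_plot_def)

lemma openin_imp_D_open:
  assumes "openin (top_of_set S) W"
  shows "D_open S (euc_plot N S) W"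
  unfolding D_open_def
proof (intro conjI allI impI)
  show "W \<subseteq> S" using assms openin_imp_subset by blast
  fix k U Q assume Q: "euc_plot N S k U Q"
  then have U: "open_euc k U" and c: "continuous_on U Q" and im: "Q ` U \<subseteq> S"
    using smooth_map_continuous by (auto simp: euc_plot_def)
  have "openin (top_of_set U) (U \<inter> Q -` W)"
    by (rule continuous_openin_preimage[OF c _ assms]) (use im in auto)
  moreover have "U \<inter> Q -` W = {u\<in>U. Q u \<in> W}" by auto
  ultimately show "open_euc k {u\<in>U. Q u \<in> W}"
    using U unfolding open_euc_iff by (simp only: openin_trans)
qed

lemma fat_sphere_euc: "fat_sphere n m \<subseteq> euc (n + m)" by (auto simp: fat_sphere_def)
lemma fat_disk_euc: "fat_disk n m \<subseteq> euc (n + m)" by (auto simp: fat_disk_def)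

lemma sphere_D_open_imp_openin:
  assumes "D_open (fat_sphere n m) (euc_plot (n + m) (fat_sphere n m)) W"
  shows "openin (top_of_set (fat_sphere n m)) W"
proof (rule openin_via_sections[OF fat_sphere_euc])
  let ?N = "n + m" and ?S = "fat_sphere n m"
  interpret half_space ?N "nonzero_u n m" by (rule half_space_nonzero_u)
  fix x assume x: "x \<in> ?S"
  \<comment> \<open>The plot depends on \<open>t\<close> through \<open>1 + t^2\<close>, so the
    radius \<open>|u|\<close> is attained at \<open>t = sqrt (|u| - 1)\<close>.\<close>
  let ?\<sigma> = "\<lambda>w. w(?N := sqrt (unorm n w - 1))"
  have "continuous_on ?S ?\<sigma>"
    by (intro continuous_on_upd continuous_on_id continuous_intros continuous_on_unorm)
  moreover have "?\<sigma> ` ?S \<subseteq> cyl" by (auto simp: cyl_nonzero_u fat_sphere_def euc_def)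
  moreover have "sphere_plot n m (?\<sigma> y) = y" if "y \<in> ?S" for y
    using that by (simp add: sphere_plot_def fat_sphere_def scale_uv_1)
  ultimately show "\<exists>R k U Q \<sigma>. openin (top_of_set ?S) R \<and> x \<in> R \<and> euc_plot ?N ?S k U Q \<and>
      continuous_on R \<sigma> \<and> \<sigma> ` R \<subseteq> U \<and> (\<forall>y\<in>R. Q (\<sigma> y) = y)"
    using sphere_plot[of n m] x
    by (intro exI[of _ ?S] exI[of _ "Suc ?N"] exI[of _ cyl] exI[of _ "sphere_plot n m"] exI[of _ ?\<sigma>]) auto
qed (use assms in \<open>auto simp: D_open_euc_plot_iff\<close>)

text \<open>By \<open>phi t >= t\<close> the right hand side of the disk inequality is at most
  \<open>|u| + |v| - 1\<close>, hence at most \<open>|u|\<close>.\<close>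

lemma fat_disk_vnorm_le:
  assumes "w \<in> euc (n + m)" "vnorm n m w \<le> 1"
  shows "w \<in> fat_disk n m"
  using assms phi_ge[of "2 - unorm n w - vnorm n m w"] by (simp add: fat_disk_def)

text \<open>If the argument of \<open>phi\<close> is at least 1/2, where \<open>phi\<close> is the
  identity, the disk inequality is just \<open>|v| <= 1\<close>. For a smaller argument
  \<open>phi\<close> is at most 1/2, less than \<open>1 - |u|\<close>, and the inequality
  fails.\<close>

lemma fat_disk_vnorm_ge:
  assumes w: "w \<in> fat_disk n m" and u: "unorm n w < 1/2"
  shows "vnorm n m w \<le> 1"
proof (rule ccontr)
  let ?t = "2 - unorm n w - vnorm n m w"
  assume "\<not> vnorm n m w \<le> 1"
  then have t: "?t < 1 - unorm n w" by simp
  have "phi ?t < 1 - unorm n w"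
  proof (cases "?t \<ge> 1/2")
    case True
    then show ?thesis using t phi_eq[of ?t] by simp
  next
    case False
    then have "phi ?t \<le> phi (1/2)" by (intro phi_mono) simp
    then show ?thesis using u phi_eq[of "1/2"] by simp
  qed
  then show False using w by (simp add: fat_disk_def)
qed

text \<open>The tangent half-angle formula: with \<open>v = sin t\<close> the number
  \<open>a * v\<close> is \<open>tan (t/2)\<close>, and
  \<open>2 * tan (t/2) / (1 + tan (t/2) ^ 2) = sin t\<close>. It inverts the map from
  \<open>v\<close> to \<open>2 * v / (1 + v^2)\<close>, and is divided by \<open>v\<close> so as to
  hold at \<open>v = 0\<close> as well.\<close>

lemma half_angle:
  assumes "0 \<le> v" "v \<le> 1"
  defines "a \<equiv> 1 / (1 + sqrt (1 - v\<^sup>2))"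
  shows "2 / (1 + (a * v)\<^sup>2) * a = 1"
proof -
  let ?s = "sqrt (1 - v\<^sup>2)"
  have "v\<^sup>2 \<le> 1" using assms by (simp add: power_le_one)
  then have s: "?s \<ge> 0" "?s\<^sup>2 = 1 - v\<^sup>2" by auto
  have p: "1 + ?s > 0" using s(1) by linarith
  have "1 + (a * v)\<^sup>2 = ((1 + ?s)\<^sup>2 + v\<^sup>2) / (1 + ?s)\<^sup>2"
    using p unfolding a_def by (simp add: power_mult_distrib power_divide add_divide_distrib)
  also have "(1 + ?s)\<^sup>2 + v\<^sup>2 = 2 * (1 + ?s)" using s(2) by (simp add: power2_sum)
  also have "2 * (1 + ?s) / (1 + ?s)\<^sup>2 = 2 * a"
  proof -
    have "2 * P / P\<^sup>2 = 2 * (1 / P)" if "P > 0" for P :: real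
      using that by (simp add: power2_eq_square)
    then show ?thesis using p by (simp only: a_def)
  qed
  finally show ?thesis using p by (simp add: a_def)
qed

text \<open>In the coordinates \<open>r = \<parallel>u\<parallel>\<close> and \<open>\<tau> = 2 - \<parallel>u\<parallel> - \<parallel>v\<parallel>\<close> the disk is the epigraph \<open>r \<ge> 1 - \<phi> \<tau>\<close>,
  parametrised by \<open>r = 1 - \<phi> \<tau> + t\<^sup>2\<close>. This fails to be smooth at \<open>u = 0\<close>, near which the disk is
  \<open>\<parallel>v\<parallel> \<le> 1\<close>, parametrised by \<open>v \<mapsto> 2 v / (1 + \<parallel>v\<parallel>\<^sup>2)\<close>, and at \<open>v = 0\<close>, an interior point.\<close>

lemma disk_D_open_imp_openin:
  assumes "D_open (fat_disk n m) (euc_plot (n + m) (fat_disk n m)) W"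
  shows "openin (top_of_set (fat_disk n m)) W"
proof (rule openin_via_sections[OF fat_disk_euc])
  let ?N = "n + m" and ?D = "fat_disk n m"
  fix x assume x: "x \<in> ?D"
  let ?goal = "\<exists>R k U Q \<sigma>. openin (top_of_set ?D) R \<and> x \<in> R \<and> euc_plot ?N ?D k U Q \<and>
      continuous_on R \<sigma> \<and> \<sigma> ` R \<subseteq> U \<and> (\<forall>y\<in>R. Q (\<sigma> y) = y)"
  have op: "openin (top_of_set ?D) {w\<in>?D. f w \<in> B}" if "continuous_on ?D f" "open B" for f :: "_ \<Rightarrow> real" and B
    using continuous_openin_preimage_gen[OF that] by (simp add: vimage_def Int_def)
  \<comment> \<open>If neither (C) nor (A) holds, then \<open>|v| >= 1\<close> and
    \<open>|u| >= 1/2\<close>, so both norms are positive. Disks with \<open>n = 0\<close> or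
    \<open>m = 0\<close> fall under (A) or (C).\<close>
  consider (C) "vnorm n m x < 1" | (A) "unorm n x < 1/2" | (B) "unorm n x > 0" "vnorm n m x > 0"
    by linarith
  then show ?goal
  proof cases
    case C
    let ?U = "{w\<in>euc ?N. vnorm n m w < 1}" and ?R = "{w\<in>?D. vnorm n m w < 1}"
    have U: "open_euc ?N ?U"
      using open_euc_vimage[OF open_euc_euc continuous_on_vnorm open_lessThan, of ?N n m 1] by simp
    have "euc_plot ?N ?D ?N ?U (\<lambda>w. w)"
      using U smooth_map_id[OF U] fat_disk_vnorm_le by (auto simp: euc_plot_def)
    moreover have "openin (top_of_set ?D) ?R" using op[OF continuous_on_vnorm open_lessThan, of n m 1] by simp
    ultimately show ?goal using x C fat_disk_euc
      by (intro exI[of _ ?R] exI[of _ ?N] exI[of _ ?U] exI[of _ "\<lambda>w. w"] conjI) auto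
  next
    case A
    let ?U = "{w\<in>euc ?N. unorm n w < 1/2}" and ?R = "{w\<in>?D. unorm n w < 1/2}"
    let ?Q = "\<lambda>w. scale_uv n m 1 (2 / (1 + (vnorm n m w)\<^sup>2)) w"
    let ?\<sigma> = "\<lambda>w. scale_uv n m 1 (1 / (1 + sqrt (1 - (vnorm n m w)\<^sup>2))) w"
    have U: "open_euc ?N ?U"
      using open_euc_vimage[OF open_euc_euc continuous_on_unorm open_lessThan, of ?N n "1/2"] by simp
    have "smooth_map ?N ?U ?N ?Q"
      by (intro smooth_map_scale_uv smooth_divide smooth_add smooth_const smooth_vnorm_sq U)
        (simp add: add_pos_nonneg)
    moreover have "?Q w \<in> ?D" for w
    proof (rule fat_disk_vnorm_le)
      let ?v = "vnorm n m w"
      have "2 * ?v \<le> 1 + ?v\<^sup>2" using sum_squares_bound[of 1 ?v] by simp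
      then have "2 * ?v / (1 + ?v\<^sup>2) \<le> 1" by (simp add: divide_le_eq add_pos_nonneg)
      then show "vnorm n m (?Q w) \<le> 1" by (simp add: abs_of_nonneg)
    qed simp
    ultimately have Q: "euc_plot ?N ?D ?N ?U ?Q" using U by (auto simp: euc_plot_def)
    have v1: "vnorm n m w \<le> 1" if "w \<in> ?R" for w using fat_disk_vnorm_ge that by auto
    have den: "1 + sqrt (1 - (vnorm n m w)\<^sup>2) > 0" if "w \<in> ?R" for w
    proof -
      have "sqrt (1 - (vnorm n m w)\<^sup>2) \<ge> 0" using v1[OF that] by (simp add: power_le_one)
      then show ?thesis by linarith
    qed
    have "continuous_on ?R ?\<sigma>"
      by (intro continuous_on_scale_uv continuous_intros continuous_on_vnorm) (use den in force)
    moreover have "?\<sigma> ` ?R \<subseteq> ?U" by auto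
    moreover have "?Q (?\<sigma> w) = w" if w: "w \<in> ?R" for w
    proof -
      let ?a = "1 / (1 + sqrt (1 - (vnorm n m w)\<^sup>2))"
      have "?Q (?\<sigma> w) = scale_uv n m 1 (2 / (1 + (\<bar>?a\<bar> * vnorm n m w)\<^sup>2) * ?a) w" by simp
      also have "\<bar>?a\<bar> = ?a" using den[OF w] by simp
      also have "2 / (1 + (?a * vnorm n m w)\<^sup>2) * ?a = 1" using half_angle v1[OF w] by simp
      also have "scale_uv n m 1 1 w = w" using w fat_disk_euc by (intro scale_uv_1) auto
      finally show ?thesis .
    qed
    moreover have "openin (top_of_set ?D) ?R" using op[OF continuous_on_unorm open_lessThan, of n "1/2"] by simp
    ultimately show ?goal using x A Q
      by (intro exI[of _ ?R] exI[of _ ?N] exI[of _ ?U] exI[of _ ?Q] exI[of _ ?\<sigma>] conjI ballI) auto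
  next
    case B
    let ?\<tau> = "\<lambda>w. 2 - unorm n w - vnorm n m w"
    let ?r = "\<lambda>w. 1 - phi (?\<tau> w) + (w ?N)\<^sup>2"
    \<comment> \<open>The new norm of \<open>v\<close> preserves \<open>|u| + |v|\<close> and hence
      \<tau>, so the disk inequality for the image reduces to \<open>t^2 >= 0\<close>.\<close>
    let ?q = "\<lambda>w. unorm n w + vnorm n m w - ?r w"
    let ?V = "{w\<in>euc (Suc ?N). min (unorm n w) (vnorm n m w) > 0}"
    let ?U = "{w\<in>?V. min (?r w) (?q w) > 0}"
    let ?R = "{w\<in>?D. min (unorm n w) (vnorm n m w) > 0}"
    let ?Q = "\<lambda>w. scale_uv n m (?r w / unorm n w) (?q w / vnorm n m w) w"
    \<comment> \<open>Solves \<open>?r = |u|\<close> for the additional coordinate; the radicand is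
      nonnegative because \<open>w\<close> lies in the disk.\<close>
    let ?\<sigma> = "\<lambda>w. w(?N := sqrt (unorm n w - 1 + phi (?\<tau> w)))"
    have V: "open_euc (Suc ?N) ?V"
      using open_euc_vimage[OF open_euc_euc continuous_on_min[OF continuous_on_unorm continuous_on_vnorm]
          open_greaterThan, of "Suc ?N" n n m 0] by simp
    have su: "smooth_fun (Suc ?N) ?V (unorm n)" "smooth_fun (Suc ?N) ?V (vnorm n m)"
      by (rule smooth_unorm[OF V] smooth_vnorm[OF V]; simp)+
    have st: "smooth_fun (Suc ?N) ?V ?\<tau>" by (intro smooth_diff smooth_const su V)
    have sr: "smooth_fun (Suc ?N) ?V ?r"
      by (intro smooth_add smooth_diff smooth_power2 smooth_coord smooth_const V
          smooth_compose1[OF V st smooth1_phi]) simp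
    have sq: "smooth_fun (Suc ?N) ?V ?q" by (intro smooth_add smooth_diff su sr V)
    have U: "open_euc (Suc ?N) ?U"
      using open_euc_vimage[OF V continuous_on_min[OF smooth_continuous[OF V sr] smooth_continuous[OF V sq]]
          open_greaterThan, of 0] by simp
    have VU: "smooth_fun (Suc ?N) ?U f" if "smooth_fun (Suc ?N) ?V f" for f
      by (rule smooth_subset[OF V U _ that]) auto
    have "smooth_map (Suc ?N) ?U ?N ?Q"
      by (intro smooth_map_scale_uv U smooth_divide VU su sr sq) auto
    moreover have "?Q w \<in> ?D" if w: "w \<in> ?U" for w
    proof -
      have u: "unorm n (?Q w) = ?r w" using w by (simp add: abs_of_pos)
      have v: "vnorm n m (?Q w) = ?q w" using w by (simp add: abs_of_pos)
      have e: "2 - ?r w - ?q w = ?\<tau> w" by simp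
      have "unorm n (?Q w) \<ge> 1 - phi (2 - unorm n (?Q w) - vnorm n m (?Q w))"
        unfolding u v e by simp
      then show ?thesis unfolding fat_disk_def by (simp only: mem_Collect_eq scale_uv_euc simp_thms)
    qed
    ultimately have Q: "euc_plot ?N ?D (Suc ?N) ?U ?Q" using U by (auto simp: euc_plot_def)
    have cphi: "continuous_on UNIV phi" using smooth1_phi Ck1_continuous unfolding smooth1_def by blast
    have c\<tau>: "continuous_on ?R ?\<tau>" by (intro continuous_intros continuous_on_unorm continuous_on_vnorm)
    have "continuous_on ?R ?\<sigma>"
      by (intro continuous_on_upd continuous_on_id continuous_intros continuous_on_unorm
          continuous_on_compose2[OF cphi c\<tau>]) auto
    moreover have r\<sigma>: "?r (?\<sigma> w) = unorm n w" if "w \<in> ?R" for w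
      using that by (simp add: fat_disk_def)
    have "?\<sigma> ` ?R \<subseteq> ?U"
    proof
      fix z assume "z \<in> ?\<sigma> ` ?R"
      then obtain w where w: "w \<in> ?R" "z = ?\<sigma> w" by blast
      have "z \<in> ?V" using w fat_disk_euc[of n m] by (auto simp: euc_def subset_iff)
      moreover have "?r z = unorm n w" using r\<sigma>[OF w(1)] w(2) by simp
      moreover from this have "?q z = vnorm n m w" using w(2) by simp
      ultimately show "z \<in> ?U" using w(1) by simp
    qed
    moreover have "?Q (?\<sigma> w) = w" if w: "w \<in> ?R" for w
    proof -
      have "?q (?\<sigma> w) = vnorm n m w" using r\<sigma>[OF w] by simp
      then have "?Q (?\<sigma> w) = scale_uv n m (unorm n w / unorm n w) (vnorm n m w / vnorm n m w) w"
        unfolding r\<sigma>[OF w] by simp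
      also have "\<dots> = w" using w fat_disk_euc by (auto intro!: scale_uv_1)
      finally show ?thesis .
    qed
    moreover have "openin (top_of_set ?D) ?R"
      using op[OF continuous_on_min[OF continuous_on_unorm continuous_on_vnorm] open_greaterThan, of n n m 0] by simp
    ultimately show ?goal using x B Q
      by (intro exI[of _ ?R] exI[of _ "Suc ?N"] exI[of _ ?U] exI[of _ ?Q] exI[of _ ?\<sigma>] conjI ballI) auto
  qed
qed (use assms in \<open>auto simp: D_open_euc_plot_iff\<close>)

section \<open>Extension over a single cell\<close>

definition bump_family :: "nat \<Rightarrow> (nat \<Rightarrow> real) set \<Rightarrow> (real \<Rightarrow> (nat \<Rightarrow> real) \<Rightarrow> 'u \<Rightarrow> bool) \<Rightarrow>
    (nat \<Rightarrow> (nat \<Rightarrow> real) \<Rightarrow> real) \<Rightarrow> (nat \<Rightarrow> 'u) \<Rightarrow> bool" where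
  "bump_family N T Pr b u \<longleftrightarrow> (\<forall>p. smooth_fun N (euc N) (b p)) \<and>
    (\<forall>p. (\<forall>y. b p y = -1) \<or>
      (\<exists>x\<in>T. \<exists>e>0. Pr e x (u p) \<and> (\<forall>y. edist N x y \<ge> e \<longrightarrow> b p y = -1))) \<and>
    (\<forall>y\<in>T. \<exists>p. b p y > 0)"

lemma bump_sequence:
  assumes T: "T \<subseteq> euc N" and Pr: "\<forall>x\<in>T. \<exists>e>0. \<exists>u. Pr e x u"
  obtains b u where "bump_family N T Pr b u"
proof -
  have "\<forall>x. \<exists>e u. x \<in> T \<longrightarrow> e > 0 \<and> Pr e x u" using Pr by blast
  then obtain e u where eu: "\<And>x. x \<in> T \<Longrightarrow> e x > 0 \<and> Pr (e x) x (u x)" by metis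
  \<comment> \<open>Scaled to take the value 1 at the centre and -1 outside the ball of radius
    \<open>e x\<close>.\<close>
  define B where "B = (\<lambda>x y. 2 * ell ((e x)\<^sup>2 - (\<Sum>i<N. (x i - y i)\<^sup>2)) / ell ((e x)\<^sup>2) - 1)"
  have smooth: "smooth_fun N (euc N) (B x)" for x
  proof -
    have "smooth_fun N (euc N) (\<lambda>y. ell ((e x)\<^sup>2 - (\<Sum>i<N. (x i - y i)\<^sup>2)))"
      by (rule smooth_compose1[OF open_euc_euc _ smooth1_ell])
        (intro smooth_diff smooth_sum smooth_power2 smooth_const smooth_coord open_euc_euc, simp)
    then have "smooth_fun N (euc N) (\<lambda>y. (2 / ell ((e x)\<^sup>2)) * ell ((e x)\<^sup>2 - (\<Sum>i<N. (x i - y i)\<^sup>2)) - 1)"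
      by (intro smooth_diff smooth_mult smooth_const open_euc_euc)
    then show ?thesis by (simp add: B_def)
  qed
  have outside: "B x y = -1" if "x \<in> T" "edist N x y \<ge> e x" for x y
  proof -
    have "(e x)\<^sup>2 \<le> (edist N x y)\<^sup>2" using that eu[OF that(1)] by (intro power_mono) auto
    also have "\<dots> = (\<Sum>i<N. (x i - y i)\<^sup>2)" by (simp add: edist_def sum_nonneg)
    finally show ?thesis by (simp add: B_def)
  qed
  have center: "B x x > 0" if "x \<in> T" for x
  proof -
    have "ell ((e x)\<^sup>2) > 0" using eu[OF that] by simp
    then show ?thesis by (simp add: B_def)
  qed
  define S where "S = (\<lambda>x. {y\<in>T. B x y > 0})"
  have op: "openin (top_of_set T) (S x)" for x
  proof -
    have "continuous_on T (B x)"
      using smooth_continuous[OF open_euc_euc smooth] T continuous_on_subset by blast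
    from continuous_openin_preimage_gen[OF this open_greaterThan, of 0] show ?thesis
      by (simp add: S_def vimage_def Int_def)
  qed
  \<comment> \<open>The sets where a bump is positive cover \<open>T\<close>; by Lindelof countably
    many of them suffice.\<close>
  have "\<exists>F. F \<subseteq> S ` T \<and> countable F \<and> \<Union>F = \<Union>(S ` T)"
  proof (rule Lindelof_openin[of "S ` T" T])
    show "openin (top_of_set T) W" if "W \<in> S ` T" for W using that op by auto
  next
    fix F assume "F \<subseteq> S ` T" "countable F" "\<Union>F = \<Union>(S ` T)"
    then show "\<exists>F. F \<subseteq> S ` T \<and> countable F \<and> \<Union>F = \<Union>(S ` T)" by (intro exI conjI)
  qed
  then obtain F where F: "F \<subseteq> S ` T" "countable F" "\<Union>F = \<Union>(S ` T)"
    by (elim exE conjE) (rule that)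
  have "countable F \<and> F \<subseteq> S ` T" using F(1,2) by simp
  then obtain C where C: "countable C" "C \<subseteq> T" "F = S ` C"
    unfolding countable_subset_image by (elim exE conjE) (rule that)
  have cov: "\<exists>x\<in>C. B x y > 0" if "y \<in> T" for y
  proof -
    have "y \<in> \<Union>(S ` T)" using that center by (auto simp: S_def)
    then show ?thesis using F(3) C(3) by (auto simp: S_def)
  qed
  show ?thesis
  proof (cases "C = {}")
    case True
    then have "T = {}" using cov by blast
    then show ?thesis
      by (intro that[of "\<lambda>_ _. -1" "\<lambda>_. undefined"]) (auto simp: bump_family_def intro: smooth_const)
  next
    case False
    define c where "c = from_nat_into C"
    have c: "c p \<in> T" for p using from_nat_into[OF False] C(2) by (auto simp: c_def)
    show ?thesis
    proof (rule that[of "\<lambda>p. B (c p)" "\<lambda>p. u (c p)"], unfold bump_family_def, intro conjI)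
      show "\<forall>y\<in>T. \<exists>p. B (c p) y > 0"
        using cov from_nat_into_surj[OF C(1)] unfolding c_def by metis
      show "\<forall>p. (\<forall>y. B (c p) y = -1) \<or> (\<exists>x\<in>T. \<exists>e>0. Pr e x (u (c p)) \<and> (\<forall>y. edist N x y \<ge> e \<longrightarrow> B (c p) y = -1))"
        using c eu outside by blast
    qed (use smooth in auto)
  qed
qed

lemma openin_ball_euc:
  assumes "openin (top_of_set D) W" "x \<in> W" "D \<subseteq> euc N"
  obtains e where "e > 0" "\<forall>y\<in>D. edist N x y < e \<longrightarrow> y \<in> W"
proof -
  obtain e where e: "e > 0" "\<forall>y\<in>D. dist y x < e \<longrightarrow> y \<in> W"
    using assms(1,2) unfolding openin_euclidean_subtopology_iff by blast
  have x: "x \<in> euc N" using assms openin_imp_subset by blast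
  have "y \<in> W" if y: "y \<in> D" "edist N x y < e / 2" for y
  proof -
    have "dist x y \<le> 2 * edist N x y" using x y assms(3) by (intro dist_le_edist) auto
    then show ?thesis using e(2) y by (simp add: dist_commute)
  qed
  then show ?thesis using e(1) by (intro that[of "e/2"]) auto
qed

lemma smooth_real_restrict:
  assumes E: "smooth_fun N (euc N) E" and D: "D \<subseteq> euc N"
  shows "smooth_real (euc_plot N D) E"
  unfolding smooth_real_def comp_def
proof (intro allI impI)
  fix k U Q assume Q: "euc_plot N D k U Q"
  then have "open_euc k U" "smooth_map k U N Q" "Q ` U \<subseteq> euc N" using D by (auto simp: euc_plot_def)
  then show "smooth_fun k U (\<lambda>u. E (Q u))" by (intro smooth_compose[OF open_euc_euc _ _ _ E])
qed

text \<open>Balls are available since D-open subsets of the disk are open in the subspace topology.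
  Each bump has a single label, so the disjoint sets of the criterion are \<open>u p\<close> at
  \<open>U = u p\<close> and empty at all other members.\<close>

lemma disk_partition_of_unity:
  fixes \<U> :: "(nat \<Rightarrow> real) set set"
  assumes op: "\<And>U. U \<in> \<U> \<Longrightarrow> D_open (fat_disk n m) (euc_plot (n + m) (fat_disk n m)) U"
    and cov: "\<Union>\<U> = fat_disk n m"
  shows "\<exists>\<rho>. subordinate_partition (fat_disk n m) (euc_plot (n + m) (fat_disk n m)) \<U> \<rho>"
proof -
  let ?D = "fat_disk n m" and ?N = "n + m"
  interpret plot_space ?D "euc_plot ?N ?D" by (rule plot_space_euc)
  define Pr where "Pr = (\<lambda>e x U. U \<in> \<U> \<and> (\<forall>y\<in>?D. edist ?N x y < e \<longrightarrow> y \<in> U))"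
  have Prex: "\<forall>x\<in>?D. \<exists>e>0. \<exists>U. Pr e x U"
  proof
    fix x assume x: "x \<in> ?D"
    obtain U where U: "U \<in> \<U>" "x \<in> U" using x cov by blast
    have "openin (top_of_set ?D) U" by (rule disk_D_open_imp_openin[OF op[OF U(1)]])
    then obtain e where "e > 0" "\<forall>y\<in>?D. edist ?N x y < e \<longrightarrow> y \<in> U"
      using openin_ball_euc[OF _ U(2) fat_disk_euc] by blast
    then show "\<exists>e>0. \<exists>U. Pr e x U" using U(1) unfolding Pr_def by blast
  qed
  obtain b u where "bump_family ?N ?D Pr b u"
    using bump_sequence[OF fat_disk_euc Prex] .
  note b = this[unfolded bump_family_def, THEN conjunct1]
    this[unfolded bump_family_def, THEN conjunct2, THEN conjunct1]
    this[unfolded bump_family_def, THEN conjunct2, THEN conjunct2]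
  have in_u: "u p \<in> \<U> \<and> y \<in> u p" if y: "y \<in> ?D" "b p y \<ge> 0" for p y
  proof -
    have "b p y \<noteq> -1" using y by simp
    then obtain x e where "Pr e x (u p)" "edist ?N x y < e" using b(2) by (metis not_le)
    then show ?thesis using y by (auto simp: Pr_def)
  qed
  have "D_open ?D (euc_plot ?N ?D) {}" using D_open_Union[of "{}"] by simp
  then show ?thesis
    using op b(1,3) in_u
    by (intro partition_of_unity_countable[where F=b and Y="\<lambda>p U. if U = u p then U else {}"])
      (auto intro: smooth_real_restrict[OF _ fat_disk_euc])
qed

lemma D_support_superset: "x \<in> X \<Longrightarrow> f x \<noteq> 0 \<Longrightarrow> x \<in> D_support X Pl f"
  unfolding D_support_def D_closure_def by blast

lemma fat_sphere_subset_disk: "fat_sphere n m \<subseteq> fat_disk n m"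
proof
  fix w assume w: "w \<in> fat_sphere n m"
  have "phi s \<ge> 0" for s
    using lamint_mono[of "min 0 (1/2 + s)" "1/2 + s"] lamint_nonpos[of "min 0 (1/2 + s)"]
    by (simp add: phi_lamint)
  then show "w \<in> fat_disk n m" using w by (auto simp: fat_sphere_def fat_disk_def intro: order_trans[of _ 1])
qed

text \<open>With \<open>E\<close> any smooth extension of \<open>f\<close>, blend it with the constant \<open>-1\<close> away from the sphere.\<close>

lemma cell_extension:
  assumes f: "\<forall>k U Q. euc_plot (n + m) (fat_sphere n m) k U Q \<longrightarrow> smooth_fun k U (\<lambda>u. f (Q u))"
    and V: "D_open (fat_disk n m) (euc_plot (n + m) (fat_disk n m)) V"
    and sub: "\<forall>s\<in>fat_sphere n m. f s \<ge> 0 \<longrightarrow> s \<in> V"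
  obtains g where "smooth_real (euc_plot (n + m) (fat_disk n m)) g"
    and "\<forall>s\<in>fat_sphere n m. g s = f s" and "\<forall>x\<in>fat_disk n m. g x \<ge> 0 \<longrightarrow> x \<in> V"
proof -
  let ?D = "fat_disk n m" and ?S = "fat_sphere n m" and ?N = "n + m"
  let ?Pl = "euc_plot ?N ?D"
  interpret plot_space ?D ?Pl by (rule plot_space_euc)
  obtain E where E0: "smooth_fun ?N (euc ?N) E" "\<forall>w\<in>?S. E w = f w"
    using sphere_extension[of n m f] f by blast
  have E: "smooth_real ?Pl E" by (rule smooth_real_restrict[OF E0(1) fat_disk_euc])
  define U1 where "U1 = ?D - ?S"
  \<comment> \<open>On this set \<open>E >= 0\<close> implies membership in \<open>V\<close>, so
    \<open>E\<close> may be used there; outside of it the blend must equal -1. It contains the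
    sphere by the hypothesis on \<open>f\<close>.\<close>
  define U2 where "U2 = {x\<in>?D. E x < 0} \<union> V"
  have "U1 = {x\<in>?D. unorm n x \<in> {..<1}}"
    by (auto simp: U1_def fat_sphere_def fat_disk_def)
  then have o1: "D_open ?D ?Pl U1"
    using openin_imp_D_open continuous_openin_preimage_gen[OF continuous_on_unorm open_lessThan, of ?D n 1]
    by (simp add: vimage_def Int_def)
  have "D_open ?D ?Pl {x\<in>?D. E x \<in> {..<0}}" by (rule D_open_vimage[OF E open_lessThan])
  then have "D_open ?D ?Pl (\<Union>{{x\<in>?D. E x < 0}, V})" using V by (intro D_open_Union) auto
  then have o2: "D_open ?D ?Pl U2" by (simp add: U2_def)
  have S2: "?S \<subseteq> U2"
    using sub E0(2) fat_sphere_subset_disk[of n m] by (force simp: U2_def not_less)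
  have cv: "\<Union>{U1, U2} = ?D" using S2 D_open_subset[OF o2] by (auto simp: U1_def)
  have op: "D_open ?D ?Pl U" if "U \<in> {U1, U2}" for U using that o1 o2 by auto
  obtain \<rho> where part: "subordinate_partition ?D ?Pl {U1, U2} \<rho>"
    using disk_partition_of_unity[OF op cv] by blast
  note \<rho> = part[unfolded subordinate_partition_def, THEN conjunct1]
    part[unfolded subordinate_partition_def, THEN conjunct2, THEN conjunct1]
    part[unfolded subordinate_partition_def, THEN conjunct2, THEN conjunct2, THEN conjunct1]
    part[unfolded subordinate_partition_def, THEN conjunct2, THEN conjunct2, THEN conjunct2, THEN conjunct2]
  let ?\<theta> = "\<rho> U2"
  have \<theta>0: "?\<theta> x = 0" if "x \<in> ?D" "x \<notin> U2" for x
    using \<rho>(3) D_support_superset[of x ?D ?\<theta> ?Pl] that by blast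
  have \<theta>1: "?\<theta> x = 1" if x: "x \<in> ?S" for x
  proof -
    have xD: "x \<in> ?D" using x fat_sphere_subset_disk by blast
    have "\<rho> U1 x = 0" using \<rho>(3) D_support_superset[of x ?D "\<rho> U1" ?Pl] xD x by (auto simp: U1_def)
    then have sub2: "{U\<in>{U1, U2}. \<rho> U x \<noteq> 0} \<subseteq> {U2}" by auto
    have "(\<Sum>U\<in>{U\<in>{U1, U2}. \<rho> U x \<noteq> 0}. \<rho> U x) = (\<Sum>U\<in>{U2}. \<rho> U x)"
      by (rule sum.mono_neutral_left[OF _ sub2]) auto
    then show ?thesis using \<rho>(4) xD by simp
  qed
  \<comment> \<open>A nonnegative value forces \<theta> > 0, hence a point of \<open>U2\<close>, and
    also \<open>E >= 0\<close>; this leaves only \<open>V\<close>.\<close>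
  define g where "g = (\<lambda>x. ?\<theta> x * E x - (1 - ?\<theta> x))"
  have g: "smooth_real ?Pl g"
    unfolding g_def using \<rho>(1) E by (intro smooth_real_diff smooth_real_mult smooth_real_const) auto
  have gV: "x \<in> V" if x: "x \<in> ?D" "g x \<ge> 0" for x
  proof -
    have t: "0 \<le> ?\<theta> x" "?\<theta> x \<le> 1" using \<rho>(2) x by auto
    have "?\<theta> x \<noteq> 0" using x by (auto simp: g_def)
    then have "x \<in> U2" "?\<theta> x > 0" using \<theta>0 x t by force+
    moreover from this have "E x \<ge> 0" using x t by (simp add: g_def) (smt (verit) mult_pos_neg)
    ultimately show ?thesis by (auto simp: U2_def)
  qed
  show ?thesis by (rule that[OF g]) (use \<theta>1 E0(2) gV in \<open>auto simp: g_def\<close>)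
qed

text \<open>Disjoint open subsets of a subspace are enlarged to disjoint open sets by balls of half the
  distance to the complement.\<close>

lemma label_extension:
  fixes S D :: "'x::metric_space set" and L :: "'x \<Rightarrow> 'j option"
  assumes op: "\<And>j. openin (top_of_set S) {s\<in>S. L s = Some j}"
  obtains L' where "\<forall>s\<in>S. L' s = L s" "\<forall>j. openin (top_of_set D) {x\<in>D. L' x = Some j}"
proof -
  \<comment> \<open>The label is constant on the part of \<open>S\<close> in a ball of twice the
    radius used. Two balls with a common point have centres at distance less than
    \<open>r + s\<close>, at most twice the larger radius, so one centre lies in the doubled ball of
    the other and the labels agree.\<close>
  define good where "good = (\<lambda>x j. \<exists>a\<in>S. \<exists>r>0. L a = Some j \<and> (\<forall>z\<in>S. dist a z < 2 * r \<longrightarrow> L z = Some j) \<and> dist x a < r)"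
  have uniq: "j = k" if gj: "good x j" and gk: "good x k" for x j k
  proof -
    obtain a r where a: "a \<in> S" "L a = Some j" "\<forall>z\<in>S. dist a z < 2 * r \<longrightarrow> L z = Some j" "dist x a < r"
      using gj unfolding good_def by blast
    obtain b s where b: "b \<in> S" "L b = Some k" "\<forall>z\<in>S. dist b z < 2 * s \<longrightarrow> L z = Some k" "dist x b < s"
      using gk unfolding good_def by blast
    have ab: "dist a b < r + s" using dist_triangle3[of a b x] a(4) b(4) by linarith
    show ?thesis
    proof (cases "s \<le> r")
      case True
      then have "L b = Some j" using a(3) b(1) ab by simp
      then show ?thesis using b(2) by simp
    next
      case False
      then have "L a = Some k" using b(3) a(1) ab by (simp add: dist_commute)
      then show ?thesis using a(2) by simp
    qed
  qed
  define L' where "L' = (\<lambda>x. if \<exists>j. good x j then Some (THE j. good x j) else None)"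
  have L': "L' x = Some j \<longleftrightarrow> good x j" for x j
  proof
    assume "good x j"
    moreover from this have "(THE j. good x j) = j" using uniq by blast
    ultimately show "L' x = Some j" by (auto simp: L'_def)
  next
    assume l: "L' x = Some j"
    then obtain k where k: "good x k" by (auto simp: L'_def split: if_splits)
    then have "(THE j. good x j) = k" using uniq by blast
    then show "good x j" using l k by (auto simp: L'_def split: if_splits)
  qed
  have "L' s = Some j \<longleftrightarrow> L s = Some j" if s: "s \<in> S" for s j
    unfolding L'
  proof
    assume "good s j"
    then obtain a r where a: "r > 0" "\<forall>z\<in>S. dist a z < 2 * r \<longrightarrow> L z = Some j" "dist s a < r"
      unfolding good_def by blast
    then have "dist a s < 2 * r" by (simp add: dist_commute)
    then show "L s = Some j" using a(2) s by blast
  next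
    assume l: "L s = Some j"
    then obtain e where e: "e > 0" "\<forall>z\<in>S. dist z s < e \<longrightarrow> z \<in> {s\<in>S. L s = Some j}"
      using op[of j] s unfolding openin_euclidean_subtopology_iff by blast
    show "good s j" unfolding good_def
      by (rule bexI[OF _ s], rule exI[of _ "e/2"]) (use e l in \<open>auto simp: dist_commute\<close>)
  qed
  then have 1: "\<forall>s\<in>S. L' s = L s" by (metis not_Some_eq)
  have 2: "openin (top_of_set D) {x\<in>D. L' x = Some j}" for j
    unfolding openin_euclidean_subtopology_iff
  proof (intro conjI ballI)
    fix x assume "x \<in> {x\<in>D. L' x = Some j}"
    then obtain a r where a: "a \<in> S" "r > 0" "L a = Some j" "\<forall>z\<in>S. dist a z < 2 * r \<longrightarrow> L z = Some j" "dist x a < r"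
      unfolding L' good_def by blast
    have "y \<in> {x\<in>D. L' x = Some j}" if y: "y \<in> D" "dist y x < r - dist x a" for y
    proof -
      have "dist y a < r" using dist_triangle[of y a x] y(2) by linarith
      then show ?thesis using a y(1) unfolding L' good_def by blast
    qed
    then show "\<exists>e>0. \<forall>x'\<in>D. dist x' x < e \<longrightarrow> x' \<in> {x\<in>D. L' x = Some j}"
      using a(5) by (intro exI[of _ "r - dist x a"]) auto
  qed auto
  show ?thesis using that 1 2 by blast
qed

section \<open>Extension over the skeleta\<close>

lemma open_euc_locally:
  assumes U: "open_euc k U"
    and loc: "\<And>u. u \<in> U \<Longrightarrow> \<exists>V. open_euc k V \<and> u \<in> V \<and> V \<subseteq> U \<and> open_euc k {v\<in>V. R v}"
  shows "open_euc k {u\<in>U. R u}"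
proof (rule open_euc_local)
  fix u assume u: "u \<in> {u\<in>U. R u}"
  then obtain V where "open_euc k V" "u \<in> V" "V \<subseteq> U" "open_euc k {v\<in>V. R v}" using loc[of u] by blast
  then show "\<exists>V. open_euc k V \<and> u \<in> V \<and> V \<subseteq> {u\<in>U. R u}"
    using u by (intro exI[of _ "{v\<in>V. R v}"]) auto
qed

text \<open>\<open>fat_CW\<close> asserts only that characteristic maps exist at each level; here a
  choice \<open>chi\<close> for all levels is fixed.\<close>

locale fat_cw_complex =
  fixes X :: "'a set" and Pl :: "'a plots"
    and Sk :: "nat \<Rightarrow> 'a set" and J :: "nat \<Rightarrow> 'j set" and m :: "nat \<Rightarrow> 'j \<Rightarrow> nat"
    and h chi :: "nat \<Rightarrow> 'j \<Rightarrow> (nat \<Rightarrow> real) \<Rightarrow> 'a"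
  assumes diff: "diffeology X Pl"
    and pushout: "\<And>n. pushout_cond X Pl n (prev_skel Sk n) (Sk n) (J n) (m n) (h n) (chi n)"
    and X_eq: "X = (\<Union>n. Sk n)"
    and colim: "\<And>k U P u. Pl k U P \<Longrightarrow> u \<in> U \<Longrightarrow>
      \<exists>V n. open_euc k V \<and> u \<in> V \<and> V \<subseteq> U \<and> P ` V \<subseteq> Sk n"

sublocale fat_cw_complex \<subseteq> plot_space X Pl
  using diff[unfolded diffeology_def, THEN conjunct1] by unfold_locales blast+

context fat_cw_complex
begin

abbreviation "disk n j \<equiv> fat_disk n (m n j)"
abbreviation "sph n j \<equiv> fat_sphere n (m n j)"
abbreviation "dplot n j \<equiv> euc_plot (n + m n j) (disk n j)"
abbreviation "splot n j \<equiv> euc_plot (n + m n j) (sph n j)"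

lemmas pushout_parts =
  pushout[unfolded pushout_cond_def, THEN conjunct1]
  pushout[unfolded pushout_cond_def, THEN conjunct2, THEN conjunct1]
  pushout[unfolded pushout_cond_def, THEN conjunct2, THEN conjunct2, THEN conjunct1]
  pushout[unfolded pushout_cond_def, THEN conjunct2, THEN conjunct2, THEN conjunct2, THEN conjunct1]
  pushout[unfolded pushout_cond_def, THEN conjunct2, THEN conjunct2, THEN conjunct2, THEN conjunct2, THEN conjunct1]
  pushout[unfolded pushout_cond_def, THEN conjunct2, THEN conjunct2, THEN conjunct2, THEN conjunct2, THEN conjunct2, THEN conjunct1]
  pushout[unfolded pushout_cond_def, THEN conjunct2, THEN conjunct2, THEN conjunct2, THEN conjunct2, THEN conjunct2, THEN conjunct2, THEN conjunct1]
  pushout[unfolded pushout_cond_def, THEN conjunct2, THEN conjunct2, THEN conjunct2, THEN conjunct2, THEN conjunct2, THEN conjunct2, THEN conjunct2, THEN conjunct1]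
  pushout[unfolded pushout_cond_def, THEN conjunct2, THEN conjunct2, THEN conjunct2, THEN conjunct2, THEN conjunct2, THEN conjunct2, THEN conjunct2, THEN conjunct2]

lemma prev_subset: "prev_skel Sk n \<subseteq> Sk n"
  by (rule pushout_parts(1))

lemma prev_0: "prev_skel Sk 0 = {}" and prev_Suc: "prev_skel Sk (Suc n) = Sk n"
  by (simp_all add: prev_skel_def)

lemma Sk_mono: "i \<le> n \<Longrightarrow> Sk i \<subseteq> Sk n"
proof (induction n)
  case (Suc n)
  then show ?case using prev_subset[of "Suc n"] by (auto simp: prev_skel_def le_Suc_eq)
qed simp

lemma attach_mem: "j \<in> J n \<Longrightarrow> s \<in> sph n j \<Longrightarrow> h n j s \<in> prev_skel Sk n"
  using pushout_parts(3) by blast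

lemma attach_plot: "j \<in> J n \<Longrightarrow> splot n j k U Q \<Longrightarrow> subset_plot Pl (prev_skel Sk n) k U (h n j \<circ> Q)"
  using pushout_parts(4) by blast

lemma chi_sphere: "j \<in> J n \<Longrightarrow> s \<in> sph n j \<Longrightarrow> chi n j s = h n j s"
  using pushout_parts(5) by blast

lemma Sk_eq: "Sk n = prev_skel Sk n \<union> (\<Union>j\<in>J n. chi n j ` disk n j)"
  by (rule pushout_parts(6))

lemma chi_inj: "j \<in> J n \<Longrightarrow> j' \<in> J n \<Longrightarrow> x \<in> disk n j - sph n j \<Longrightarrow> y \<in> disk n j' - sph n j' \<Longrightarrow>
    chi n j x = chi n j' y \<Longrightarrow> j = j' \<and> x = y"
  by (rule pushout_parts(7)[rule_format])

lemma chi_notin: "j \<in> J n \<Longrightarrow> x \<in> disk n j - sph n j \<Longrightarrow> chi n j x \<notin> prev_skel Sk n"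
  by (rule pushout_parts(8)[rule_format])

lemma skel_plot_iff: "open_euc k U \<Longrightarrow> subset_plot Pl (Sk n) k U P \<longleftrightarrow>
    P ` U \<subseteq> Sk n \<and> (\<forall>u\<in>U. \<exists>V. open_euc k V \<and> u \<in> V \<and> V \<subseteq> U \<and>
      (subset_plot Pl (prev_skel Sk n) k V P \<or>
        (\<exists>j\<in>J n. \<exists>Q. dplot n j k V Q \<and> (\<forall>x\<in>V. P x = chi n j (Q x)))))"
  by (rule pushout_parts(9)[THEN spec, THEN spec, THEN spec, THEN mp])

lemma chi_mem: "j \<in> J n \<Longrightarrow> y \<in> disk n j \<Longrightarrow> chi n j y \<in> Sk n"
  using Sk_eq[of n] by blast

lemma chi_plot:
  assumes j: "j \<in> J n" and Q: "dplot n j k U Q"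
  shows "Pl k U (\<lambda>u. chi n j (Q u))"
proof -
  have U: "open_euc k U" using Q by (simp add: euc_plot_def)
  have "Q ` U \<subseteq> disk n j" using Q by (simp add: euc_plot_def)
  then have "(\<lambda>u. chi n j (Q u)) ` U \<subseteq> Sk n" using chi_mem[OF j] by blast
  then have "subset_plot Pl (Sk n) k U (\<lambda>u. chi n j (Q u))"
    unfolding skel_plot_iff[OF U] using j Q U by blast
  then show ?thesis by (simp add: subset_plot_def)
qed

text \<open>Unfolds the pushout diffeology level by level. The descent ends at level 0, where the
  previous skeleton is empty and admits no plot whose domain contains \<open>u\<close>. Hence
  smoothness and openness can be tested on the maps \<open>chi i j\<close> alone.\<close>

lemma skel_plot_charts:
  "subset_plot Pl (Sk n) k U P \<Longrightarrow> u \<in> U \<Longrightarrow>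
    \<exists>V. open_euc k V \<and> u \<in> V \<and> V \<subseteq> U \<and>
      (\<exists>i\<le>n. \<exists>j\<in>J i. \<exists>Q. dplot i j k V Q \<and> (\<forall>x\<in>V. P x = chi i j (Q x)))"
proof (induction n arbitrary: U)
  case 0
  have U: "open_euc k U" using 0 plot_open by (auto simp: subset_plot_def)
  obtain V where V: "open_euc k V" "u \<in> V" "V \<subseteq> U" "subset_plot Pl {} k V P \<or>
        (\<exists>j\<in>J 0. \<exists>Q. dplot 0 j k V Q \<and> (\<forall>x\<in>V. P x = chi 0 j (Q x)))"
    using skel_plot_iff[OF U, THEN iffD1, OF 0(1), THEN conjunct2, THEN bspec, OF 0(2)] prev_0
    by (elim exE conjE) (rule that, simp_all)
  moreover have "\<not> subset_plot Pl {} k V P" using V(2) by (auto simp: subset_plot_def)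
  ultimately show ?case by blast
next
  case (Suc n)
  have U: "open_euc k U" using Suc.prems plot_open by (auto simp: subset_plot_def)
  obtain V where V: "open_euc k V" "u \<in> V" "V \<subseteq> U" "subset_plot Pl (Sk n) k V P \<or>
        (\<exists>j\<in>J (Suc n). \<exists>Q. dplot (Suc n) j k V Q \<and> (\<forall>x\<in>V. P x = chi (Suc n) j (Q x)))"
    using skel_plot_iff[OF U, THEN iffD1, OF Suc.prems(1), THEN conjunct2, THEN bspec, OF Suc.prems(2)] prev_Suc
    by (elim exE conjE) (rule that, simp_all)
  from V(4) show ?case
  proof
    assume "subset_plot Pl (Sk n) k V P"
    from Suc.IH[OF this V(2)] obtain V' i where "open_euc k V'" "u \<in> V'" "V' \<subseteq> V" "i \<le> n"
      "\<exists>j\<in>J i. \<exists>Q. dplot i j k V' Q \<and> (\<forall>x\<in>V'. P x = chi i j (Q x))" by blast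
    then show ?case using V(3) by (intro exI[of _ V'] conjI exI[of _ i]) auto
  next
    assume "\<exists>j\<in>J (Suc n). \<exists>Q. dplot (Suc n) j k V Q \<and> (\<forall>x\<in>V. P x = chi (Suc n) j (Q x))"
    then show ?case using V(1-3) by (intro exI[of _ V] conjI exI[of _ "Suc n"]) auto
  qed
qed

lemma plot_restrict:
  assumes P: "Pl k U P" and V: "open_euc k V" "V \<subseteq> U"
  shows "Pl k V P"
proof -
  have "Pl k V (P \<circ> (\<lambda>x. x))"
    by (rule diff[unfolded diffeology_def, THEN conjunct2, THEN conjunct2, THEN conjunct2, THEN conjunct2, rule_format,
          OF P V(1) smooth_map_id[OF V(1)]]) (use V(2) in simp)
  then show ?thesis by (simp add: comp_def)
qed

lemma plot_charts:
  assumes P: "Pl k U P" and u: "u \<in> U"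
  shows "\<exists>V. open_euc k V \<and> u \<in> V \<and> V \<subseteq> U \<and>
      (\<exists>i. \<exists>j\<in>J i. \<exists>Q. dplot i j k V Q \<and> (\<forall>x\<in>V. P x = chi i j (Q x)))"
proof -
  obtain V n where V: "open_euc k V" "u \<in> V" "V \<subseteq> U" "P ` V \<subseteq> Sk n" using colim[OF P u] by blast
  then have "subset_plot Pl (Sk n) k V P" using plot_restrict[OF P] by (simp add: subset_plot_def)
  from skel_plot_charts[OF this V(2)] V(3) show ?thesis by blast
qed

section \<open>Testing on the characteristic maps\<close>

definition smooth_upto :: "nat \<Rightarrow> ('a \<Rightarrow> real) \<Rightarrow> bool" where
  "smooth_upto n f \<longleftrightarrow> (\<forall>i\<le>n. \<forall>j\<in>J i. smooth_real (dplot i j) (\<lambda>y. f (chi i j y)))"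

text \<open>A family of pairwise disjoint sets indexed by labels is encoded as one function into an
  option type. Disjointness is then automatic, and the family is glued and extended in the same way
  as a real function.\<close>

definition open_upto :: "nat \<Rightarrow> ('a \<Rightarrow> 'c option) \<Rightarrow> bool" where
  "open_upto n L \<longleftrightarrow> (\<forall>i\<le>n. \<forall>j\<in>J i. \<forall>c. D_open (disk i j) (dplot i j) {y\<in>disk i j. L (chi i j y) = Some c})"

lemma smooth_via_chart:
  assumes "smooth_real (dplot i j) (\<lambda>y. f (chi i j y))" "dplot i j k V Q" "\<forall>x\<in>V. P x = chi i j (Q x)"
  shows "smooth_fun k V (\<lambda>u. f (P u))"
proof -
  have V: "open_euc k V" using assms(2) by (simp add: euc_plot_def)
  have "smooth_fun k V (\<lambda>u. f (chi i j (Q u)))"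
    using assms(1,2) unfolding smooth_real_def comp_def by blast
  then show ?thesis by (rule smooth_cong[OF V, rotated]) (use assms(3) in simp)
qed

lemma smooth_upto_plot:
  assumes f: "smooth_upto n f" and P: "subset_plot Pl (Sk n) k U P"
  shows "smooth_fun k U (\<lambda>u. f (P u))"
proof (rule smooth_local)
  show "open_euc k U" using P plot_open by (auto simp: subset_plot_def)
  fix u assume "u \<in> U"
  from skel_plot_charts[OF P this] obtain V i j Q where V: "open_euc k V" "u \<in> V" "V \<subseteq> U" "i \<le> n" "j \<in> J i"
    "dplot i j k V Q" "\<forall>x\<in>V. P x = chi i j (Q x)" by blast
  then have "smooth_fun k V (\<lambda>u. f (P u))"
    using f unfolding smooth_upto_def by (intro smooth_via_chart) auto
  then show "\<exists>V. open_euc k V \<and> u \<in> V \<and> V \<subseteq> U \<and> smooth_fun k V (\<lambda>u. f (P u))" using V by blast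
qed

lemma smooth_all:
  assumes "\<And>n. smooth_upto n f"
  shows "smooth_real Pl f"
proof (rule smooth_realI, rule smooth_local)
  fix k U P u assume P: "Pl k U P"
  then show "open_euc k U" by (rule plot_open)
  assume "u \<in> U"
  from plot_charts[OF P this] obtain V i j Q where V: "open_euc k V" "u \<in> V" "V \<subseteq> U" "j \<in> J i"
    "dplot i j k V Q" "\<forall>x\<in>V. P x = chi i j (Q x)" by blast
  then have "smooth_fun k V (\<lambda>u. f (P u))"
    using assms[of i] unfolding smooth_upto_def by (intro smooth_via_chart) auto
  then show "\<exists>V. open_euc k V \<and> u \<in> V \<and> V \<subseteq> U \<and> smooth_fun k V (\<lambda>u. f (P u))" using V by blast
qed

lemma open_via_chart:
  assumes "D_open (disk i j) (dplot i j) {y\<in>disk i j. L (chi i j y) = Some c}"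
    and Q: "dplot i j k V Q" "\<forall>x\<in>V. P x = chi i j (Q x)"
  shows "open_euc k {v\<in>V. L (P v) = Some c}"
proof -
  have "open_euc k {v\<in>V. Q v \<in> {y\<in>disk i j. L (chi i j y) = Some c}}"
    using assms(1) Q(1) unfolding D_open_def by blast
  moreover have "{v\<in>V. Q v \<in> {y\<in>disk i j. L (chi i j y) = Some c}} = {v\<in>V. L (P v) = Some c}"
    using Q by (auto simp: euc_plot_def image_subset_iff)
  ultimately show ?thesis by simp
qed

lemma open_upto_plot:
  assumes L: "open_upto n L" and P: "subset_plot Pl (Sk n) k U P"
  shows "open_euc k {u\<in>U. L (P u) = Some c}"
proof (rule open_euc_locally)
  show "open_euc k U" using P plot_open by (auto simp: subset_plot_def)
  fix u assume "u \<in> U"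
  from skel_plot_charts[OF P this] obtain V i j Q where V: "open_euc k V" "u \<in> V" "V \<subseteq> U" "i \<le> n" "j \<in> J i"
    "dplot i j k V Q" "\<forall>x\<in>V. P x = chi i j (Q x)" by blast
  then have "open_euc k {v\<in>V. L (P v) = Some c}"
    using L unfolding open_upto_def by (intro open_via_chart) auto
  then show "\<exists>V. open_euc k V \<and> u \<in> V \<and> V \<subseteq> U \<and> open_euc k {v\<in>V. L (P v) = Some c}" using V by blast
qed

lemma open_all:
  assumes "\<And>n. open_upto n L"
  shows "D_open X Pl {x\<in>X. L x = Some c}"
  unfolding D_open_def
proof (intro conjI allI impI)
  fix k U P assume P: "Pl k U P"
  have "open_euc k {u\<in>U. L (P u) = Some c}"
  proof (rule open_euc_locally)
    show "open_euc k U" using P by (rule plot_open)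
    fix u assume "u \<in> U"
    from plot_charts[OF P this] obtain V i j Q where V: "open_euc k V" "u \<in> V" "V \<subseteq> U" "j \<in> J i"
      "dplot i j k V Q" "\<forall>x\<in>V. P x = chi i j (Q x)" by blast
    then have "open_euc k {v\<in>V. L (P v) = Some c}"
      using assms[of i] unfolding open_upto_def by (intro open_via_chart) auto
    then show "\<exists>V. open_euc k V \<and> u \<in> V \<and> V \<subseteq> U \<and> open_euc k {v\<in>V. L (P v) = Some c}" using V by blast
  qed
  moreover have "{u\<in>U. P u \<in> {x\<in>X. L x = Some c}} = {u\<in>U. L (P u) = Some c}"
    using plot_image[OF P] by auto
  ultimately show "open_euc k {u\<in>U. P u \<in> {x\<in>X. L x = Some c}}" by simp
qed auto

lemma chi_vimage_open:
  assumes W: "D_open X Pl W" and j: "j \<in> J n"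
  shows "D_open (disk n j) (dplot n j) {y\<in>disk n j. chi n j y \<in> W}"
  unfolding D_open_def
proof (intro conjI allI impI)
  fix k U Q assume Q: "dplot n j k U Q"
  have "open_euc k {u\<in>U. chi n j (Q u) \<in> W}" by (rule D_openD[OF W chi_plot[OF j Q]])
  moreover have "{u\<in>U. Q u \<in> {y\<in>disk n j. chi n j y \<in> W}} = {u\<in>U. chi n j (Q u) \<in> W}"
    using Q by (auto simp: euc_plot_def)
  ultimately show "open_euc k {u\<in>U. Q u \<in> {y\<in>disk n j. chi n j y \<in> W}}" by simp
qed auto

text \<open>The universal property of the pushout for bare sets: open cells are embedded disjointly
  and miss the previous skeleton. The target type is arbitrary so as to cover real functions and
  labels; smoothness and openness are read off afterwards in the charts.\<close>

lemma glue:
  fixes \<phi> :: "'a \<Rightarrow> 'c"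
  assumes g: "\<And>j s. j \<in> J n \<Longrightarrow> s \<in> sph n j \<Longrightarrow> g j s = \<phi> (h n j s)"
  obtains \<psi> where "\<forall>x\<in>prev_skel Sk n. \<psi> x = \<phi> x" "\<forall>j\<in>J n. \<forall>y\<in>disk n j. \<psi> (chi n j y) = g j y"
proof -
  define \<psi> where "\<psi> = (\<lambda>x. if x \<in> prev_skel Sk n then \<phi> x else
    THE c. \<exists>j y. j \<in> J n \<and> y \<in> disk n j - sph n j \<and> chi n j y = x \<and> c = g j y)"
  have "\<psi> (chi n j y) = g j y" if j: "j \<in> J n" and y: "y \<in> disk n j" for j y
  proof (cases "y \<in> sph n j")
    case True
    then show ?thesis using chi_sphere[OF j True] attach_mem[OF j True] g[OF j True] by (simp add: \<psi>_def)
  next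
    case False
    have "(THE c. \<exists>j' y'. j' \<in> J n \<and> y' \<in> disk n j' - sph n j' \<and> chi n j' y' = chi n j y \<and> c = g j' y') = g j y"
    proof (rule the_equality)
      show "\<exists>j' y'. j' \<in> J n \<and> y' \<in> disk n j' - sph n j' \<and> chi n j' y' = chi n j y \<and> g j y = g j' y'"
        using j y False by blast
      fix c assume "\<exists>j' y'. j' \<in> J n \<and> y' \<in> disk n j' - sph n j' \<and> chi n j' y' = chi n j y \<and> c = g j' y'"
      then obtain j' y' where "j' \<in> J n" "y' \<in> disk n j' - sph n j'" "chi n j' y' = chi n j y" "c = g j' y'"
        by blast
      then show "c = g j y" using chi_inj[OF _ j _ _, of j' y' y] y False by blast
    qed
    then show ?thesis using chi_notin[OF j, of y] y False by (simp add: \<psi>_def)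
  qed
  then show ?thesis by (intro that[of \<psi>]) (auto simp: \<psi>_def)
qed

text \<open>Dependent choice gives successive extensions, which are eventually constant at each
  point of a skeleton. The limit agrees with stage \<open>k\<close> on \<open>Sk (n + k)\<close> and
  inherits \<Phi> from it by the assumption on congruence.\<close>

lemma extend_over_skeleta:
  fixes \<Phi> :: "nat \<Rightarrow> ('a \<Rightarrow> 'c) \<Rightarrow> bool"
  assumes start: "\<Phi> n \<phi>"
    and step: "\<forall>i \<phi>. \<Phi> i \<phi> \<longrightarrow> (\<exists>\<psi>. \<Phi> (Suc i) \<psi> \<and> (\<forall>x\<in>Sk i. \<psi> x = \<phi> x))"
    and cong: "\<forall>i \<phi> \<psi>. \<Phi> i \<phi> \<longrightarrow> (\<forall>x\<in>Sk i. \<psi> x = \<phi> x) \<longrightarrow> \<Phi> i \<psi>"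
  obtains \<psi> where "\<forall>i\<ge>n. \<Phi> i \<psi>" "\<forall>x\<in>Sk n. \<psi> x = \<phi> x"
proof -
  have "\<exists>s. \<forall>k. (\<Phi> (n + k) (s k) \<and> (k = 0 \<longrightarrow> s k = \<phi>)) \<and> (\<forall>x\<in>Sk (n + k). s (Suc k) x = s k x)"
  proof (rule dependent_nat_choice)
    show "\<exists>\<psi>. \<Phi> (n + 0) \<psi> \<and> (0 = 0 \<longrightarrow> \<psi> = \<phi>)" using start by auto
    fix \<psi> k assume "\<Phi> (n + k) \<psi> \<and> (k = 0 \<longrightarrow> \<psi> = \<phi>)"
    then show "\<exists>\<psi>'. (\<Phi> (n + Suc k) \<psi>' \<and> (Suc k = 0 \<longrightarrow> \<psi>' = \<phi>)) \<and> (\<forall>x\<in>Sk (n + k). \<psi>' x = \<psi> x)"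
      using step by auto
  qed
  then obtain s where s: "\<And>k. \<Phi> (n + k) (s k)" "s 0 = \<phi>" "\<And>k x. x \<in> Sk (n + k) \<Longrightarrow> s (Suc k) x = s k x"
    by blast
  have stable: "s (k + d) x = s k x" if "x \<in> Sk (n + k)" for k d x
  proof (induction d)
    case (Suc d)
    have "x \<in> Sk (n + (k + d))" using that Sk_mono[of "n + k" "n + (k + d)"] by auto
    then show ?case using s(3) Suc by simp
  qed simp
  define \<psi> where "\<psi> = (\<lambda>x. s (LEAST k. x \<in> Sk (n + k)) x)"
  have \<psi>: "\<psi> x = s k x" if x: "x \<in> Sk (n + k)" for k x
  proof -
    let ?l = "LEAST k. x \<in> Sk (n + k)"
    have l: "x \<in> Sk (n + ?l)" "?l \<le> k" using x by (auto intro: LeastI Least_le)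
    then show ?thesis using stable[OF l(1), of "k - ?l"] by (simp add: \<psi>_def)
  qed
  have "\<Phi> i \<psi>" if "n \<le> i" for i
    using cong[rule_format, OF s(1)[of "i - n"], of \<psi>] \<psi>[of _ "i - n"] that by simp
  moreover have "\<psi> x = \<phi> x" if "x \<in> Sk n" for x using \<psi>[of x 0] that s(2) by simp
  ultimately show ?thesis using that by blast
qed

lemma smooth_upto_cong:
  assumes "smooth_upto n f" "\<And>x. x \<in> Sk n \<Longrightarrow> g x = f x"
  shows "smooth_upto n g"
  unfolding smooth_upto_def
proof (intro allI impI ballI)
  fix i j assume i: "i \<le> n" "j \<in> J i"
  interpret d: plot_space "disk i j" "dplot i j" by (rule plot_space_euc)
  have eq: "g (chi i j y) = f (chi i j y)" if "y \<in> disk i j" for y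
    using assms(2) chi_mem[OF i(2) that] Sk_mono[OF i(1)] by blast
  show "smooth_real (dplot i j) (\<lambda>y. g (chi i j y))"
    by (rule d.smooth_real_local)
      (use assms(1) i eq d.D_open_space in \<open>unfold smooth_upto_def, blast\<close>)
qed

lemma open_upto_cong:
  assumes "open_upto n L" "\<And>x. x \<in> Sk n \<Longrightarrow> L' x = L x"
  shows "open_upto n L'"
  unfolding open_upto_def
proof (intro allI impI ballI)
  fix i j c assume i: "i \<le> n" "j \<in> J i"
  have "L' (chi i j y) = L (chi i j y)" if "y \<in> disk i j" for y
    using assms(2) chi_mem[OF i(2) that] Sk_mono[OF i(1)] by blast
  then have "{y\<in>disk i j. L' (chi i j y) = Some c} = {y\<in>disk i j. L (chi i j y) = Some c}" by auto
  then show "D_open (disk i j) (dplot i j) {y\<in>disk i j. L' (chi i j y) = Some c}"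
    using assms(1) i unfolding open_upto_def by simp
qed

lemma smooth_upto_Suc:
  assumes "smooth_upto n f" "\<And>j. j \<in> J (Suc n) \<Longrightarrow> smooth_real (dplot (Suc n) j) (\<lambda>y. f (chi (Suc n) j y))"
  shows "smooth_upto (Suc n) f"
  using assms by (auto simp: smooth_upto_def le_Suc_eq)

lemma open_upto_Suc:
  assumes "open_upto n L"
    and "\<And>j c. j \<in> J (Suc n) \<Longrightarrow> D_open (disk (Suc n) j) (dplot (Suc n) j) {y\<in>disk (Suc n) j. L (chi (Suc n) j y) = Some c}"
  shows "open_upto (Suc n) L"
  using assms by (auto simp: open_upto_def le_Suc_eq)

lemma smooth_real_disk_cong:
  assumes "smooth_real (dplot n j) f" "\<And>y. y \<in> disk n j \<Longrightarrow> g y = f y"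
  shows "smooth_real (dplot n j) g"
proof -
  interpret d: plot_space "disk n j" "dplot n j" by (rule plot_space_euc)
  show ?thesis by (rule d.smooth_real_local) (use assms d.D_open_space in blast)
qed

text \<open>Attaching maps send plots of the sphere to plots of the previous skeleton, so
  \<open>f\<close> pulls back to smooth functions on the spheres. That \<open>W\<close> is open in
  \<open>X\<close>, not merely in one skeleton, makes its preimages open in the disks of all later
  levels, which carries the sign condition through the induction.\<close>

lemma function_extension:
  assumes f: "smooth_upto n f" and W: "D_open X Pl W" and sub: "\<forall>x\<in>Sk n. f x \<ge> 0 \<longrightarrow> x \<in> W"
  obtains F where "smooth_real Pl F" "\<forall>x\<in>Sk n. F x = f x" "\<forall>x\<in>X. F x \<ge> 0 \<longrightarrow> x \<in> W"
proof -
  define \<Phi> where "\<Phi> = (\<lambda>i f. smooth_upto i f \<and> (\<forall>x\<in>Sk i. f x \<ge> 0 \<longrightarrow> x \<in> W))"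
  have start: "\<Phi> n f" using f sub by (simp add: \<Phi>_def)
  have step: "\<forall>i f. \<Phi> i f \<longrightarrow> (\<exists>\<psi>. \<Phi> (Suc i) \<psi> \<and> (\<forall>x\<in>Sk i. \<psi> x = f x))"
  proof (intro allI impI)
    fix i f assume \<Phi>: "\<Phi> i f"
    have prev: "prev_skel Sk (Suc i) = Sk i" by (simp add: prev_skel_def)
    have "\<forall>j\<in>J (Suc i). \<exists>g. smooth_real (dplot (Suc i) j) g \<and> (\<forall>s\<in>sph (Suc i) j. g s = f (h (Suc i) j s)) \<and>
        (\<forall>y\<in>disk (Suc i) j. g y \<ge> 0 \<longrightarrow> chi (Suc i) j y \<in> W)"
    proof
      fix j assume j: "j \<in> J (Suc i)"
      have 1: "\<forall>k U Q. splot (Suc i) j k U Q \<longrightarrow> smooth_fun k U (\<lambda>u. f (h (Suc i) j (Q u)))"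
        using smooth_upto_plot[of i f] attach_plot[OF j] \<Phi> unfolding prev \<Phi>_def comp_def by blast
      have 2: "\<forall>s\<in>sph (Suc i) j. f (h (Suc i) j s) \<ge> 0 \<longrightarrow> s \<in> {y\<in>disk (Suc i) j. chi (Suc i) j y \<in> W}"
        using \<Phi> attach_mem[OF j] chi_sphere[OF j] fat_sphere_subset_disk[THEN subsetD]
        unfolding prev \<Phi>_def by auto
      obtain g where "smooth_real (dplot (Suc i) j) g" "\<forall>s\<in>sph (Suc i) j. g s = f (h (Suc i) j s)"
        "\<forall>x\<in>disk (Suc i) j. g x \<ge> 0 \<longrightarrow> x \<in> {y\<in>disk (Suc i) j. chi (Suc i) j y \<in> W}"
        using cell_extension[OF 1 chi_vimage_open[OF W j] 2] .
      then show "\<exists>g. smooth_real (dplot (Suc i) j) g \<and> (\<forall>s\<in>sph (Suc i) j. g s = f (h (Suc i) j s)) \<and>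
        (\<forall>y\<in>disk (Suc i) j. g y \<ge> 0 \<longrightarrow> chi (Suc i) j y \<in> W)" by blast
    qed
    then obtain g where g: "\<forall>j\<in>J (Suc i). smooth_real (dplot (Suc i) j) (g j) \<and>
        (\<forall>s\<in>sph (Suc i) j. g j s = f (h (Suc i) j s)) \<and>
        (\<forall>y\<in>disk (Suc i) j. g j y \<ge> 0 \<longrightarrow> chi (Suc i) j y \<in> W)"
      by (rule bchoice[THEN exE])
    obtain \<psi> where \<psi>: "\<forall>x\<in>prev_skel Sk (Suc i). \<psi> x = f x"
      "\<forall>j\<in>J (Suc i). \<forall>y\<in>disk (Suc i) j. \<psi> (chi (Suc i) j y) = g j y"
      using glue[of "Suc i" g f] g by blast
    have eq: "\<And>x. x \<in> Sk i \<Longrightarrow> \<psi> x = f x" using \<psi>(1) prev by simp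
    have "smooth_upto (Suc i) \<psi>"
    proof (rule smooth_upto_Suc)
      show "smooth_upto i \<psi>" using smooth_upto_cong[of i f \<psi>] eq \<Phi> by (simp add: \<Phi>_def)
      show "smooth_real (dplot (Suc i) j) (\<lambda>y. \<psi> (chi (Suc i) j y))" if "j \<in> J (Suc i)" for j
        using smooth_real_disk_cong[of "Suc i" j "g j" "\<lambda>y. \<psi> (chi (Suc i) j y)"] g \<psi>(2) that by blast
    qed
    moreover have "x \<in> W" if x: "x \<in> Sk (Suc i)" "\<psi> x \<ge> 0" for x
    proof (cases "x \<in> Sk i")
      case True
      then show ?thesis using eq x \<Phi> by (simp add: \<Phi>_def)
    next
      case False
      then obtain j y where "j \<in> J (Suc i)" "y \<in> disk (Suc i) j" "x = chi (Suc i) j y"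
        using x Sk_eq[of "Suc i"] prev by blast
      then show ?thesis using \<psi>(2) g x(2) by auto
    qed
    ultimately show "\<exists>\<psi>. \<Phi> (Suc i) \<psi> \<and> (\<forall>x\<in>Sk i. \<psi> x = f x)" using eq unfolding \<Phi>_def by blast
  qed
  have cong: "\<forall>i \<phi> \<psi>. \<Phi> i \<phi> \<longrightarrow> (\<forall>x\<in>Sk i. \<psi> x = \<phi> x) \<longrightarrow> \<Phi> i \<psi>"
    using smooth_upto_cong by (auto simp: \<Phi>_def)
  obtain F where F: "\<forall>i\<ge>n. \<Phi> i F" "\<forall>x\<in>Sk n. F x = f x"
    using extend_over_skeleta[OF start step cong] .
  have "smooth_upto i F" for i
    using F(1)[rule_format, of "max n i"] unfolding \<Phi>_def smooth_upto_def by auto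
  then have "smooth_real Pl F" by (rule smooth_all)
  moreover have "x \<in> W" if x: "x \<in> X" "F x \<ge> 0" for x
  proof -
    obtain i where "x \<in> Sk i" using x X_eq by blast
    then have "x \<in> Sk (max n i)" using Sk_mono[of i "max n i"] by auto
    then show ?thesis using F(1)[rule_format, of "max n i"] x(2) by (simp add: \<Phi>_def)
  qed
  ultimately show ?thesis using that F(2) by blast
qed

text \<open>Provides pairwise disjoint D-open sets of \<open>X\<close> around the open cells of
  level \<open>n\<close>. At the start label \<open>j\<close> sits on the part
  \<open>|u| < 1\<close> of the disk \<open>j\<close>; over later cells the labels are extended
  metrically.\<close>

lemma cell_labels:
  obtains L :: "'a \<Rightarrow> 'j option" where "\<And>c. D_open X Pl {x\<in>X. L x = Some c}"
    and "\<And>j y. j \<in> J n \<Longrightarrow> y \<in> disk n j - sph n j \<Longrightarrow> L (chi n j y) = Some j"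
proof -
  obtain L0 where L0: "\<forall>x\<in>prev_skel Sk n. L0 x = None"
    "\<forall>j\<in>J n. \<forall>y\<in>disk n j. L0 (chi n j y) = (if y \<in> sph n j then None else Some j)"
    using glue[of n "\<lambda>j y. if y \<in> sph n j then None else Some j" "\<lambda>_. None"] by auto
  have start: "open_upto n L0"
    unfolding open_upto_def
  proof (intro allI impI ballI)
    fix i j c assume i: "i \<le> n" "j \<in> J i"
    interpret d: plot_space "disk i j" "dplot i j" by (rule plot_space_euc)
    have empty: "D_open (disk i j) (dplot i j) {}" using d.D_open_Union[of "{}"] by simp
    show "D_open (disk i j) (dplot i j) {y\<in>disk i j. L0 (chi i j y) = Some c}"
    proof (cases "i = n")
      case True
      show ?thesis
      proof (cases "c = j")
        case c: True
        have "y \<in> sph i j \<longleftrightarrow> \<not> unorm i y < 1" if "y \<in> disk i j" for y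
          using that by (auto simp: fat_sphere_def fat_disk_def)
        then have "L0 (chi i j y) = Some c \<longleftrightarrow> unorm i y < 1" if "y \<in> disk i j" for y
          using L0(2) i True c that by simp
        then have "{y\<in>disk i j. L0 (chi i j y) = Some c} = {y\<in>disk i j. unorm i y < 1}" by blast
        also have "openin (top_of_set (disk i j)) \<dots>"
          using continuous_openin_preimage_gen[OF continuous_on_unorm open_lessThan, of "disk i j" i 1]
          by (simp add: vimage_def Int_def)
        finally show ?thesis by (rule openin_imp_D_open)
      next
        case c: False
        then have "{y\<in>disk i j. L0 (chi i j y) = Some c} = {}" using L0(2) i True by auto
        then show ?thesis by (simp only: empty)
      qed
    next
      case False
      then have "Sk i \<subseteq> prev_skel Sk n" using i Sk_mono[of i "n - 1"] by (auto simp: prev_skel_def)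
      then have "{y\<in>disk i j. L0 (chi i j y) = Some c} = {}" using L0(1) chi_mem[OF i(2)] by fastforce
      then show ?thesis by (simp only: empty)
    qed
  qed
  have step: "\<forall>i L. open_upto i (L :: 'a \<Rightarrow> 'j option) \<longrightarrow> (\<exists>\<psi>. open_upto (Suc i) \<psi> \<and> (\<forall>x\<in>Sk i. \<psi> x = L x))"
  proof (intro allI impI)
    fix i and L :: "'a \<Rightarrow> 'j option" assume L: "open_upto i L"
    have prev: "prev_skel Sk (Suc i) = Sk i" by (simp add: prev_skel_def)
    have "\<forall>j\<in>J (Suc i). \<exists>g. (\<forall>s\<in>sph (Suc i) j. g s = L (h (Suc i) j s)) \<and>
       (\<forall>c. openin (top_of_set (disk (Suc i) j)) {x\<in>disk (Suc i) j. g x = Some c})"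
    proof
      fix j assume j: "j \<in> J (Suc i)"
      \<comment> \<open>The metric extension needs sets that are open in the subspace topology,
        while the attaching map yields D-open ones; on the fat sphere these agree.\<close>
      have op: "openin (top_of_set (sph (Suc i) j)) {s\<in>sph (Suc i) j. L (h (Suc i) j s) = Some c}" for c
      proof (rule sphere_D_open_imp_openin, unfold D_open_def, intro conjI allI impI)
        fix k U Q assume Q: "splot (Suc i) j k U Q"
        have "open_euc k {u\<in>U. L ((h (Suc i) j \<circ> Q) u) = Some c}"
          using open_upto_plot[OF L] attach_plot[OF j Q] unfolding prev by blast
        moreover have "{u\<in>U. Q u \<in> {s\<in>sph (Suc i) j. L (h (Suc i) j s) = Some c}} = {u\<in>U. L ((h (Suc i) j \<circ> Q) u) = Some c}"
          using Q by (auto simp: euc_plot_def)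
        ultimately show "open_euc k {u\<in>U. Q u \<in> {s\<in>sph (Suc i) j. L (h (Suc i) j s) = Some c}}" by simp
      qed auto
      show "\<exists>g. (\<forall>s\<in>sph (Suc i) j. g s = L (h (Suc i) j s)) \<and>
       (\<forall>c. openin (top_of_set (disk (Suc i) j)) {x\<in>disk (Suc i) j. g x = Some c})"
        by (rule label_extension[of "sph (Suc i) j" "\<lambda>s. L (h (Suc i) j s)" "disk (Suc i) j", OF op])
          (intro exI conjI)
    qed
    then obtain g where g: "\<forall>j\<in>J (Suc i). (\<forall>s\<in>sph (Suc i) j. g j s = L (h (Suc i) j s)) \<and>
       (\<forall>c. openin (top_of_set (disk (Suc i) j)) {x\<in>disk (Suc i) j. g j x = Some c})"
      by (rule bchoice[THEN exE])
    obtain \<psi> where \<psi>: "\<forall>x\<in>prev_skel Sk (Suc i). \<psi> x = L x"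
      "\<forall>j\<in>J (Suc i). \<forall>y\<in>disk (Suc i) j. \<psi> (chi (Suc i) j y) = g j y"
      using glue[of "Suc i" g L] g by blast
    have eq: "\<And>x. x \<in> Sk i \<Longrightarrow> \<psi> x = L x" using \<psi>(1) prev by simp
    have "open_upto (Suc i) \<psi>"
    proof (rule open_upto_Suc)
      show "open_upto i \<psi>" using open_upto_cong[of i L \<psi>] eq L by simp
      fix j c assume j: "j \<in> J (Suc i)"
      have "{y\<in>disk (Suc i) j. \<psi> (chi (Suc i) j y) = Some c} = {y\<in>disk (Suc i) j. g j y = Some c}"
        using \<psi>(2) j by auto
      then show "D_open (disk (Suc i) j) (dplot (Suc i) j) {y\<in>disk (Suc i) j. \<psi> (chi (Suc i) j y) = Some c}"
        using g j by (simp add: openin_imp_D_open)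
    qed
    then show "\<exists>\<psi>. open_upto (Suc i) \<psi> \<and> (\<forall>x\<in>Sk i. \<psi> x = L x)" using eq by blast
  qed
  have cong: "\<forall>i \<phi> \<psi>. open_upto i \<phi> \<longrightarrow> (\<forall>x\<in>Sk i. \<psi> x = \<phi> x) \<longrightarrow> open_upto i (\<psi> :: 'a \<Rightarrow> 'j option)"
    using open_upto_cong by blast
  obtain L where L: "\<forall>i\<ge>n. open_upto i L" "\<forall>x\<in>Sk n. L x = L0 x"
    using extend_over_skeleta[OF start step cong] .
  have "open_upto i L" for i
    using L(1)[rule_format, of "max n i"] unfolding open_upto_def by auto
  then have "D_open X Pl {x\<in>X. L x = Some c}" for c by (rule open_all)
  moreover have "L (chi n j y) = Some j" if "j \<in> J n" "y \<in> disk n j - sph n j" for j y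
    using L(2) chi_mem L0(2) that by auto
  ultimately show ?thesis using that by blast
qed

text \<open>The hypotheses of \<open>partition_of_unity_countable\<close>, with positivity demanded
  only at the points that are new at level \<open>n\<close>.\<close>

definition level_family :: "'a set set \<Rightarrow> nat \<Rightarrow> (nat \<Rightarrow> 'a \<Rightarrow> real) \<Rightarrow> (nat \<Rightarrow> 'a set \<Rightarrow> 'a set) \<Rightarrow> bool" where
  "level_family \<U> n F Y \<longleftrightarrow> (\<forall>p. smooth_real Pl (F p)) \<and>
    (\<forall>p. \<forall>U\<in>\<U>. D_open X Pl (Y p U) \<and> Y p U \<subseteq> U) \<and>
    (\<forall>p. \<forall>U\<in>\<U>. \<forall>V\<in>\<U>. U \<noteq> V \<longrightarrow> Y p U \<inter> Y p V = {}) \<and>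
    (\<forall>p. \<forall>x\<in>X. F p x \<ge> 0 \<longrightarrow> (\<exists>U\<in>\<U>. x \<in> Y p U)) \<and>
    (\<forall>x\<in>Sk n - prev_skel Sk n. \<exists>p. F p x > 0)"

lemma level_functions:
  assumes \<U>: "\<forall>U\<in>\<U>. D_open X Pl U" and cov: "\<Union>\<U> = X"
  shows "\<exists>F Y. level_family \<U> n F Y"
proof -
  \<comment> \<open>The balls also avoid the sphere, so each bump is -1 there and glues with the
    constant -1 on the previous skeleton.\<close>
  define Pr where "Pr = (\<lambda>j e x U. U \<in> \<U> \<and> (\<forall>y\<in>disk n j. edist (n + m n j) x y < e \<longrightarrow> chi n j y \<in> U \<and> y \<notin> sph n j))"
  let ?bumps = "\<lambda>j. bump_family (n + m n j) (disk n j - sph n j) (Pr j)"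
  have "\<forall>j\<in>J n. \<exists>bu. ?bumps j (fst bu) (snd bu)"
  proof
    fix j assume j: "j \<in> J n"
    have Prex: "\<forall>x\<in>disk n j - sph n j. \<exists>e>0. \<exists>U. Pr j e x U"
    proof
      fix x assume x: "x \<in> disk n j - sph n j"
      then have "chi n j x \<in> X" using chi_mem[OF j] X_eq by blast
      then obtain U where U: "U \<in> \<U>" "chi n j x \<in> U" using cov by blast
      have "openin (top_of_set (disk n j)) {y\<in>disk n j. chi n j y \<in> U}"
        by (rule disk_D_open_imp_openin[OF chi_vimage_open[OF \<U>[rule_format, OF U(1)] j]])
      moreover have "openin (top_of_set (disk n j)) {y\<in>disk n j. unorm n y < 1}"
        using continuous_openin_preimage_gen[OF continuous_on_unorm open_lessThan, of "disk n j" n 1]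
        by (simp add: vimage_def Int_def)
      ultimately have "openin (top_of_set (disk n j)) ({y\<in>disk n j. chi n j y \<in> U} \<inter> {y\<in>disk n j. unorm n y < 1})"
        by (rule openin_Int)
      moreover have "x \<in> {y\<in>disk n j. chi n j y \<in> U} \<inter> {y\<in>disk n j. unorm n y < 1}"
        using x U by (auto simp: fat_disk_def fat_sphere_def)
      ultimately obtain e where e: "e > 0" "\<forall>y\<in>disk n j. edist (n + m n j) x y < e \<longrightarrow>
          y \<in> {y\<in>disk n j. chi n j y \<in> U} \<inter> {y\<in>disk n j. unorm n y < 1}"
        using openin_ball_euc[OF _ _ fat_disk_euc] by blast
      then have "Pr j e x U" using U(1) by (auto simp: Pr_def fat_sphere_def)
      then show "\<exists>e>0. \<exists>U. Pr j e x U" using e(1) by blast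
    qed
    have "disk n j - sph n j \<subseteq> euc (n + m n j)" using fat_disk_euc by blast
    then obtain b u where "?bumps j b u" using bump_sequence[OF _ Prex] by blast
    then show "\<exists>bu. ?bumps j (fst bu) (snd bu)" by (intro exI[of _ "(b, u)"]) simp
  qed
  from bchoice[OF this] obtain bu where bu: "\<forall>j\<in>J n. ?bumps j (fst (bu j)) (snd (bu j))" ..
  define b where "b = (\<lambda>j. fst (bu j))"
  define u where "u = (\<lambda>j. snd (bu j))"
  have b: "smooth_fun (n + m n j) (euc (n + m n j)) (b j p)"
    "(\<forall>y. b j p y = -1) \<or> (\<exists>x\<in>disk n j - sph n j. \<exists>e>0. Pr j e x (u j p) \<and>
       (\<forall>y. edist (n + m n j) x y \<ge> e \<longrightarrow> b j p y = -1))"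
    "y \<in> disk n j - sph n j \<Longrightarrow> \<exists>p. b j p y > 0" if "j \<in> J n" for j p y
    using bu that unfolding b_def u_def bump_family_def by blast+
  have bval: "b j p y = -1 \<or> u j p \<in> \<U> \<and> chi n j y \<in> u j p \<and> y \<notin> sph n j"
    if jy: "j \<in> J n" "y \<in> disk n j" for j p y
  proof (cases "b j p y = -1")
    case False
    then obtain x e where "Pr j e x (u j p)" "\<forall>y. edist (n + m n j) x y \<ge> e \<longrightarrow> b j p y = -1"
      using b(2)[OF jy(1), of p] by blast
    moreover from this have "edist (n + m n j) x y < e" using False not_le by blast
    ultimately show ?thesis using jy by (auto simp: Pr_def)
  qed simp
  have "\<forall>p. \<exists>f. (\<forall>x\<in>prev_skel Sk n. f x = -1) \<and> (\<forall>j\<in>J n. \<forall>y\<in>disk n j. f (chi n j y) = b j p y)"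
  proof
    fix p
    show "\<exists>f. (\<forall>x\<in>prev_skel Sk n. f x = -1) \<and> (\<forall>j\<in>J n. \<forall>y\<in>disk n j. f (chi n j y) = b j p y)"
    proof (rule glue[of n "\<lambda>j. b j p" "\<lambda>_. -1"])
      show "b j p s = -1" if "j \<in> J n" "s \<in> sph n j" for j s
        using bval[of j s p] that fat_sphere_subset_disk by blast
    qed (intro exI conjI)
  qed
  from choice[OF this] obtain f where f0: "\<forall>p. (\<forall>x\<in>prev_skel Sk n. f p x = -1) \<and>
    (\<forall>j\<in>J n. \<forall>y\<in>disk n j. f p (chi n j y) = b j p y)" ..
  have f: "x \<in> prev_skel Sk n \<Longrightarrow> f p x = -1"
    "j \<in> J n \<Longrightarrow> y \<in> disk n j \<Longrightarrow> f p (chi n j y) = b j p y" for p x j y using f0 by auto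
  have smooth: "smooth_upto n (f p)" for p
    unfolding smooth_upto_def
  proof (intro allI impI ballI)
    fix i j assume i: "i \<le> n" "j \<in> J i"
    interpret d: plot_space "disk i j" "dplot i j" by (rule plot_space_euc)
    show "smooth_real (dplot i j) (\<lambda>y. f p (chi i j y))"
    proof (cases "i = n")
      case True
      have "smooth_real (dplot n j) (b j p)"
        using b(1) i True by (intro smooth_real_restrict[OF _ fat_disk_euc]) auto
      then have "smooth_real (dplot n j) (\<lambda>y. f p (chi n j y))"
        by (rule smooth_real_disk_cong) (use f(2) i True in simp)
      then show ?thesis using True by simp
    next
      case False
      then have "Sk i \<subseteq> prev_skel Sk n" using i Sk_mono[of i "n - 1"] by (auto simp: prev_skel_def)
      then have "f p (chi i j y) = -1" if "y \<in> disk i j" for y using f(1) chi_mem[OF i(2) that] by blast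
      then show ?thesis by (rule smooth_real_disk_cong[OF d.smooth_real_const[of "-1"]])
    qed
  qed
  obtain L :: "'a \<Rightarrow> 'j option" where L: "\<And>c. D_open X Pl {x\<in>X. L x = Some c}"
    "\<And>j y. j \<in> J n \<Longrightarrow> y \<in> disk n j - sph n j \<Longrightarrow> L (chi n j y) = Some j"
    using cell_labels[of n] by blast
  \<comment> \<open>\<open>Y p U\<close> collects the neighbourhoods of the cells whose
    \<open>p\<close>-th bump is labelled by \<open>U\<close>. A cell has one label for each
    \<open>p\<close>, so different \<open>U\<close> use different cells and the sets are
    disjoint.\<close>
  define Y where "Y = (\<lambda>p U. (\<Union>j\<in>{j. u j p = U}. {x\<in>X. L x = Some j}) \<inter> U)"
  have Yo: "D_open X Pl (Y p U)" if "U \<in> \<U>" for p U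
    unfolding Y_def by (intro D_open_Int D_open_Union \<U>[rule_format, OF that]) (use L(1) in auto)
  have Ydisj: "Y p U \<inter> Y p V = {}" if "U \<noteq> V" for p U V using that by (auto simp: Y_def)
  define W where "W = (\<lambda>p. \<Union>U\<in>\<U>. Y p U)"
  have Wo: "D_open X Pl (W p)" for p unfolding W_def by (intro D_open_Union) (use Yo in auto)
  have fW: "\<forall>x\<in>Sk n. f p x \<ge> 0 \<longrightarrow> x \<in> W p" for p
  proof (intro ballI impI)
    fix x assume x: "x \<in> Sk n" "f p x \<ge> 0"
    have "x \<notin> prev_skel Sk n" using f(1)[of x p] x by auto
    then obtain j y where jy: "j \<in> J n" "y \<in> disk n j" "x = chi n j y" using x Sk_eq[of n] by blast
    then have "b j p y \<noteq> -1" using f(2) x by auto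
    then have "u j p \<in> \<U>" "chi n j y \<in> u j p" "y \<notin> sph n j" using bval[OF jy(1,2), of p] by auto
    moreover have "x \<in> X" using x X_eq by blast
    ultimately show "x \<in> W p" using L(2)[OF jy(1), of y] jy unfolding W_def Y_def by blast
  qed
  have "\<forall>p. \<exists>F. smooth_real Pl F \<and> (\<forall>x\<in>Sk n. F x = f p x) \<and> (\<forall>x\<in>X. F x \<ge> 0 \<longrightarrow> x \<in> W p)"
  proof
    fix p
    obtain F where "smooth_real Pl F" "\<forall>x\<in>Sk n. F x = f p x" "\<forall>x\<in>X. F x \<ge> 0 \<longrightarrow> x \<in> W p"
      using function_extension[OF smooth Wo fW] .
    then show "\<exists>F. smooth_real Pl F \<and> (\<forall>x\<in>Sk n. F x = f p x) \<and> (\<forall>x\<in>X. F x \<ge> 0 \<longrightarrow> x \<in> W p)" by blast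
  qed
  then obtain F where F: "\<forall>p. smooth_real Pl (F p) \<and> (\<forall>x\<in>Sk n. F p x = f p x) \<and> (\<forall>x\<in>X. F p x \<ge> 0 \<longrightarrow> x \<in> W p)"
    by (rule choice[THEN exE])
  have pos: "\<exists>p. F p x > 0" if x: "x \<in> Sk n - prev_skel Sk n" for x
  proof -
    obtain j y where jy: "j \<in> J n" "y \<in> disk n j" "x = chi n j y" using x Sk_eq[of n] by blast
    then have "y \<notin> sph n j" using x chi_sphere attach_mem by auto
    then obtain p where "b j p y > 0" using b(3)[OF jy(1), of y] jy by blast
    then show ?thesis using F f(2)[OF jy(1,2), of p] jy x by (intro exI[of _ p]) auto
  qed
  show ?thesis unfolding level_family_def
  proof (intro exI[of _ F] exI[of _ Y] conjI)
    show "\<forall>p. \<forall>U\<in>\<U>. D_open X Pl (Y p U) \<and> Y p U \<subseteq> U" using Yo by (auto simp: Y_def)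
    show "\<forall>p. \<forall>x\<in>X. F p x \<ge> 0 \<longrightarrow> (\<exists>U\<in>\<U>. x \<in> Y p U)" using F by (auto simp: W_def)
  qed (use F Ydisj pos in auto)
qed

theorem partition_of_unity:
  assumes \<U>: "\<forall>U\<in>\<U>. D_open X Pl U" and cov: "\<Union>\<U> = X"
  shows "\<exists>\<rho>. subordinate_partition X Pl \<U> \<rho>"
proof -
  have "\<forall>n. \<exists>F Y. level_family \<U> n F Y" using level_functions[OF \<U> cov] by blast
  from choice[OF this] obtain F where "\<forall>n. \<exists>Y. level_family \<U> n (F n) Y" ..
  from choice[OF this] obtain Y where good: "\<forall>n. level_family \<U> n (F n) (Y n)" ..
  note parts = good[unfolded level_family_def, THEN spec]
  note good_parts = parts[THEN conjunct1] parts[THEN conjunct2, THEN conjunct1]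
    parts[THEN conjunct2, THEN conjunct2, THEN conjunct1]
    parts[THEN conjunct2, THEN conjunct2, THEN conjunct2, THEN conjunct1]
    parts[THEN conjunct2, THEN conjunct2, THEN conjunct2, THEN conjunct2]
  \<comment> \<open>The pairing function merges level and index into one sequence; a point is
    covered at the least level containing it.\<close>
  define F' where "F' = (\<lambda>p. F (fst (prod_decode p)) (snd (prod_decode p)))"
  define Y' where "Y' = (\<lambda>p. Y (fst (prod_decode p)) (snd (prod_decode p)))"
  show ?thesis
  proof (rule partition_of_unity_countable[of F' \<U> Y'])
    fix x assume x: "x \<in> X"
    define n where "n = (LEAST n. x \<in> Sk n)"
    have "\<exists>n. x \<in> Sk n" using x X_eq by blast
    then have n: "x \<in> Sk n" unfolding n_def by (rule LeastI_ex)
    have "x \<notin> prev_skel Sk n"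
    proof (cases n)
      case (Suc k)
      then have "k < n" by simp
      then have "x \<notin> Sk k" using not_less_Least[of k "\<lambda>n. x \<in> Sk n"] unfolding n_def by blast
      then show ?thesis using Suc by (simp add: prev_skel_def)
    qed (simp add: prev_skel_def)
    then obtain p where "F n p x > 0" using good_parts(5)[of n] n by blast
    then have "F' (prod_encode (n, p)) x > 0" by (simp add: F'_def)
    then show "\<exists>p. F' p x > 0" by blast
  qed (use good_parts(1-4) in \<open>auto simp: F'_def Y'_def\<close>)
qed

end

theorem theorem6p1:
  fixes X :: "'a set" and Pl :: "'a plots"
    and Sk :: "nat \<Rightarrow> 'a set" and J :: "nat \<Rightarrow> 'j set" and m :: "nat \<Rightarrow> 'j \<Rightarrow> nat"
    and h :: "nat \<Rightarrow> 'j \<Rightarrow> (nat \<Rightarrow> real) \<Rightarrow> 'a"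
    and \<U> :: "'a set set"
  assumes "fat_CW X Pl Sk J m h"
    and "\<forall>U\<in>\<U>. D_open X Pl U"
    and "\<Union>\<U> = X"
  shows "\<exists>\<rho> :: 'a set \<Rightarrow> 'a \<Rightarrow> real.
    (\<forall>U\<in>\<U>. smooth_real Pl (\<rho> U)) \<and>
    (\<forall>U\<in>\<U>. \<forall>x\<in>X. 0 \<le> \<rho> U x \<and> \<rho> U x \<le> 1) \<and>
    (\<forall>U\<in>\<U>. D_support X Pl (\<rho> U) \<subseteq> U) \<and>
    (\<forall>x\<in>X. \<exists>W. D_open X Pl W \<and> x \<in> W \<and>
        finite {U\<in>\<U>. D_support X Pl (\<rho> U) \<inter> W \<noteq> {}}) \<and>
    (\<forall>x\<in>X. (\<Sum>U\<in>{U\<in>\<U>. \<rho> U x \<noteq> 0}. \<rho> U x) = 1)"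
proof -
  have "\<forall>n. \<exists>chi. pushout_cond X Pl n (prev_skel Sk n) (Sk n) (J n) (m n) (h n) chi"
    by (rule assms(1)[unfolded fat_CW_def, THEN conjunct2, THEN conjunct1])
  then obtain chi where chi: "\<forall>n. pushout_cond X Pl n (prev_skel Sk n) (Sk n) (J n) (m n) (h n) (chi n)"
    by (rule choice[THEN exE])
  interpret fat_cw_complex X Pl Sk J m h chi
  proof
    show "diffeology X Pl" by (rule assms(1)[unfolded fat_CW_def, THEN conjunct1])
    show "pushout_cond X Pl n (prev_skel Sk n) (Sk n) (J n) (m n) (h n) (chi n)" for n
      using chi by blast
    show "X = (\<Union>n. Sk n)"
      by (rule assms(1)[unfolded fat_CW_def, THEN conjunct2, THEN conjunct2, THEN conjunct1])
    show "\<exists>V n. open_euc k V \<and> u \<in> V \<and> V \<subseteq> U \<and> P ` V \<subseteq> Sk n" if "Pl k U P" "u \<in> U" for k U P u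
      by (rule assms(1)[unfolded fat_CW_def, THEN conjunct2, THEN conjunct2, THEN conjunct2, rule_format, OF that])
  qed
  show ?thesis using partition_of_unity[OF assms(2,3)] unfolding subordinate_partition_def .
qed

end
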